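(* Let $n\ge 1$, let $2<p<\infty$, and let $\Omega\subset\mathbb R^n$ be a bounded, non-empty, open set. If $y\in\partial\Omega$ satisfies the measure density condition, then $y$ is game regular (for the tug-of-war with noise with parameters $n$, $p$).
   Context: Notation: $B_r(x)=\{z\in\mathbb R^n:|z-x|<r\}$, $|\cdot|$ applied to sets is Lebesgue measure, $\Omega^c=\mathbb R^n\setminus\Omega$. Measure density condition: a point $y\in\partial\Omega$ satisfies a measure density condition if there is $c>0$ such that $|\Omega^c\cap B_r(y)|\ge c|B_r(y)|$ for all $r>0$. Tug-of-war with noise: let $\alpha=\frac{p-2}{p+n}$ and $\beta=\frac{n+2}{p+n}$ (so $\alpha+\beta=1$). Fix a step size $\epsilon>0$ and a starting point $x_0\in\Omega$. Let $\Gamma_\epsilon=\{z\in\mathbb R^n\setminus\Omega:\inf_{w\in\partial\Omega}|z-w|\le\epsilon\}$ and $\Omega_\epsilon=\Omega\cup\Gamma_\epsilon$, so that $B_\epsilon(x)\subset\Omega_\epsilon$ for every $x\in\Omega$. Let $\mathcal C=\{0,1,2\}$ (0: Player 1 wins the round, 1: Player 2 wins the round, 2: random move). A history up to step $k$ is $h_k=(x_0,(c_1,x_1),\dots,(c_k,x_k))\in H^k:=\{x_0\}\times(\mathcal C\times\Omega_\epsilon)^k$. A strategy for Player $i$ ($i=1,2$) is a sequence $S_i=(S_{i,k})_{k\ge0}$ of Borel measurable functions $S_{i,k}:H^k\to\mathbb R^n$ with $S_{i,k}(h_k)\in B_\epsilon(x_k)$ whenever $x_k\in\Omega$. Given $x_0,S_1,S_2$,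 the probability measure $\mathbb P^{x_0}_{S_1,S_2}$ on the space of infinite game sequences is the one determined (via Kolmogorov's extension theorem) by the following transition probabilities: given $h_k$ with $x_k\in\Omega$, for $C\subset\mathcal C$ and Borel $A\subset\Omega_\epsilon$, the probability that $c_{k+1}\in C$ and $x_{k+1}\in A$ is $$\tfrac{\alpha}{2}\delta_0(C)\,\delta_{S_{1,k}(h_k)}(A)+\tfrac{\alpha}{2}\delta_1(C)\,\delta_{S_{2,k}(h_k)}(A)+\beta\,\delta_2(C)\,\frac{|A\cap B_\epsilon(x_k)|}{|B_\epsilon(x_k)|};$$ if $x_k\notin\Omega$, then $x_{k+1}=x_k$. The game ends at the stopping time $\tau=\inf\{k\ge0:x_k\in\Gamma_\epsilon\}$, which is almost surely finite. Game regularity: a point $y\in\partial\Omega$ is game regular if for all $\delta>0$ and $\eta>0$ there exist $\delta_0>0$ and $\epsilon_0>0$ such that for every fixed $0<\epsilon<\epsilon_0$ and every starting point $x_0\in B_{\delta_0}(y)\cap\Omega$ there is a strategy $S_1^*$ for Player 1 such that, for every strategy $S_2$ of Player 2, $$\mathbb P^{x_0}_{S_1^*,S_2}\big(x_\tau\in B_\delta(y)\cap\Omega^c\big)\ge 1-\eta .$$ *)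

theory Defs
  imports "HOL-Probability.Probability"
begin

definition measure_density_condition :: "(real ^ 'n) set \<Rightarrow> real ^ 'n \<Rightarrow> bool" where
  "measure_density_condition \<Omega> y \<longleftrightarrow>
    (\<exists>c>0. \<forall>r>0. measure lebesgue ((- \<Omega>) \<inter> ball y r) \<ge> c * measure lebesgue (ball y r))"

definition boundary_strip :: "(real ^ 'n) set \<Rightarrow> real \<Rightarrow> (real ^ 'n) set" where
  "boundary_strip \<Omega> \<epsilon> = {z \<in> - \<Omega>. infdist z (frontier \<Omega>) \<le> \<epsilon>}"

definition enlarged_domain :: "(real ^ 'n) set \<Rightarrow> real \<Rightarrow> (real ^ 'n) set" where
  "enlarged_domain \<Omega> \<epsilon> = \<Omega> \<union> boundary_strip \<Omega> \<epsilon>"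

text \<open>
  One round produces a pair (c, x) of a round result c (0: Player 1 wins the round, 1: Player 2
  wins the round, 2: random move) and the new position x.
\<close>

definition round_space :: "(real ^ 'n) set \<Rightarrow> real \<Rightarrow> (nat \<times> (real ^ 'n)) measure" where
  "round_space \<Omega> \<epsilon> = count_space {0, 1, 2} \<Otimes>\<^sub>M restrict_space borel (enlarged_domain \<Omega> \<epsilon>)"

text \<open>
  The starting point is kept outside the sequences: the history
  (x0, (c1, x1), ..., (ck, xk)) is represented by x0 together with a function h on
  {0..<k} such that h j is the pair with index j + 1. Infinite game sequences are encoded
  in the same way by functions on the natural numbers.
\<close>

definition history_space :: "(real ^ 'n) set \<Rightarrow> real \<Rightarrow> nat \<Rightarrow> (nat \<Rightarrow> nat \<times> (real ^ 'n)) measure" where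
  "history_space \<Omega> \<epsilon> k = PiM {0..<k} (\<lambda>_. round_space \<Omega> \<epsilon>)"

fun position :: "real ^ 'n \<Rightarrow> (nat \<Rightarrow> nat \<times> (real ^ 'n)) \<Rightarrow> nat \<Rightarrow> real ^ 'n" where
  "position x0 h 0 = x0"
| "position x0 h (Suc k) = snd (h k)"

definition strategy ::
  "(real ^ 'n) set \<Rightarrow> real \<Rightarrow> real ^ 'n \<Rightarrow> (nat \<Rightarrow> (nat \<Rightarrow> nat \<times> (real ^ 'n)) \<Rightarrow> real ^ 'n) \<Rightarrow> bool" where
  "strategy \<Omega> \<epsilon> x0 S \<longleftrightarrow>
    (\<forall>k. S k \<in> borel_measurable (history_space \<Omega> \<epsilon> k) \<and>
      (\<forall>h \<in> space (history_space \<Omega> \<epsilon> k).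
        position x0 h k \<in> \<Omega> \<longrightarrow> S k h \<in> ball (position x0 h k) \<epsilon>))"

definition game_alpha :: "'n itself \<Rightarrow> real \<Rightarrow> real" where
  "game_alpha _ p = (p - 2) / (p + real CARD('n))"

definition game_beta :: "'n itself \<Rightarrow> real \<Rightarrow> real" where
  "game_beta _ p = (real CARD('n) + 2) / (p + real CARD('n))"

definition move_measure ::
  "real \<Rightarrow> (real ^ 'n) set \<Rightarrow> real \<Rightarrow> real ^ 'n \<Rightarrow> real ^ 'n \<Rightarrow> real ^ 'n \<Rightarrow> (nat \<times> (real ^ 'n)) measure" where
  "move_measure p \<Omega> \<epsilon> s1 s2 x =
    measure_of (space (round_space \<Omega> \<epsilon>)) (sets (round_space \<Omega> \<epsilon>))
      (\<lambda>E. ennreal (game_alpha TYPE('n) p / 2) * indicator E (0, s1)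
         + ennreal (game_alpha TYPE('n) p / 2) * indicator E (1, s2)
         + ennreal (game_beta TYPE('n) p) *
             (emeasure lborel ({z. (2, z) \<in> E} \<inter> ball x \<epsilon>) / emeasure lborel (ball x \<epsilon>)))"

text \<open>
  Once the position has left \<open>\<Omega>\<close> it stays fixed. The round result recorded after that is
  irrelevant to the game; it is set to 2.
\<close>

definition transition ::
  "real \<Rightarrow> (real ^ 'n) set \<Rightarrow> real \<Rightarrow> real ^ 'n \<Rightarrow>
    (nat \<Rightarrow> (nat \<Rightarrow> nat \<times> (real ^ 'n)) \<Rightarrow> real ^ 'n) \<Rightarrow>
    (nat \<Rightarrow> (nat \<Rightarrow> nat \<times> (real ^ 'n)) \<Rightarrow> real ^ 'n) \<Rightarrow>
    nat \<Rightarrow> (nat \<Rightarrow> nat \<times> (real ^ 'n)) \<Rightarrow> (nat \<times> (real ^ 'n)) measure" where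
  "transition p \<Omega> \<epsilon> x0 S1 S2 k h =
    (if position x0 h k \<in> \<Omega>
     then move_measure p \<Omega> \<epsilon> (S1 k h) (S2 k h) (position x0 h k)
     else return (round_space \<Omega> \<epsilon>) (2, position x0 h k))"

text \<open>
  The measure on infinite game sequences is the Ionescu-Tulcea extension of the transition
  kernels; the assumptions of that construction are verified in
  \<open>Ionescu_Tulcea_transition\<close> below.
\<close>

definition game_measure ::
  "real \<Rightarrow> (real ^ 'n) set \<Rightarrow> real \<Rightarrow> real ^ 'n \<Rightarrow>
    (nat \<Rightarrow> (nat \<Rightarrow> nat \<times> (real ^ 'n)) \<Rightarrow> real ^ 'n) \<Rightarrow>
    (nat \<Rightarrow> (nat \<Rightarrow> nat \<times> (real ^ 'n)) \<Rightarrow> real ^ 'n) \<Rightarrow>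
    (nat \<Rightarrow> nat \<times> (real ^ 'n)) measure" where
  "game_measure p \<Omega> \<epsilon> x0 S1 S2 =
    projective_family.lim UNIV
      (Ionescu_Tulcea.CI (transition p \<Omega> \<epsilon> x0 S1 S2) (\<lambda>_. round_space \<Omega> \<epsilon>))
      (\<lambda>_. round_space \<Omega> \<epsilon>)"

definition exit_time ::
  "(real ^ 'n) set \<Rightarrow> real \<Rightarrow> real ^ 'n \<Rightarrow> (nat \<Rightarrow> nat \<times> (real ^ 'n)) \<Rightarrow> enat" where
  "exit_time \<Omega> \<epsilon> x0 \<omega> = (INF k \<in> {k. position x0 \<omega> k \<in> boundary_strip \<Omega> \<epsilon>}. enat k)"

definition game_regular :: "real \<Rightarrow> (real ^ 'n) set \<Rightarrow> real ^ 'n \<Rightarrow> bool" where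
  "game_regular p \<Omega> y \<longleftrightarrow>
    (\<forall>\<delta>>0. \<forall>\<eta>>0. \<exists>\<delta>0>0. \<exists>\<epsilon>0>0.
      \<forall>\<epsilon>. 0 < \<epsilon> \<and> \<epsilon> < \<epsilon>0 \<longrightarrow>
        (\<forall>x0 \<in> ball y \<delta>0 \<inter> \<Omega>.
          \<exists>S1. strategy \<Omega> \<epsilon> x0 S1 \<and>
            (\<forall>S2. strategy \<Omega> \<epsilon> x0 S2 \<longrightarrow>
              measure (game_measure p \<Omega> \<epsilon> x0 S1 S2)
                {\<omega> \<in> space (game_measure p \<Omega> \<epsilon> x0 S1 S2).
                  exit_time \<Omega> \<epsilon> x0 \<omega> < \<infinity> \<and>
                  position x0 \<omega> (the_enat (exit_time \<Omega> \<epsilon> x0 \<omega>)) \<in> ball y \<delta> \<inter> - \<Omega>}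
              \<ge> 1 - \<eta>)))"

lemma enlarged_domain_borel [measurable]:
  assumes "open \<Omega>" shows "enlarged_domain \<Omega> \<epsilon> \<in> sets borel"
proof -
  have "closed (- \<Omega> \<inter> {z. infdist z (frontier \<Omega>) \<le> \<epsilon>})"
    using assms by (intro closed_Int closed_Collect_le continuous_intros) (auto simp: closed_def)
  moreover have "boundary_strip \<Omega> \<epsilon> = - \<Omega> \<inter> {z. infdist z (frontier \<Omega>) \<le> \<epsilon>}"
    by (auto simp: boundary_strip_def)
  ultimately show ?thesis
    using assms by (auto simp: enlarged_domain_def)
qed

lemma ball_subset_enlarged_domain:
  fixes \<Omega> :: "(real ^ 'n) set"
  assumes "open \<Omega>" "x \<in> \<Omega>"
  shows "ball x \<epsilon> \<subseteq> enlarged_domain \<Omega> \<epsilon>"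
proof
  fix z assume z: "z \<in> ball x \<epsilon>"
  show "z \<in> enlarged_domain \<Omega> \<epsilon>"
  proof (cases "z \<in> \<Omega>")
    case False
    have "closed_segment x z \<inter> frontier \<Omega> \<noteq> {}"
      using assms False by (intro connected_Int_frontier) (auto simp: False)
    then obtain w where w: "w \<in> closed_segment x z" "w \<in> frontier \<Omega>" by auto
    have "infdist z (frontier \<Omega>) \<le> dist z w"
      using w by (intro infdist_le)
    also have "\<dots> \<le> dist z x"
      using dist_in_closed_segment[OF w(1)] by (simp add: dist_commute)
    finally show ?thesis
      using z False by (auto simp: enlarged_domain_def boundary_strip_def dist_commute)
  qed (auto simp: enlarged_domain_def)
qed

lemma space_round_space: "space (round_space \<Omega> \<epsilon>) = {0, 1, 2} \<times> enlarged_domain \<Omega> \<epsilon>"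
  by (auto simp: round_space_def space_pair_measure space_restrict_space)

lemma position_measurable:
  "(\<lambda>h. position x0 h k) \<in> borel_measurable (history_space \<Omega> \<epsilon> k)"
proof (cases k)
  case (Suc j)
  have a: "(\<lambda>h. h j) \<in> measurable (history_space \<Omega> \<epsilon> k) (round_space \<Omega> \<epsilon>)"
    unfolding history_space_def by (rule measurable_component_singleton) (simp add: Suc)
  have b: "snd \<in> measurable (round_space \<Omega> \<epsilon>) (restrict_space borel (enlarged_domain \<Omega> \<epsilon>))"
    unfolding round_space_def by (rule measurable_snd)
  have c: "(\<lambda>x. x) \<in> measurable (restrict_space borel (enlarged_domain \<Omega> \<epsilon>)) borel"
    by (rule measurable_restrict_space1) simp
  show ?thesis
    using measurable_compose[OF measurable_compose[OF a b] c] by (simp add: Suc)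
qed simp

lemma position_in_enlarged_domain:
  assumes "x0 \<in> \<Omega>" "h \<in> space (history_space \<Omega> \<epsilon> k)"
  shows "position x0 h k \<in> enlarged_domain \<Omega> \<epsilon>"
proof (cases k)
  case (Suc j)
  then have "h j \<in> space (round_space \<Omega> \<epsilon>)"
    using assms(2) by (auto simp: history_space_def space_PiM)
  then show ?thesis by (auto simp: Suc space_round_space)
qed (use assms in \<open>simp add: enlarged_domain_def\<close>)

lemma section_borel:
  fixes \<Omega> :: "(real ^ 'n) set"
  assumes "open \<Omega>" "E \<in> sets (round_space \<Omega> \<epsilon>)" "i \<in> {0, 1, 2}"
  shows "{z. (i, z) \<in> E} \<in> sets borel"
proof -
  let ?R = "restrict_space borel (enlarged_domain \<Omega> \<epsilon>)"
  have "Pair i \<in> measurable ?R (round_space \<Omega> \<epsilon>)"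
    unfolding round_space_def using assms by (intro measurable_Pair1') simp
  then have "Pair i -` E \<inter> space ?R \<in> sets ?R"
    using assms(2) by (rule measurable_sets)
  moreover have "Pair i -` E \<inter> space ?R = {z. (i, z) \<in> E}"
    using sets.sets_into_space[OF assms(2)] assms(3)
    by (auto simp: space_restrict_space space_round_space)
  ultimately show ?thesis
    using assms(1) by (simp add: sets_restrict_space_iff enlarged_domain_borel)
qed

lemma sets_move_measure: "sets (move_measure p \<Omega> \<epsilon> s1 s2 x) = sets (round_space \<Omega> \<epsilon>)"
  by (simp add: move_measure_def sets.space_closed sets.sigma_sets_eq)

lemma space_move_measure: "space (move_measure p \<Omega> \<epsilon> s1 s2 x) = space (round_space \<Omega> \<epsilon>)"
  by (simp add: move_measure_def sets.space_closed)

lemma emeasure_move_measure: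
  fixes \<Omega> :: "(real ^ 'n) set"
  assumes "open \<Omega>" and E: "E \<in> sets (round_space \<Omega> \<epsilon>)"
  shows "emeasure (move_measure p \<Omega> \<epsilon> s1 s2 x) E =
    ennreal (game_alpha TYPE('n) p / 2) * indicator E (0, s1)
    + ennreal (game_alpha TYPE('n) p / 2) * indicator E (1, s2)
    + ennreal (game_beta TYPE('n) p) *
        (emeasure lborel ({z. (2, z) \<in> E} \<inter> ball x \<epsilon>) / emeasure lborel (ball x \<epsilon>))"
proof (rule emeasure_measure_of[OF move_measure_def])
  show "countably_additive (sets (move_measure p \<Omega> \<epsilon> s1 s2 x)) (\<lambda>E.
      ennreal (game_alpha TYPE('n) p / 2) * indicator E (0, s1)
    + ennreal (game_alpha TYPE('n) p / 2) * indicator E (1, s2)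
    + ennreal (game_beta TYPE('n) p) *
        (emeasure lborel ({z. (2, z) \<in> E} \<inter> ball x \<epsilon>) / emeasure lborel (ball x \<epsilon>)))"
    unfolding countably_additive_def sets_move_measure
  proof (intro allI impI)
    fix A :: "nat \<Rightarrow> _"
    assume A: "range A \<subseteq> sets (round_space \<Omega> \<epsilon>)" "disjoint_family A"
    have ind: "(\<Sum>i. indicator (A i) z :: ennreal) = indicator (\<Union>(range A)) z" for z
      using suminf_indicator[OF A(2)] by simp
    have "(\<Sum>i. emeasure lborel ({z. (2, z) \<in> A i} \<inter> ball x \<epsilon>)) =
        emeasure lborel (\<Union>i. {z. (2, z) \<in> A i} \<inter> ball x \<epsilon>)"
    proof (rule suminf_emeasure)
      show "range (\<lambda>i. {z. (2, z) \<in> A i} \<inter> ball x \<epsilon>) \<subseteq> sets lborel"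
        using section_borel[OF assms(1), of _ \<epsilon>] A(1) by auto
      show "disjoint_family (\<lambda>i. {z. (2, z) \<in> A i} \<inter> ball x \<epsilon>)"
        using A(2) by (fastforce simp: disjoint_family_on_def)
    qed
    also have "(\<Union>i. {z. (2, z) \<in> A i} \<inter> ball x \<epsilon>) = {z. (2, z) \<in> \<Union>(range A)} \<inter> ball x \<epsilon>"
      by auto
    finally have vol: "(\<Sum>i. emeasure lborel ({z. (2, z) \<in> A i} \<inter> ball x \<epsilon>)) =
        emeasure lborel ({z. (2, z) \<in> \<Union>(range A)} \<inter> ball x \<epsilon>)" .
    show "(\<Sum>i. ennreal (game_alpha TYPE('n) p / 2) * indicator (A i) (0, s1)
        + ennreal (game_alpha TYPE('n) p / 2) * indicator (A i) (1, s2)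
        + ennreal (game_beta TYPE('n) p) *
            (emeasure lborel ({z. (2, z) \<in> A i} \<inter> ball x \<epsilon>) / emeasure lborel (ball x \<epsilon>))) =
        ennreal (game_alpha TYPE('n) p / 2) * indicator (\<Union>(range A)) (0, s1)
        + ennreal (game_alpha TYPE('n) p / 2) * indicator (\<Union>(range A)) (1, s2)
        + ennreal (game_beta TYPE('n) p) *
            (emeasure lborel ({z. (2, z) \<in> \<Union>(range A)} \<inter> ball x \<epsilon>) / emeasure lborel (ball x \<epsilon>))"
      by (simp add: suminf_add[symmetric] ind vol divide_ennreal_def
          del: indicator_simps UN_iff)
  qed
qed (use E in \<open>auto simp: sets_move_measure positive_def sets.space_closed dest: sets.sets_into_space\<close>)

lemma emeasure_move_measure_Times:
  fixes \<Omega> :: "(real ^ 'n) set"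
  assumes "open \<Omega>" "C \<subseteq> {0, 1, 2}" "A \<in> sets borel" "A \<subseteq> enlarged_domain \<Omega> \<epsilon>"
  shows "emeasure (move_measure p \<Omega> \<epsilon> s1 s2 x) (C \<times> A) =
    ennreal (game_alpha TYPE('n) p / 2) * (indicator C 0 * indicator A s1)
    + ennreal (game_alpha TYPE('n) p / 2) * (indicator C 1 * indicator A s2)
    + ennreal (game_beta TYPE('n) p) *
        (indicator C 2 * (emeasure lborel (A \<inter> ball x \<epsilon>) / emeasure lborel (ball x \<epsilon>)))"
proof -
  have "C \<times> A \<in> sets (round_space \<Omega> \<epsilon>)"
    unfolding round_space_def using assms
    by (intro pair_measureI) (auto simp: sets_restrict_space_iff enlarged_domain_borel)
  then show ?thesis
    using assms(1) by (auto simp: emeasure_move_measure indicator_def)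
qed

lemma prob_space_move_measure:
  fixes \<Omega> :: "(real ^ 'n) set"
  assumes "open \<Omega>" "2 < p" "0 < \<epsilon>" "x \<in> \<Omega>" "s1 \<in> ball x \<epsilon>" "s2 \<in> ball x \<epsilon>"
  shows "prob_space (move_measure p \<Omega> \<epsilon> s1 s2 x)"
proof
  have sub: "ball x \<epsilon> \<subseteq> enlarged_domain \<Omega> \<epsilon>"
    using assms by (intro ball_subset_enlarged_domain)
  have "emeasure lborel (ball x \<epsilon>) \<noteq> 0"
    using content_ball_pos[OF assms(3), of x] by (auto simp: measure_def)
  then have one: "emeasure lborel (ball x \<epsilon>) / emeasure lborel (ball x \<epsilon>) = 1"
    using emeasure_lborel_ball_finite[of x \<epsilon>] by (intro ennreal_divide_self) auto
  have eq: "{z. (2, z) \<in> {0, 1, 2::nat} \<times> enlarged_domain \<Omega> \<epsilon>} \<inter> ball x \<epsilon> = ball x \<epsilon>"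
    using sub by auto
  have "emeasure (move_measure p \<Omega> \<epsilon> s1 s2 x) (space (round_space \<Omega> \<epsilon>)) =
      ennreal (game_alpha TYPE('n) p / 2) + ennreal (game_alpha TYPE('n) p / 2)
      + ennreal (game_beta TYPE('n) p)"
    using sub assms one eq
    by (subst emeasure_move_measure[OF assms(1) sets.top]) (auto simp: space_round_space indicator_def)
  also have "\<dots> = ennreal (game_alpha TYPE('n) p + game_beta TYPE('n) p)"
  proof -
    have "0 \<le> game_alpha TYPE('n) p" "0 \<le> game_beta TYPE('n) p"
      using assms(2) by (auto simp: game_alpha_def game_beta_def)
    then show ?thesis by (simp flip: ennreal_plus)
  qed
  also have "game_alpha TYPE('n) p + game_beta TYPE('n) p = 1"
    using assms(2) by (simp add: game_alpha_def game_beta_def flip: add_divide_distrib)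
  finally show "emeasure (move_measure p \<Omega> \<epsilon> s1 s2 x) (space (move_measure p \<Omega> \<epsilon> s1 s2 x)) = 1"
    by (simp add: space_move_measure)
qed

lemma prob_space_transition:
  fixes \<Omega> :: "(real ^ 'n) set"
  assumes "open \<Omega>" "2 < p" "0 < \<epsilon>" "x0 \<in> \<Omega>" "strategy \<Omega> \<epsilon> x0 S1" "strategy \<Omega> \<epsilon> x0 S2"
    and h: "h \<in> space (history_space \<Omega> \<epsilon> k)"
  shows "prob_space (transition p \<Omega> \<epsilon> x0 S1 S2 k h)"
  using assms position_in_enlarged_domain[OF assms(4) h]
  by (auto simp: transition_def strategy_def space_round_space
      intro!: prob_space_move_measure prob_space_return)

lemma Ionescu_Tulcea_transition:
  fixes \<Omega> :: "(real ^ 'n) set"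
  assumes "open \<Omega>" "2 < p" "0 < \<epsilon>" "x0 \<in> \<Omega>" "strategy \<Omega> \<epsilon> x0 S1" "strategy \<Omega> \<epsilon> x0 S2"
  shows "Ionescu_Tulcea (transition p \<Omega> \<epsilon> x0 S1 S2) (\<lambda>_. round_space \<Omega> \<epsilon>)"
proof (rule Ionescu_Tulcea.intro)
  fix k
  let ?H = "history_space \<Omega> \<epsilon> k" and ?R = "round_space \<Omega> \<epsilon>"
  let ?x = "\<lambda>h. position x0 h k"
  note [measurable] = position_measurable[of x0 k \<Omega> \<epsilon>]
  have [measurable]: "\<Omega> \<in> sets borel" using assms(1) by auto
  have S [measurable]: "S1 k \<in> borel_measurable ?H" "S2 k \<in> borel_measurable ?H"
    using assms by (auto simp: strategy_def)
  show "prob_space (transition p \<Omega> \<epsilon> x0 S1 S2 k h)"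
    if "h \<in> space (PiM {0..<k} (\<lambda>_. ?R))" for h
    using prob_space_transition[OF assms] that by (simp add: history_space_def)
  have "transition p \<Omega> \<epsilon> x0 S1 S2 k \<in> measurable ?H (subprob_algebra ?R)"
  proof (rule measurable_subprob_algebra)
    fix h assume h: "h \<in> space ?H"
    show "subprob_space (transition p \<Omega> \<epsilon> x0 S1 S2 k h)"
      by (intro prob_space_imp_subprob_space prob_space_transition[OF assms h])
    show "sets (transition p \<Omega> \<epsilon> x0 S1 S2 k h) = sets ?R"
      by (simp add: transition_def sets_move_measure)
  next
    fix E assume E: "E \<in> sets ?R"
    note slice = section_borel[OF assms(1) E]
    have ind: "(\<lambda>h. indicator E (i, f h) :: ennreal) \<in> borel_measurable ?H"
      if "i \<in> {0, 1, 2}" "f \<in> borel_measurable ?H" for i f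
    proof -
      have "(\<lambda>h. indicator {z. (i, z) \<in> E} (f h) :: ennreal) \<in> borel_measurable ?H"
        using slice[OF that(1)] that(2) by measurable
      then show ?thesis by (simp add: indicator_def)
    qed
    have vol: "(\<lambda>h. emeasure lborel (B \<inter> ball (?x h) \<epsilon>)) \<in> borel_measurable ?H"
      if [measurable]: "B \<in> sets borel" for B
    proof -
      have "{w \<in> space (?H \<Otimes>\<^sub>M lborel). snd w \<in> B \<and> dist (?x (fst w)) (snd w) < \<epsilon>}
          \<in> sets (?H \<Otimes>\<^sub>M lborel)"
        by measurable
      from lborel.measurable_emeasure_Pair[OF this] show ?thesis
        by (rule measurable_cong[THEN iffD1, rotated])
          (auto simp: space_pair_measure intro!: arg_cong[where f = "emeasure lborel"])
    qed
    have vol': "(\<lambda>h. emeasure lborel (ball (?x h) \<epsilon>)) \<in> borel_measurable ?H"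
      using vol[of UNIV] by simp
    note [measurable] = vol' vol[OF slice[of 2], simplified]
      ind[of 0 "S1 k", simplified S, simplified] ind[of 1 "S2 k", simplified S, simplified]
      ind[of 2 ?x, simplified]
    have "(\<lambda>h. if ?x h \<in> \<Omega>
        then ennreal (game_alpha TYPE('n) p / 2) * indicator E (0, S1 k h)
          + ennreal (game_alpha TYPE('n) p / 2) * indicator E (1, S2 k h)
          + ennreal (game_beta TYPE('n) p) *
            (emeasure lborel ({z. (2, z) \<in> E} \<inter> ball (?x h) \<epsilon>) / emeasure lborel (ball (?x h) \<epsilon>))
        else indicator E (2, ?x h)) \<in> borel_measurable ?H"
      using S by (intro measurable_If borel_measurable_add borel_measurable_times_ennreal
          borel_measurable_divide_ennreal borel_measurable_const ind vol vol' slice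
          position_measurable) auto
    then show "(\<lambda>h. emeasure (transition p \<Omega> \<epsilon> x0 S1 S2 k h) E) \<in> borel_measurable ?H"
      by (rule measurable_cong[THEN iffD1, rotated])
        (auto simp: transition_def emeasure_move_measure[OF assms(1) E] E)
  qed
  then show "transition p \<Omega> \<epsilon> x0 S1 S2 k
      \<in> measurable (PiM {0..<k} (\<lambda>_. ?R)) (subprob_algebra ?R)"
    by (simp add: history_space_def)
qed

lemma prob_space_game_measure:
  fixes \<Omega> :: "(real ^ 'n) set"
  assumes "open \<Omega>" "2 < p" "0 < \<epsilon>" "x0 \<in> \<Omega>" "strategy \<Omega> \<epsilon> x0 S1" "strategy \<Omega> \<epsilon> x0 S2"
  shows "prob_space (game_measure p \<Omega> \<epsilon> x0 S1 S2)"
proof -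
  interpret Ionescu_Tulcea "transition p \<Omega> \<epsilon> x0 S1 S2" "\<lambda>_. round_space \<Omega> \<epsilon>"
    by (rule Ionescu_Tulcea_transition[OF assms])
  let ?X = "space (PiM {} (\<lambda>_. round_space \<Omega> \<epsilon>))"
  have "emeasure PF.lim (PF.emb UNIV {} ?X) = emeasure (CI {}) ?X"
    by (rule lim) auto
  also have "\<dots> = 1"
    using prob_space.emeasure_space_1[OF PF.prob_space_P[of "{}"]] by (simp add: PF.space_P)
  also have "PF.emb UNIV {} ?X = space PF.lim"
    by (auto simp: prod_emb_def space_PiM)
  finally show ?thesis
    unfolding game_measure_def by (rule prob_spaceI)
qed

end

theory Submission
  imports Defs
begin

text \<open>
  Player 1 always undoes the moves of Player 2: he remembers the point \<open>z\<close> to which the random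
  moves alone would have led and the number \<open>q\<close> of moves of Player 2 that are not yet undone, and
  moves the fraction \<open>1 / q\<close> of the way from his position to \<open>z\<close>. Then the position is within
  \<open>q * \<epsilon>\<close> of \<open>z\<close>, and \<open>(z, q)\<close> is a random walk that does not depend on Player 2. It is enough
  that this walk, started near \<open>(y, 0)\<close>, hits the complement of \<open>\<Omega>\<close> at a time with \<open>q = 0\<close> before
  it leaves a neighbourhood of \<open>(y, 0)\<close>.

  In units of \<open>\<epsilon>\<close> the walk lives in dimension \<open>n + 1\<close> and the set \<open>T \<times> {0}\<close> to be hit has
  positive density in dimension \<open>n\<close>, hence positive capacity. Quantitatively, a potential of \<open>T\<close>
  with a subharmonic kernel of order \<open>n - 1 / 2\<close> bounds the hitting probability from below by some
  \<open>\<theta> > 0\<close>, uniformly in the scale. Iterating over \<open>k\<close> scales gives \<open>1 - (1 - \<theta>) ^ k\<close>.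
\<close>

subsection \<open>The uniform distribution on the unit ball\<close>

text \<open>The complement of \<Omega> need contain no ball near y, and Player 2 moves freely.
  Moving 1/q of the way towards z makes only the number of open moves matter: one such move shrinks
  a displacement below q * \<epsilon> to one below (q - 1) * \<epsilon>, whatever Player 2 did. With
  q = 0 the position equals z, so a walk that reaches the target has taken the game out of \<Omega>;
  an exit with q > 0 is just as good, because the position is then still near y. The bound at one
  scale does not depend on that scale s because volume s ^ n times kernel s powr (1/2 - n) is sqrt
  s, both in the upper bound of the potential and in its gain at the start. The potential is known
  to be subharmonic only away from the good centres; near them a bounded number of rounds reaches
  the target with a fixed probability, which closes the gap in the maximum principle. Strict
  subharmonicity replaces compactness there, since suprema of merely measurable functions need not
  be attained.\<close>

definition ball_step :: "'a::euclidean_space measure" where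
  "ball_step = uniform_measure lborel (ball 0 1)"

lemma emeasure_ball_neq_0:
  fixes x :: "'a::euclidean_space"
  assumes "0 < r"
  shows "emeasure lborel (ball x r) \<noteq> 0"
  using content_ball_pos[OF assms, of x] by (auto simp: measure_def)

lemma emeasure_ball_neq_top: "emeasure lborel (ball (x :: 'a::euclidean_space) r) \<noteq> \<infinity>"
  using emeasure_lborel_ball_finite[of x r] by auto

lemma sets_ball_step [simp, measurable_cong]: "sets ball_step = sets borel"
  by (simp add: ball_step_def)

lemma space_ball_step [simp]: "space ball_step = UNIV"
  by (simp add: ball_step_def)

lemma borel_measurable_ball_step [simp]:
  "borel_measurable (ball_step :: 'a::euclidean_space measure) = borel_measurable borel"
  by (rule measurable_cong_sets) auto

interpretation ball_step: prob_space "ball_step :: 'a::euclidean_space measure"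
  unfolding ball_step_def
  by (intro prob_space_uniform_measure emeasure_ball_neq_0 emeasure_ball_neq_top) simp

lemma AE_ball_step: "AE u in ball_step. norm (u :: 'a::euclidean_space) < 1"
  unfolding ball_step_def by (rule AE_uniform_measureI) auto

lemma integrable_ball_step:
  fixes f :: "'a::euclidean_space \<Rightarrow> real"
  assumes "f \<in> borel_measurable borel" "\<And>u. norm u < 1 \<Longrightarrow> \<bar>f u\<bar> \<le> B"
  shows "integrable ball_step f"
  by (rule ball_step.integrable_const_bound[where B = B])
    (use assms AE_ball_step in \<open>auto elim!: eventually_mono\<close>)

lemma integral_ball_step_mono:
  fixes f g :: "'a::euclidean_space \<Rightarrow> real"
  assumes "integrable ball_step f" "integrable ball_step g"
    and "\<And>u. norm u < 1 \<Longrightarrow> f u \<le> g u"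
  shows "(LINT u|ball_step. f u) \<le> (LINT u|ball_step. g u)"
  by (rule integral_mono_AE) (use assms AE_ball_step in \<open>auto elim!: eventually_mono\<close>)

text \<open>All moments of the random step are computed from symmetries: a map that preserves
  Lebesgue measure and the norm also preserves the uniform measure on the unit ball.\<close>

lemma integral_ball_step_invariant:
  fixes T :: "'a::euclidean_space \<Rightarrow> 'a" and f :: "'a \<Rightarrow> real"
  assumes T [measurable]: "T \<in> borel_measurable borel" and [measurable]: "f \<in> borel_measurable borel"
    and lborel: "distr lborel borel T = lborel" and norm: "\<And>x. norm (T x) = norm x"
  shows "(LINT u|ball_step. f (T u)) = (LINT u|ball_step. f u)"
proof -
  have "distr ball_step borel T = ball_step"
  proof (rule measure_eqI)
    fix A assume "A \<in> sets (distr ball_step borel T)"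
    then have A [measurable]: "A \<in> sets borel" by simp
    have pre: "T -` B \<in> sets borel" if "B \<in> sets borel" for B
      using measurable_sets[OF T that] by simp
    have "emeasure lborel (T -` (ball 0 1 \<inter> A)) = emeasure (distr lborel borel T) (ball 0 1 \<inter> A)"
      by (subst emeasure_distr) auto
    also have "T -` (ball 0 1 \<inter> A) = ball 0 1 \<inter> T -` A"
      using norm by auto
    finally show "emeasure (distr ball_step borel T) A = emeasure ball_step A"
      using pre[OF A] by (simp add: emeasure_distr lborel, simp add: ball_step_def lborel)
  qed simp
  then have "(LINT u|ball_step. f u) = (LINT u|distr ball_step borel T. f u)"
    by simp
  also have "\<dots> = (LINT u|ball_step. f (T u))"
    by (rule integral_distr) auto
  finally show ?thesis ..
qed

text \<open>For i \<noteq> j the vector i - j has squared length 2, so \<open>T\<close> is the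
  reflection in the hyperplane orthogonal to it, that is, the exchange of the coordinates i and j.
  The inner product form makes measurability evident. The exchange shows that all coordinates have
  the same second moment.\<close>

lemma distr_lborel_swap:
  fixes i j :: "'a::euclidean_space"
  assumes i: "i \<in> Basis" and j: "j \<in> Basis"
  defines "T \<equiv> \<lambda>x. x - (x \<bullet> (i - j)) *\<^sub>R (i - j)"
  shows "distr lborel borel T = lborel" "norm (T x) = norm x" "T x \<bullet> i = x \<bullet> j"
proof -
  have T [measurable]: "T \<in> borel_measurable borel"
    unfolding T_def by simp
  have comp: "T x \<bullet> b = x \<bullet> Transposition.transpose i j b" if "b \<in> Basis" for x b
    using i j that
    by (auto simp: T_def inner_simps inner_Basis Transposition.transpose_def algebra_simps)
  have perm: "Transposition.transpose i j permutes Basis"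
    using i j by (intro permutes_swap_id)
  have inB: "Transposition.transpose i j b \<in> Basis" if "b \<in> Basis" for b
    using that i j by (auto simp: Transposition.transpose_def)
  show "distr lborel borel T = lborel"
  proof (rule lborel_eqI[symmetric])
    fix l u :: 'a assume lu: "\<And>b. b \<in> Basis \<Longrightarrow> l \<bullet> b \<le> u \<bullet> b"
    have sub: "l \<bullet> Transposition.transpose i j b < x \<bullet> b \<longleftrightarrow> l \<bullet> Transposition.transpose i j b < T x \<bullet> Transposition.transpose i j b"
      "x \<bullet> b < u \<bullet> Transposition.transpose i j b \<longleftrightarrow> T x \<bullet> Transposition.transpose i j b < u \<bullet> Transposition.transpose i j b"
      if "b \<in> Basis" for b x
      using that by (simp_all add: comp inB)
    have "T -` box l u = box (T l) (T u)"
    proof (intro set_eqI)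
      fix x
      have "x \<in> box (T l) (T u) \<longleftrightarrow>
          (\<forall>b\<in>Basis. l \<bullet> Transposition.transpose i j b < T x \<bullet> Transposition.transpose i j b \<and> T x \<bullet> Transposition.transpose i j b < u \<bullet> Transposition.transpose i j b)"
        using sub by (auto simp: mem_box comp)
      also have "\<dots> \<longleftrightarrow> x \<in> T -` box l u"
        using inB by (auto simp: mem_box) (metis inB transpose_involutory)+
      finally show "x \<in> T -` box l u \<longleftrightarrow> x \<in> box (T l) (T u)" ..
    qed
    then have "emeasure (distr lborel borel T) (box l u) = emeasure lborel (box (T l) (T u))"
      by (subst emeasure_distr) auto
    also have "\<dots> = (\<Prod>b\<in>Basis. (T u - T l) \<bullet> b)"
      using lu inB by (intro emeasure_lborel_box) (auto simp: comp)
    also have "(\<Prod>b\<in>Basis. (T u - T l) \<bullet> b) = (\<Prod>b\<in>Basis. (u - l) \<bullet> Transposition.transpose i j b)"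
      by (intro prod.cong) (auto simp: inner_diff_left comp)
    also have "\<dots> = (\<Prod>b\<in>Basis. (u - l) \<bullet> b)"
      using perm by (intro prod.reindex_bij_betw permutes_imp_bij)
    finally show "emeasure (distr lborel borel T) (box l u) = (\<Prod>b\<in>Basis. (u - l) \<bullet> b)" .
  qed simp
  have "(\<Sum>b\<in>Basis. (T x \<bullet> b)^2) = (\<Sum>b\<in>Basis. (x \<bullet> Transposition.transpose i j b)^2)"
    by (simp add: comp)
  also have "\<dots> = (\<Sum>b\<in>Basis. (x \<bullet> b)^2)"
    using perm by (intro sum.reindex_bij_betw[of _ _ _ "\<lambda>b. (x \<bullet> b)^2"] permutes_imp_bij)
  finally show "norm (T x) = norm x"
    by (simp add: norm_eq_sqrt_inner euclidean_inner[of "T x" "T x"] euclidean_inner[of x x] power2_eq_square)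
  show "T x \<bullet> i = x \<bullet> j"
    by (simp add: comp i)
qed

text \<open>The sign change of one coordinate; it makes the mixed second moments vanish.\<close>

lemma distr_lborel_reflect:
  fixes i :: "'a::euclidean_space"
  assumes i: "i \<in> Basis"
  defines "T \<equiv> \<lambda>x. x - (2 * (x \<bullet> i)) *\<^sub>R i"
  shows "distr lborel borel T = lborel" "norm (T x) = norm x" 
    "b \<in> Basis \<Longrightarrow> T x \<bullet> b = (if b = i then - (x \<bullet> b) else x \<bullet> b)"
proof -
  define c where "c j = (if j = i then -1 else 1 :: real)" for j
  have comp: "T x \<bullet> b = c b * (x \<bullet> b)" if "b \<in> Basis" for b x
    using that i by (auto simp: T_def c_def inner_simps inner_Basis)
  then show "b \<in> Basis \<Longrightarrow> T x \<bullet> b = (if b = i then - (x \<bullet> b) else x \<bullet> b)"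
    by (simp add: c_def)
  have eq: "T = (\<lambda>x. 0 + (\<Sum>j\<in>Basis. (c j * (x \<bullet> j)) *\<^sub>R j))"
    by (rule ext, rule euclidean_eqI) (simp add: comp inner_sum_left inner_Basis if_distrib cong: if_cong)
  have "lborel = density (distr lborel borel T) (\<lambda>_. ennreal (\<Prod>j\<in>Basis. \<bar>c j\<bar>))"
    unfolding eq by (rule lborel_affine_euclidean) (simp add: c_def)
  moreover have "(\<Prod>j\<in>Basis. \<bar>c j\<bar>) = 1"
    by (intro prod.neutral) (simp add: c_def)
  ultimately have "lborel = density (distr lborel borel T) (\<lambda>_. 1)"
    by simp
  then show "distr lborel borel T = lborel"
    by (simp only: density_1)
  have "(\<Sum>b\<in>Basis. (T x \<bullet> b)^2) = (\<Sum>b\<in>Basis. (x \<bullet> b)^2)"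
    by (intro sum.cong) (auto simp: comp c_def)
  then show "norm (T x) = norm x"
    by (simp add: norm_eq_sqrt_inner euclidean_inner[of "T x" "T x"] euclidean_inner[of x x] power2_eq_square)
qed

lemma integral_ball_step_odd:
  fixes f :: "'a::euclidean_space \<Rightarrow> real"
  assumes [measurable]: "f \<in> borel_measurable borel" and "\<And>u. f (- u) = - f u"
  shows "(LINT u|ball_step. f u) = 0"
proof -
  have "(\<lambda>x::'a. 0 + (-1) *\<^sub>R x) = uminus"
    by auto
  with lborel_affine[of "-1" "0::'a"] have "distr lborel borel (uminus :: 'a \<Rightarrow> 'a) = lborel"
    by (simp add: density_1)
  then have "(LINT u|ball_step. f (- u)) = (LINT u|ball_step. f u)"
    by (intro integral_ball_step_invariant) auto
  then show ?thesis
    using assms(2) by simp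
qed

lemma integral_ball_step_cross:
  fixes i j :: "'a::euclidean_space"
  assumes "i \<in> Basis" "j \<in> Basis" "i \<noteq> j"
  shows "(LINT u|ball_step. (u \<bullet> i) * (u \<bullet> j)) = 0"
proof -
  let ?T = "\<lambda>x::'a. x - (2 * (x \<bullet> i)) *\<^sub>R i"
  have "(LINT u|ball_step. (?T u \<bullet> i) * (?T u \<bullet> j)) = (LINT u|ball_step. (u \<bullet> i) * (u \<bullet> j))"
    using assms(1) by (intro integral_ball_step_invariant[of ?T "\<lambda>u. (u \<bullet> i) * (u \<bullet> j)"] distr_lborel_reflect)
      auto
  then show ?thesis
    using assms by (simp add: distr_lborel_reflect(3))
qed

text \<open>The variance of one coordinate of the step. Averaging over all coordinates avoids the
  choice of a basis vector.\<close>

definition ball_variance :: "'a::euclidean_space itself \<Rightarrow> real" where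
  "ball_variance _ = (LINT u|ball_step. (norm (u :: 'a))^2) / DIM('a)"

lemma integral_ball_step_coordinate:
  fixes i :: "'a::euclidean_space"
  assumes i: "i \<in> Basis"
  shows "(LINT u|ball_step. (u \<bullet> i)^2) = ball_variance TYPE('a)"
proof -
  have eq: "(LINT u|ball_step. (u \<bullet> j)^2) = (LINT u|ball_step. (u \<bullet> i)^2)" if "j \<in> Basis" for j :: 'a
  proof -
    let ?T = "\<lambda>x::'a. x - (x \<bullet> (i - j)) *\<^sub>R (i - j)"
    have "(LINT u|ball_step. (?T u \<bullet> i)^2) = (LINT u|ball_step. (u \<bullet> i)^2)"
      using i that
      by (intro integral_ball_step_invariant[of ?T "\<lambda>u. (u \<bullet> i)^2"] distr_lborel_swap) auto
    then show ?thesis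
      by (simp add: distr_lborel_swap(3)[OF i that])
  qed
  have int: "integrable ball_step (\<lambda>u::'a. (u \<bullet> j)^2)" if "j \<in> Basis" for j :: 'a
    by (rule integrable_ball_step[of _ 1])
      (use that Basis_le_norm[OF that] in \<open>auto simp: abs_square_le_1 intro: order_trans[OF _ less_imp_le]\<close>)
  have "(LINT u|ball_step. (norm (u::'a))^2) = (LINT u|ball_step. (\<Sum>j\<in>Basis. ((u::'a) \<bullet> j)^2))"
    by (subst norm_eq_sqrt_inner, subst euclidean_inner) (simp add: power2_eq_square sum_nonneg)
  also have "\<dots> = DIM('a) * (LINT u|ball_step. (u \<bullet> i)^2)"
    by (subst Bochner_Integration.integral_sum) (use int eq in auto)
  finally show ?thesis
    by (simp add: ball_variance_def)
qed

lemma ball_variance_pos: "0 < ball_variance TYPE('a::euclidean_space)"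
proof -
  have "(LINT u|ball_step. (norm (u :: 'a))^2) \<noteq> 0"
  proof
    assume "(LINT u|ball_step. (norm (u :: 'a))^2) = 0"
    moreover have "integrable ball_step (\<lambda>u::'a. (norm u)^2)"
      by (rule integrable_ball_step[of _ 1]) (auto simp: abs_square_le_1)
    ultimately have "AE u in ball_step. u = (0::'a)"
      by (subst (asm) integral_nonneg_eq_0_iff_AE) auto
    moreover have "AE u in ball_step. u \<noteq> (0::'a)"
      unfolding ball_step_def by (rule AE_uniform_measureI) (use AE_lborel_singleton[of 0] in auto)
    ultimately have "AE u in (ball_step :: 'a measure). False"
      by eventually_elim simp
    then show False by simp
  qed
  then show ?thesis
    by (simp add: ball_variance_def less_le)
qed

text \<open>The covariance matrix of the step is a multiple of the identity, because diagonal
  entries agree and mixed ones vanish.\<close>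

lemma integral_ball_step_inner_square:
  fixes z :: "'a::euclidean_space"
  shows "(LINT u|ball_step. (z \<bullet> u)^2) = ball_variance TYPE('a) * (norm z)^2"
proof -
  have int: "integrable ball_step (\<lambda>u::'a. (z \<bullet> i) * (u \<bullet> i) * ((z \<bullet> j) * (u \<bullet> j)))"
    if "i \<in> Basis" "j \<in> Basis" for i j
  proof (rule integrable_ball_step[of _ "\<bar>z \<bullet> i\<bar> * 1 * (\<bar>z \<bullet> j\<bar> * 1)"])
    fix u :: 'a assume "norm u < 1"
    then show "\<bar>(z \<bullet> i) * (u \<bullet> i) * ((z \<bullet> j) * (u \<bullet> j))\<bar> \<le> \<bar>z \<bullet> i\<bar> * 1 * (\<bar>z \<bullet> j\<bar> * 1)"
      unfolding abs_mult using Basis_le_norm[OF that(1), of u] Basis_le_norm[OF that(2), of u]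
      by (intro mult_mono) auto
  qed auto
  have "(z \<bullet> u)^2 = (\<Sum>i\<in>Basis. \<Sum>j\<in>Basis. (z \<bullet> i) * (u \<bullet> i) * ((z \<bullet> j) * (u \<bullet> j)))" for u
    by (subst euclidean_inner) (simp add: power2_eq_square sum_product)
  then have "(LINT u|ball_step. (z \<bullet> u)^2) =
      (LINT u|ball_step. (\<Sum>i\<in>Basis. \<Sum>j\<in>Basis. (z \<bullet> i) * (u \<bullet> i) * ((z \<bullet> j) * (u \<bullet> j))))"
    by simp
  also have "\<dots> = (\<Sum>i\<in>Basis. \<Sum>j\<in>Basis. (LINT u|ball_step. (z \<bullet> i) * (u \<bullet> i) * ((z \<bullet> j) * (u \<bullet> j))))"
    using int by (simp add: Bochner_Integration.integral_sum)
  also have "\<dots> = (\<Sum>i\<in>Basis. \<Sum>j\<in>Basis. if i = j then (z \<bullet> i)^2 * ball_variance TYPE('a) else 0)"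
  proof (intro sum.cong refl)
    fix i j :: 'a assume ij: "i \<in> Basis" "j \<in> Basis"
    have "(LINT u|ball_step. (z \<bullet> i) * (u \<bullet> i) * ((z \<bullet> j) * (u \<bullet> j))) =
        (z \<bullet> i) * (z \<bullet> j) * (LINT u|ball_step. (u \<bullet> i) * (u \<bullet> j))"
      by (subst Bochner_Integration.integral_mult_right_zero[symmetric]) (simp add: mult_ac)
    then show "(LINT u|ball_step. (z \<bullet> i) * (u \<bullet> i) * ((z \<bullet> j) * (u \<bullet> j))) =
        (if i = j then (z \<bullet> i)^2 * ball_variance TYPE('a) else 0)"
      using integral_ball_step_coordinate[OF ij(1)] integral_ball_step_cross[OF ij]
      by (auto simp: power2_eq_square)
  qed
  also have "\<dots> = ball_variance TYPE('a) * (norm z)^2"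
    unfolding power2_norm_eq_inner euclidean_inner[of z z]
    by (simp add: power2_eq_square sum_distrib_left mult_ac)
  finally show ?thesis .
qed

lemma integral_ball_step_norm_square:
  "(LINT u|ball_step. (norm (u :: 'a::euclidean_space))^2) = DIM('a) * ball_variance TYPE('a)"
  by (simp add: ball_variance_def)

subsection \<open>A subharmonic kernel for the cancelled walk\<close>

text \<open>Taylor expansion at 1: the fourth derivative of x powr (- g) is positive, so the
  remainder, with its even power of t, has a sign. The bound is therefore global in t > -1 and costs
  no error term beyond the cubic one.\<close>

lemma powr_minus_ge_cubic:
  fixes g t :: real
  assumes g: "0 < g" and t: "-1 < t"
  shows "1 - g * t + g * (g + 1) / 2 * t^2 - g * (g + 1) * (g + 2) / 6 * t^3 \<le> (1 + t) powr (- g)"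
proof (cases "t = 0")
  case False
  define c where "c m = (\<Prod>i<m. - g - real i)" for m :: nat
  define diff where "diff m x = c m * x powr (- g - real m)" for m :: nat and x :: real
  have "\<exists>\<xi>. (if 1 + t < 1 then 1 + t < \<xi> \<and> \<xi> < 1 else 1 < \<xi> \<and> \<xi> < 1 + t) \<and>
      (1 + t) powr (- g) = (\<Sum>m<4. diff m 1 / fact m * (1 + t - 1) ^ m) + diff 4 \<xi> / fact 4 * (1 + t - 1) ^ 4"
  proof (rule Taylor[where f = "\<lambda>x. x powr (- g)" and a = "min 1 (1 + t)" and b = "max 1 (1 + t)"])
    show "diff 0 = (\<lambda>x. x powr (- g))"
      by (rule ext) (simp add: diff_def c_def)
    show "\<forall>m x. m < 4 \<and> min 1 (1 + t) \<le> x \<and> x \<le> max 1 (1 + t) \<longrightarrow>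
        DERIV (diff m) x :> diff (Suc m) x"
    proof (intro allI impI)
      fix m :: nat and x :: real
      assume "m < 4 \<and> min 1 (1 + t) \<le> x \<and> x \<le> max 1 (1 + t)"
      then have "0 < x" using t by auto
      have "DERIV (\<lambda>x. c m * x powr (- g - real m)) x :> c m * ((- g - real m) * x powr (- g - real m - 1))"
        using \<open>0 < x\<close> by (intro DERIV_cmult has_real_derivative_powr)
      also have "c m * ((- g - real m) * x powr (- g - real m - 1)) = diff (Suc m) x"
        by (simp add: diff_def c_def mult.assoc algebra_simps)
      finally show "DERIV (diff m) x :> diff (Suc m) x"
        unfolding diff_def .
    qed
  qed (use False in auto)
  then obtain \<xi> where \<xi>: "(if 1 + t < 1 then 1 + t < \<xi> \<and> \<xi> < 1 else 1 < \<xi> \<and> \<xi> < 1 + t)"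
    and eq: "(1 + t) powr (- g) = (\<Sum>m<4. diff m 1 / fact m * t ^ m) + diff 4 \<xi> / fact 4 * t ^ 4"
    by auto
  have "c 4 = g * (g + 1) * (g + 2) * (g + 3)"
    by (simp add: c_def eval_nat_numeral algebra_simps)
  then have "0 \<le> diff 4 \<xi> / fact 4 * t ^ 4"
    using g by (simp add: diff_def)
  moreover have "(\<Sum>m<4. diff m 1 / fact m * t ^ m) =
      1 - g * t + g * (g + 1) / 2 * t^2 - g * (g + 1) * (g + 2) / 6 * t^3"
    by (simp add: diff_def c_def eval_nat_numeral field_simps)
  ultimately show ?thesis
    using eq by linarith
qed simp

locale cancelled_walk =
  fixes a :: real and dim :: "'a::euclidean_space itself"
  assumes a_pos: "0 < a" and a_less: "a < 1 / 2"
begin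

text \<open>
  \<open>walk f z q\<close> is the expectation of \<open>f\<close> after one round of the game in which Player 1 always
  undoes a move of Player 2: \<open>z\<close> collects the random moves (in units of the step size) and \<open>q\<close>
  counts the moves of Player 2 that are still to be undone.
\<close>

definition walk :: "('a \<Rightarrow> nat \<Rightarrow> real) \<Rightarrow> 'a \<Rightarrow> nat \<Rightarrow> real" where
  "walk f z q = a * f z (q - 1) + a * f z (Suc q) + (1 - 2 * a) * (LINT u|ball_step. f (z + u) q)"

text \<open>
  The weight balances the variances of the two components. The shift by 1/2 turns the truncation
  of \<open>q - 1\<close> at 0 into a reflection.
\<close>

definition weight :: real where
  "weight = (1 - 2 * a) * ball_variance TYPE('a) / (2 * a)"

definition sqr :: "'a \<Rightarrow> nat \<Rightarrow> real" where
  "sqr z q = (norm z)^2 + weight * (real q + 1 / 2)^2"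

text \<open>
  In dimension \<open>d + 1\<close> the function \<open>\<bar>X\<bar> powr (- m)\<close> is strictly subharmonic for \<open>m > d - 1\<close>, and
  it is integrable near the origin of a \<open>d\<close>-dimensional subspace for \<open>m < d\<close>. The choice
  \<open>m = d - 1 / 2\<close> has both properties.
\<close>

definition gam :: real where
  "gam = (real DIM('a) - 1 / 2) / 2"

definition kern :: "'a \<Rightarrow> nat \<Rightarrow> real" where
  "kern z q = sqr z q powr (- gam)"

lemma weight_pos: "0 < weight"
  using a_pos a_less ball_variance_pos[where 'a = 'a] by (simp add: weight_def)

lemma gam_pos: "0 < gam"
proof -
  have "0 < (real d - 1 / 2) / 2" if "0 < d" for d :: nat
    using that by (cases d) auto
  from this[OF DIM_positive[where 'a = 'a]] show ?thesis
    unfolding gam_def .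
qed

text \<open>The shift by 1/2 also keeps \<open>sqr\<close> away from 0, so \<open>kern\<close> is
  bounded and its integrals over bounded sets exist.\<close>

lemma sqr_ge: "weight / 4 \<le> sqr z q"
proof -
  have "(1/2)^2 \<le> (real q + 1 / 2)^2"
    by (intro power_mono) auto
  then have "weight * (1/4) \<le> weight * (real q + 1 / 2)^2"
    using weight_pos by (intro mult_left_mono) (auto simp: power2_eq_square)
  then show ?thesis by (simp add: sqr_def add_increasing)
qed

lemma sqr_pos: "0 < sqr z q"
  using sqr_ge[of z q] weight_pos by linarith

lemma kern_pos: "0 < kern z q"
  using sqr_pos[of z q] by (simp add: kern_def)

lemma sqr_measurable [measurable]: "(\<lambda>z. sqr z q) \<in> borel_measurable borel"
  unfolding sqr_def by measurable

lemma kern_measurable [measurable]: "(\<lambda>z. kern z q) \<in> borel_measurable borel"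
  unfolding kern_def by measurable

lemma kern_le_bound: "kern z q \<le> (weight / 4) powr (- gam)"
  unfolding kern_def using sqr_ge weight_pos gam_pos by (intro powr_mono2') auto

text \<open>A discrete version of the Laplacian of a radial power in dimension DIM + 1. By the
  choice of \<open>weight\<close> all DIM + 1 directions have the same variance, so the second-order
  term of the expansion beats the first-order one by a multiple of 1 / \<open>sqr\<close>. The cubic
  error is smaller by a further factor 1 / r, with r the root of \<open>sqr\<close>, and takes at
  most half of that gain once r is large.\<close>

lemma kern_subharmonic:
  obtains C\<^sub>0 c where "1 \<le> C\<^sub>0" "0 < c"
    "\<And>z q. C\<^sub>0^2 \<le> sqr z q \<Longrightarrow> kern z q + c * kern z q / sqr z q \<le> walk kern z q"
proof -
  define s where "s = ball_variance TYPE('a)"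
  define \<beta> where "\<beta> = 1 - 2 * a"
  define A where "A = gam * (gam + 1) / 2"
  define B where "B = gam * (gam + 1) * (gam + 2) / 6"
  \<comment> \<open>One round changes \<open>sqr\<close> by at most D * r: a random step by at most
    2 * r + 1, which is at most 3 * r, and a step of the count by at most weight * (2 * Q + 1).
    Hence the relative change is at most D / r.\<close>
  define D where "D = 3 + 2 * sqrt weight + weight"
  \<comment> \<open>The entry 2 * D keeps relative changes within 1/2; the last entry makes the
    cubic error K at most half of the gain.\<close>
  define C where "C = Max {1, 2 * D, 4 * B * D^3 / (gam * \<beta> * s)}"
  have s: "0 < s" and \<beta>: "0 < \<beta>" and g: "0 < gam" and b: "0 < weight"
    using ball_variance_pos a_less gam_pos weight_pos by (auto simp: s_def \<beta>_def)
  have A: "0 < A" and B: "0 < B"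
    using g by (auto simp: A_def B_def)
  have D: "3 \<le> D" "2 * sqrt weight + weight \<le> D"
    using b by (auto simp: D_def)
  have bal: "2 * a * weight = \<beta> * s"
    using a_pos by (simp add: weight_def \<beta>_def s_def)
  have main: "kern z q + (gam * \<beta> * s / 4) * kern z q / sqr z q \<le> walk kern z q"
    if X: "C^2 \<le> sqr z q" for z q
  proof -
    define X where "X = sqr z q"
    define r where "r = sqrt X"
    define Q where "Q = real q + 1 / 2"
    define K where "K = B * (D / r)^3"
    have "0 < X" using sqr_pos by (simp add: X_def)
    have "C \<ge> 1" "C \<ge> 2 * D" "C \<ge> 4 * B * D^3 / (gam * \<beta> * s)"
      unfolding C_def by (rule Max_ge; simp)+
    moreover have "C \<le> r"
      unfolding r_def X_def using X by (rule real_le_rsqrt)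
    ultimately have r: "1 \<le> r" "2 * D \<le> r" "4 * B * D^3 / (gam * \<beta> * s) \<le> r"
      by auto
    have rX: "r^2 = X" using \<open>0 < X\<close> by (simp add: r_def)
    have zr: "norm z \<le> r"
      unfolding r_def X_def sqr_def using b by (intro real_le_rsqrt) simp
    have Qr: "sqrt weight * Q \<le> r"
      unfolding r_def X_def sqr_def Q_def using b
      by (intro real_le_rsqrt) (simp add: power_mult_distrib)
    have XQ: "X = (norm z)^2 + weight * Q^2"
      by (simp add: X_def sqr_def Q_def)
    have taylor: "1 - gam * t + A * t^2 - K \<le> (1 + t) powr (- gam)" "-1 < t" if t: "\<bar>t\<bar> \<le> D / r" for t
    proof -
      have "D / r \<le> 1 / 2"
        using r D by (simp add: field_simps)
      then show "-1 < t" using t by linarith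
      have "t^3 \<le> \<bar>t\<bar>^3" by (metis abs_ge_self power_abs)
      also have "\<dots> \<le> (D / r)^3" using t by (intro power_mono) auto
      finally have "B * t^3 \<le> K"
        unfolding K_def using B by (intro mult_left_mono) auto
      then show "1 - gam * t + A * t^2 - K \<le> (1 + t) powr (- gam)"
        using powr_minus_ge_cubic[OF g \<open>-1 < t\<close>] by (simp add: A_def B_def)
    qed
    have scale: "X powr (- gam) * (1 - gam * t + A * t^2 - K) \<le> kern z' q'"
      if "sqr z' q' = X * (1 + t)" "\<bar>t\<bar> \<le> D / r" for z' q' t
    proof -
      have "X powr (- gam) * (1 - gam * t + A * t^2 - K) \<le> X powr (- gam) * (1 + t) powr (- gam)"
        using taylor[OF that(2)] by (intro mult_left_mono) auto
      also have "\<dots> = kern z' q'"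
        unfolding kern_def that(1) using \<open>0 < X\<close> taylor(2)[OF that(2)] by (subst powr_mult) auto
      finally show ?thesis .
    qed
    have frac: "y / X \<le> D / r" if "y \<le> D * r" for y
    proof -
      have "y / X \<le> D * r / r^2"
        unfolding rX[symmetric] using that by (intro divide_right_mono) auto
      then show ?thesis using r(1) by (simp add: power2_eq_square)
    qed
    have Qb: "weight * (2 * Q + 1) \<le> D * r"
    proof -
      have "weight * (2 * Q + 1) = 2 * sqrt weight * (sqrt weight * Q) + weight"
        using b by (simp add: algebra_simps flip: power2_eq_square)
      also have "\<dots> \<le> 2 * sqrt weight * r + weight * r"
        using Qr r(1) b by (intro add_mono mult_left_mono) auto
      also have "\<dots> = (2 * sqrt weight + weight) * r" by (simp add: algebra_simps)
      also have "\<dots> \<le> D * r" using D r by (intro mult_right_mono) auto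
      finally show ?thesis .
    qed
    have Q0: "1 / 2 \<le> Q" by (simp add: Q_def)
    define tp tm where "tp = weight * (2 * Q + 1) / X" and "tm = weight * (1 - 2 * Q) / X"
    have up: "X powr (- gam) * (1 - gam * tp + A * tp^2 - K) \<le> kern z (Suc q)"
    proof (rule scale)
      have "X * tp = weight * (2 * Q + 1)" using \<open>0 < X\<close> by (simp add: tp_def)
      then show "sqr z (Suc q) = X * (1 + tp)"
        by (simp add: distrib_left) (simp add: XQ sqr_def Q_def power2_eq_square algebra_simps)
      show "\<bar>tp\<bar> \<le> D / r"
        using frac[OF Qb] \<open>0 < X\<close> b Q0 by (simp add: tp_def abs_of_nonneg)
    qed
    have down: "X powr (- gam) * (1 - gam * tm + A * tm^2 - K) \<le> kern z (q - 1)"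
    proof (rule scale)
      \<comment> \<open>For q = 0 the truncated difference gives 1/2 and Q - 1 is -1/2, with equal
        squares.\<close>
      have "(real (q - 1) + 1 / 2)^2 = (Q - 1)^2"
        by (cases q) (auto simp: Q_def power2_eq_square algebra_simps)
      moreover have "X * tm = weight * (1 - 2 * Q)" using \<open>0 < X\<close> by (simp add: tm_def)
      ultimately show "sqr z (q - 1) = X * (1 + tm)"
        by (simp add: distrib_left sqr_def) (simp add: XQ power2_eq_square algebra_simps)
      have "\<bar>tm\<bar> = weight * (2 * Q - 1) / X"
        using \<open>0 < X\<close> b Q0 by (simp add: tm_def abs_mult abs_divide)
      also have "\<dots> \<le> weight * (2 * Q + 1) / X"
        using \<open>0 < X\<close> b by (intro divide_right_mono mult_left_mono) auto
      finally show "\<bar>tm\<bar> \<le> D / r"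
        using frac[OF Qb] by simp
    qed
    \<comment> \<open>The expansion for a random step without its nonnegative term in (norm u)^4.
      What remains is integrated exactly: the odd terms vanish, the others are second
      moments.\<close>
    define L where "L u = (1 - K) - (2 * gam / X) * (z \<bullet> u) - (gam / X) * (norm u)^2
        + (4 * A / X^2) * (z \<bullet> u)^2 + (4 * A / X^2) * ((z \<bullet> u) * (norm u)^2)" for u
    have noise: "X powr (- gam) * L u \<le> kern (z + u) q" if u: "norm u < 1" for u
    proof -
      define t where "t = (2 * (z \<bullet> u) + (norm u)^2) / X"
      have "\<bar>z \<bullet> u\<bar> \<le> norm z * norm u" by (rule Cauchy_Schwarz_ineq2)
      also have "\<dots> \<le> r * 1" using zr u r by (intro mult_mono) auto
      finally have zu: "\<bar>z \<bullet> u\<bar> \<le> r" by simp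
      have "(norm u)^2 \<le> 1" using u by (simp add: abs_square_le_1)
      then have "\<bar>2 * (z \<bullet> u) + (norm u)^2\<bar> \<le> 3 * r"
        using zu r by (intro order_trans[OF abs_triangle_ineq]) (simp add: abs_mult)
      also have "\<dots> \<le> D * r" using D r by (intro mult_right_mono) auto
      finally have "\<bar>t\<bar> \<le> D / r"
        using frac \<open>0 < X\<close> by (simp add: t_def abs_divide)
      moreover have "X * t = 2 * (z \<bullet> u) + (norm u)^2" using \<open>0 < X\<close> by (simp add: t_def)
      then have "sqr (z + u) q = X * (1 + t)"
        by (simp add: distrib_left) (simp add: X_def sqr_def power2_norm_eq_inner inner_simps inner_commute)
      ultimately have "X powr (- gam) * (1 - gam * t + A * t^2 - K) \<le> kern (z + u) q"
        by (rule scale[rotated])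
      moreover have "L u \<le> 1 - gam * t + A * t^2 - K"
      proof -
        have "t^2 = (4 * (z \<bullet> u)^2 + 4 * ((z \<bullet> u) * (norm u)^2) + ((norm u)^2)^2) / X^2"
        proof -
          have "(2 * v + w)^2 = 4 * v^2 + 4 * (v * w) + w^2" for v w :: real
            by (simp add: power2_eq_square algebra_simps)
          then show ?thesis unfolding t_def power_divide by presburger
        qed
        then have "1 - gam * t + A * t^2 - K = L u + A * ((norm u)^2)^2 / X^2"
          by (simp add: L_def t_def add_divide_distrib algebra_simps)
        then show ?thesis using A by simp
      qed
      ultimately show ?thesis
        by (smt (verit) mult_left_mono powr_ge_zero)
    qed
    have zu: "\<bar>z \<bullet> u\<bar> \<le> norm z" if "norm u < 1" for u
      using Cauchy_Schwarz_ineq2[of z u] mult_left_mono[of "norm u" 1 "norm z"] that by simp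
    have i1: "integrable ball_step (\<lambda>u. z \<bullet> u)"
      by (rule integrable_ball_step[of _ "norm z"]) (use zu in auto)
    have i2: "integrable ball_step (\<lambda>u::'a. (norm u)^2)"
      by (rule integrable_ball_step[of _ 1]) (auto simp: abs_square_le_1)
    have i3: "integrable ball_step (\<lambda>u. (z \<bullet> u)^2)"
      by (rule integrable_ball_step[of _ "(norm z)^2"]) (use zu in \<open>auto intro!: power2_le_iff_abs_le[THEN iffD2]\<close>)
    have i4: "integrable ball_step (\<lambda>u. (z \<bullet> u) * (norm u)^2)"
    proof (rule integrable_ball_step[of _ "norm z * 1"])
      fix u :: 'a assume "norm u < 1"
      then show "\<bar>(z \<bullet> u) * (norm u)^2\<bar> \<le> norm z * 1"
        unfolding abs_mult using zu by (intro mult_mono) (auto simp: abs_square_le_1)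
    qed auto
    have o1: "(LINT u|ball_step. z \<bullet> u) = 0" "(LINT u|ball_step. (z \<bullet> u) * (norm u)^2) = 0"
      by (rule integral_ball_step_odd; simp)+
    have intL: "integrable ball_step L"
      unfolding L_def using i1 i2 i3 i4 by simp
    have LL: "(LINT u|ball_step. L u) = (1 - K) - gam * (DIM('a) * s) / X + 4 * A * (s * (norm z)^2) / X^2"
      unfolding L_def using i1 i2 i3 i4
      by (simp add: o1 integral_ball_step_inner_square integral_ball_step_norm_square s_def ball_step.prob_space[simplified])
    have "X powr (- gam) * (LINT u|ball_step. L u) = (LINT u|ball_step. X powr (- gam) * L u)"
      by simp
    also have "\<dots> \<le> (LINT u|ball_step. kern (z + u) q)"
    proof (rule integral_ball_step_mono)
      show "integrable ball_step (\<lambda>u. kern (z + u) q)"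
        by (rule integrable_ball_step[of _ "(weight / 4) powr (- gam)"])
          (use kern_le_bound in \<open>auto simp: abs_of_pos[OF kern_pos]\<close>)
    qed (use noise intL in auto)
    finally have "\<beta> * (X powr (- gam) * (LINT u|ball_step. L u)) \<le> \<beta> * (LINT u|ball_step. kern (z + u) q)"
      using \<beta> by (intro mult_left_mono) auto
    then have "X powr (- gam) * (a * (1 - gam * tm + A * tm^2 - K) + a * (1 - gam * tp + A * tp^2 - K)
        + \<beta> * (LINT u|ball_step. L u)) \<le> walk kern z q"
      using mult_left_mono[OF up less_imp_le[OF a_pos]] mult_left_mono[OF down less_imp_le[OF a_pos]]
      by (simp add: walk_def \<beta>_def algebra_simps)
    moreover have "1 + gam * \<beta> * s / 4 / X \<le> a * (1 - gam * tm + A * tm^2 - K)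
        + a * (1 - gam * tp + A * tp^2 - K) + \<beta> * (LINT u|ball_step. L u)"
    proof -
      have sum_t: "a * tm + a * tp = \<beta> * s / X"
        unfolding tm_def tp_def using bal \<open>0 < X\<close> by (simp add: field_simps)
      have "a * tm^2 + a * tp^2 = (2 * a * weight) * weight * (4 * Q^2 + 1) / X^2"
        unfolding tm_def tp_def by (simp add: power_divide add_divide_distrib[symmetric])
          (simp add: power2_eq_square algebra_simps)
      also have "\<dots> \<ge> 4 * \<beta> * s * (weight * Q^2) / X^2"
        unfolding bal using b \<beta> s by (intro divide_right_mono) (auto simp: algebra_simps)
      finally have sum_q: "4 * \<beta> * s * (weight * Q^2) / X^2 \<le> a * tm^2 + a * tp^2" .
      have "4 * \<beta> * s / X = 4 * \<beta> * s * (weight * Q^2) / X^2 + \<beta> * (4 * (s * (norm z)^2) / X^2)"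
      proof -
        have "4 * \<beta> * s / X = 4 * \<beta> * s * X / X^2"
          using \<open>0 < X\<close> by (simp add: power2_eq_square)
        also have "4 * \<beta> * s * X = 4 * \<beta> * s * (weight * Q^2) + \<beta> * (4 * (s * (norm z)^2))"
          by (subst XQ) (simp add: algebra_simps)
        finally show ?thesis by (simp add: add_divide_distrib)
      qed
      also have "\<dots> \<le> (a * tm^2 + a * tp^2) + \<beta> * (4 * (s * (norm z)^2) / X^2)"
        using sum_q by simp
      finally have "A * (4 * \<beta> * s / X) \<le> A * ((a * tm^2 + a * tp^2) + \<beta> * (4 * (s * (norm z)^2) / X^2))"
        using A by (intro mult_left_mono) auto
      moreover have "a * (1 - gam * tm + A * tm^2 - K) + a * (1 - gam * tp + A * tp^2 - K)
          + \<beta> * (LINT u|ball_step. L u)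
        = (2 * a + \<beta>) * (1 - K) - gam * (a * tm + a * tp) - \<beta> * (gam * (DIM('a) * s) / X)
          + A * ((a * tm^2 + a * tp^2) + \<beta> * (4 * (s * (norm z)^2) / X^2))"
        unfolding LL by (simp add: algebra_simps)
      moreover have "2 * a + \<beta> = 1" by (simp add: \<beta>_def)
      \<comment> \<open>Here DIM = 2 * gam + 1/2, so 4 * A = 2 * gam * (gam + 1) exceeds gam * (DIM
        + 1) by exactly gam / 2.\<close>
      moreover have "A * (4 * \<beta> * s / X) - gam * (\<beta> * s / X) - \<beta> * (gam * (DIM('a) * s) / X) = gam * \<beta> * s / 2 / X"
      proof -
        have "d = 2 * ((d - 1 / 2) / 2) + 1 / 2" for d :: real by (simp add: field_simps)
        then have d: "real DIM('a) = 2 * gam + 1 / 2" unfolding gam_def .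
        show ?thesis unfolding A_def d using \<open>0 < X\<close> by (simp add: field_simps)
      qed
      moreover have "K \<le> gam * \<beta> * s / 4 / X"
      proof -
        have "K = B * D^3 / r / X"
          using r(1) by (simp add: K_def rX[symmetric] power_divide eval_nat_numeral)
        also have "B * D^3 / r \<le> gam * \<beta> * s / 4"
          using r s g \<beta> by (simp add: field_simps)
        finally show ?thesis using \<open>0 < X\<close> by (simp add: divide_right_mono)
      qed
      ultimately show ?thesis
        using sum_t by simp
    qed
    ultimately have "X powr (- gam) * (1 + gam * \<beta> * s / 4 / X) \<le> walk kern z q"
      by (smt (verit) mult_left_mono powr_ge_zero)
    then show ?thesis
      by (simp add: kern_def X_def algebra_simps)
  qed
  show thesis
  proof (rule that[of C "gam * \<beta> * s / 4"])
    show "1 \<le> C" unfolding C_def by (rule Max_ge) auto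
  qed (use g \<beta> s main in auto)
qed

end

section \<open>Growth of integrals of the kernel\<close>

lemma integral_lborel_reflect:
  fixes f :: "'a::euclidean_space \<Rightarrow> real"
  assumes [measurable]: "f \<in> borel_measurable borel"
  shows "(LINT t|lborel. f (z - t)) = (LINT t|lborel. f t)"
proof -
  have "distr lborel borel (\<lambda>t. z - t) = lborel"
    using lborel_affine[of "-1" z] by (simp add: density_1)
  then have "(LINT t|lborel. f t) = (LINT t|distr lborel borel (\<lambda>t. z - t). f t)"
    by simp
  also have "\<dots> = (LINT t|lborel. f (z - t))"
    by (rule integral_distr) auto
  finally show ?thesis ..
qed

context cancelled_walk
begin

lemma integrable_kern:
  assumes [measurable]: "A \<in> sets borel" and "bounded A"
  shows "integrable lborel (\<lambda>t. indicator A t * kern (z - t) q)"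
proof -
  have "emeasure lborel A < \<infinity>"
    using assms(2) by (rule emeasure_bounded_finite)
  then have "integrable lborel (\<lambda>t. (weight / 4) powr (- gam) * indicator A t)"
    by (intro integrable_mult_right integrable_real_indicator) auto
  then show ?thesis
  proof (rule Bochner_Integration.integrable_bound)
    show "(\<lambda>t. indicator A t * kern (z - t) q) \<in> borel_measurable lborel"
      unfolding kern_def sqr_def by measurable
    show "AE t in lborel. norm (indicator A t * kern (z - t) q) \<le> norm ((weight / 4) powr (- gam) * indicator A t)"
      using kern_le_bound by (auto simp: abs_of_pos[OF kern_pos] indicator_def)
  qed
qed

lemma kern_le_powr:
  assumes "0 < r" "r^2 \<le> sqr z q"
  shows "kern z q \<le> r powr (- (2 * gam))"
proof -
  have "kern z q \<le> (r^2) powr (- gam)"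
    unfolding kern_def using assms gam_pos by (intro powr_mono2') auto
  also have "\<dots> = r powr (- (2 * gam))"
    using assms(1) by (simp add: powr_powr flip: powr_numeral)
  finally show ?thesis .
qed

lemma kern_ge_powr:
  assumes "0 < r" "sqr z q \<le> r^2"
  shows "r powr (- (2 * gam)) \<le> kern z q"
proof -
  have "r powr (- (2 * gam)) = (r^2) powr (- gam)"
    using assms(1) by (simp add: powr_powr flip: powr_numeral)
  also have "\<dots> \<le> kern z q"
    unfolding kern_def using assms gam_pos sqr_pos by (intro powr_mono2') auto
  finally show ?thesis .
qed

text \<open>The product of volume and kernel at scale r. This rate governs the potential from above
  and from below, which makes the hitting estimate independent of the scale.\<close>

lemma power_DIM_times_powr:
  assumes "0 < r"
  shows "r ^ DIM('a) * r powr (- (2 * gam)) = sqrt r"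
proof -
  have "r ^ DIM('a) * r powr (- (2 * gam)) = r powr (real DIM('a) + - (2 * gam))"
    using assms by (simp only: powr_add powr_realpow)
  also have "real DIM('a) + - (2 * gam) = 1 / 2"
    by (simp add: gam_def field_simps)
  finally show ?thesis using assms by (simp add: powr_half_sqrt)
qed

text \<open>The shell between R / 2 and R contributes at most a multiple of sqrt R, and over dyadic
  radii these contributions form a geometric series with ratio 1 / sqrt 2.\<close>

lemma integral_kern_ball:
  obtains C where "0 < C" "\<And>R z q. 1 \<le> R \<Longrightarrow>
    (LINT t|lborel. indicator (ball z R) t * kern (z - t) q) \<le> C * sqrt R"
proof -
  define J where "J R = (LINT t|lborel. indicator (ball 0 R) t * kern (0 - t) 0)" for R
  define \<omega> where "\<omega> = unit_ball_vol (real DIM('a))"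
  define D where "D = \<omega> * 2 powr (2 * gam)"
  \<comment> \<open>The second entry gives C / sqrt 2 + D \<le> C, which closes the induction over
    doublings; \<open>J 2\<close> covers the radii up to 2.\<close>
  define C where "C = max (J 2) (D / (1 - 1 / sqrt 2))"
  have int: "integrable lborel (\<lambda>t. indicator (ball x R) t * kern (z - t) q)" for x R z q
    by (rule integrable_kern) auto
  have \<omega>: "0 < \<omega>"
    by (simp add: \<omega>_def unit_ball_vol_pos)
  have e: "0 < 1 - 1 / sqrt (2 :: real)" by simp
  have "0 < D" using \<omega> by (simp add: D_def)
  then have "0 < D / (1 - 1 / sqrt 2)" using e by (rule divide_pos_pos)
  moreover have "J 2 \<le> C" "D / (1 - 1 / sqrt 2) \<le> C"
    by (simp_all add: C_def)
  ultimately have "J 2 \<le> C" "D / (1 - 1 / sqrt 2) \<le> C" "0 < C"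
    by linarith+
  then have C: "J 2 \<le> C" "D \<le> C * (1 - 1 / sqrt 2)" "0 < C"
    unfolding pos_divide_le_eq[OF e] by simp_all
  have J_mono: "J R \<le> J R'" if "R \<le> R'" for R R'
    unfolding J_def
    by (intro integral_mono int) (use that kern_pos less_imp_le in \<open>auto simp: indicator_def\<close>)
  have J_step: "J R \<le> J (R / 2) + D * sqrt R" if "2 \<le> R" for R
  proof -
    have "J R \<le> (LINT t|lborel. indicator (ball 0 (R / 2)) t * kern (0 - t) 0
        + (R / 2) powr (- (2 * gam)) * indicator (ball 0 R) t)"
      unfolding J_def
    proof (intro integral_mono Bochner_Integration.integrable_add int integrable_mult_right
        integrable_real_indicator emeasure_lborel_ball_finite)
      fix t :: 'a
      have "kern (0 - t) 0 \<le> (R / 2) powr (- (2 * gam))" if "t \<notin> ball 0 (R / 2)"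
      proof (rule kern_le_powr)
        have "(R / 2)^2 \<le> (norm t)^2"
          using that \<open>2 \<le> R\<close> by (intro power_mono) auto
        then show "(R / 2)^2 \<le> sqr (0 - t) 0"
          using weight_pos by (simp add: sqr_def add_increasing2)
      qed (use \<open>2 \<le> R\<close> in auto)
      then show "indicator (ball 0 R) t * kern (0 - t) 0 \<le>
          indicator (ball 0 (R / 2)) t * kern (0 - t) 0 + (R / 2) powr (- (2 * gam)) * indicator (ball 0 R) t"
        using kern_pos[of "0 - t" 0] by (auto simp: indicator_def)
    qed auto
    also have "\<dots> = J (R / 2) + (R / 2) powr (- (2 * gam)) * (\<omega> * R ^ DIM('a))"
      unfolding J_def using that
    proof (subst Bochner_Integration.integral_add)
      show "integrable lborel (\<lambda>t. (R / 2) powr (- (2 * gam)) * indicator (ball (0::'a) R) t)"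
        by (intro integrable_mult_right integrable_real_indicator emeasure_lborel_ball_finite) auto
    qed (use int[of 0 "R / 2" 0 0] in \<open>auto simp: \<omega>_def content_ball\<close>)
    also have "(R / 2) powr (- (2 * gam)) = 2 powr (2 * gam) * R powr (- (2 * gam))"
      using that by (simp add: powr_divide powr_minus field_simps)
    also have "J (R / 2) + 2 powr (2 * gam) * R powr (- (2 * gam)) * (\<omega> * R ^ DIM('a)) =
        J (R / 2) + D * (R ^ DIM('a) * R powr (- (2 * gam)))"
      by (simp add: D_def)
    finally show ?thesis
      using that by (simp add: power_DIM_times_powr)
  qed
  have "J R \<le> C * sqrt R" if "1 \<le> R" "R \<le> 2 ^ k" for R k
    using that
  proof (induction k arbitrary: R)
    case 0
    then have "J R \<le> C" using J_mono[of R 2] C by simp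
    then show ?case using 0 by simp
  next
    case (Suc k)
    show ?case
    proof (cases "R \<le> 2")
      case True
      then have "J R \<le> C * 1" using J_mono[of R 2] C by simp
      also have "\<dots> \<le> C * sqrt R"
        using Suc.prems C by (intro mult_left_mono) auto
      finally show ?thesis .
    next
      case False
      then have "J R \<le> J (R / 2) + D * sqrt R" by (intro J_step) simp
      also have "J (R / 2) \<le> C * sqrt (R / 2)"
        using False Suc.prems by (intro Suc.IH) auto
      also have "C * sqrt (R / 2) + D * sqrt R \<le> C * sqrt (R / 2) + C * (1 - 1 / sqrt 2) * sqrt R"
        using C False by (intro add_left_mono mult_right_mono) auto
      also have "\<dots> = C * sqrt R"
        by (simp add: real_sqrt_divide algebra_simps)
      finally show ?thesis by simp
    qed
  qed
  moreover have "\<exists>k. R \<le> 2 ^ k" for R :: real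
    using real_arch_pow[of 2 R] less_imp_le by auto
  ultimately have J: "J R \<le> C * sqrt R" if "1 \<le> R" for R
    using that by blast
  show thesis
  proof (rule that[OF C(3)])
    fix R q and z :: 'a assume "1 \<le> (R::real)"
    \<comment> \<open>The kernel decreases in q, so q = 0 is the worst case; a reflection and
      translation then moves the centre to 0.\<close>
    have "(LINT t|lborel. indicator (ball z R) t * kern (z - t) q) \<le>
        (LINT t|lborel. indicator (ball z R) t * kern (z - t) 0)"
    proof (intro integral_mono int mult_left_mono)
      fix t
      have "(0 + 1 / 2)^2 \<le> (real q + 1 / 2)^2"
        by (intro power_mono) auto
      then have "sqr (z - t) 0 \<le> sqr (z - t) q"
        unfolding sqr_def using weight_pos by (intro add_left_mono mult_left_mono) auto
      then show "kern (z - t) q \<le> kern (z - t) 0"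
        unfolding kern_def using sqr_pos gam_pos by (intro powr_mono2') auto
    qed auto
    also have "\<dots> = (LINT t|lborel. indicator (ball z R) (z - t) * kern (z - (z - t)) 0)"
    proof (rule integral_lborel_reflect[symmetric])
      show "(\<lambda>t. indicator (ball z R) t * kern (z - t) 0) \<in> borel_measurable borel"
        by (intro borel_measurable_times borel_measurable_indicator
            measurable_compose[OF _ kern_measurable]) simp_all
    qed
    also have "\<dots> = J R"
      unfolding J_def by (intro Bochner_Integration.integral_cong)
        (auto simp: indicator_def dist_norm kern_def sqr_def)
    also have "\<dots> \<le> C * sqrt R" using \<open>1 \<le> R\<close> by (rule J)
    finally show "(LINT t|lborel. indicator (ball z R) t * kern (z - t) q) \<le> C * sqrt R" .
  qed
qed

end

section \<open>Centres near which the target has mass\<close>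

lemma measurable_measure_Int_ball:
  fixes T :: "'a::euclidean_space set"
  assumes [measurable]: "T \<in> sets borel"
  shows "(\<lambda>x. emeasure lborel (T \<inter> ball x r)) \<in> borel_measurable borel"
    "(\<lambda>x. measure lborel (T \<inter> ball x r)) \<in> borel_measurable borel"
proof -
  have "{w \<in> space (borel \<Otimes>\<^sub>M lborel). snd w \<in> T \<and> dist (fst w) (snd w) < r} \<in> sets ((borel :: 'a measure) \<Otimes>\<^sub>M lborel)"
    by measurable
  from lborel.measurable_emeasure_Pair[OF this]
  show "(\<lambda>x. emeasure lborel (T \<inter> ball x r)) \<in> borel_measurable borel"
    by (rule measurable_cong[THEN iffD1, rotated])
      (auto simp: space_pair_measure intro!: arg_cong[where f = "emeasure lborel"])
  then show "(\<lambda>x. measure lborel (T \<inter> ball x r)) \<in> borel_measurable borel"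
    unfolding measure_def by measurable
qed

text \<open>Average the mass of \<open>T\<close> in small balls over the centres.\<close>

lemma good_centres:
  fixes T :: "'a::euclidean_space set"
  assumes T [measurable]: "T \<in> sets borel" and r: "1 \<le> r" and c: "0 \<le> c"
    and dens: "c * measure lborel (ball (0::'a) r) \<le> measure lborel (T \<inter> ball 0 r)"
    and \<kappa>: "\<kappa> = c / 2 * measure lborel (ball (0::'a) (1 / 2)) / 2 ^ DIM('a)"
  defines "A \<equiv> {x \<in> ball 0 (2 * r). \<kappa> \<le> measure lborel (T \<inter> ball x (1 / 2))}"
  shows "A \<in> sets borel" "c / 2 * measure lborel (ball (0::'a) r) \<le> measure lborel A"
proof -
  note [measurable] = measurable_measure_Int_ball[OF T]
  show A [measurable]: "A \<in> sets borel"
    unfolding A_def by measurable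
  define v where "v = measure lborel (ball (0::'a) (1 / 2))"
  have v: "0 < v" by (simp add: v_def content_ball_pos)
  have vx: "measure lborel (ball x (1 / 2)) = v" for x :: 'a
    by (simp add: v_def content_ball)
  have fin: "emeasure lborel (S \<inter> ball x s) < \<infinity>" for S :: "'a set" and x s
    by (rule emeasure_bounded_finite) auto
  have fin': "emeasure lborel S = ennreal (measure lborel S)" if "bounded S" for S :: "'a set"
    using emeasure_bounded_finite[OF that] by (intro emeasure_eq_ennreal_measure) auto
  have bA: "bounded A" unfolding A_def by (rule bounded_subset[of "ball 0 (2 * r)"]) auto
  have "ennreal (measure lborel (T \<inter> ball 0 r) * v) = (\<integral>\<^sup>+t. ennreal v * indicator (T \<inter> ball 0 r) t \<partial>lborel)"
    by (subst nn_integral_cmult_indicator) (auto simp: fin' bounded_Int v less_imp_le ennreal_mult mult.commute)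
  \<comment> \<open>The pairs (x, t) with t in T and distance below 1/2 are counted in two orders.
    All relevant x lie in the ball of radius 2 * r because r \<ge> 1.\<close>
  also have "\<dots> \<le> (\<integral>\<^sup>+t. (\<integral>\<^sup>+x. indicator T t * indicator (ball 0 (2 * r)) x * indicator {w. dist (fst w) (snd w) < 1 / 2} (x, t) \<partial>lborel) \<partial>lborel)"
  proof (rule nn_integral_mono)
    fix t :: 'a
    show "ennreal v * indicator (T \<inter> ball 0 r) t \<le>
      (\<integral>\<^sup>+x. indicator T t * indicator (ball 0 (2 * r)) x * indicator {w. dist (fst w) (snd w) < 1 / 2} (x, t) \<partial>lborel)"
    proof (cases "t \<in> T \<inter> ball 0 r")
      case True
      have "ennreal v = emeasure lborel (ball t (1 / 2))"
        by (simp add: fin' vx)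
      also have "\<dots> = (\<integral>\<^sup>+x. indicator (ball t (1 / 2)) x \<partial>lborel)"
        by simp
      also have "\<dots> \<le> (\<integral>\<^sup>+x. indicator T t * indicator (ball 0 (2 * r)) x * indicator {w. dist (fst w) (snd w) < 1 / 2} (x, t) \<partial>lborel)"
      proof (rule nn_integral_mono)
        fix x
        have "norm x < 2 * r" if "dist t x < 1 / 2"
          using that True r norm_triangle_ineq[of "x - t" t] by (auto simp: dist_norm norm_minus_commute)
        then show "indicator (ball t (1 / 2)) x \<le>
          (indicator T t * indicator (ball 0 (2 * r)) x * indicator {w. dist (fst w) (snd w) < 1 / 2} (x, t) :: ennreal)"
          using True by (auto simp: indicator_def dist_commute)
      qed
      finally show ?thesis using True by simp
    qed simp
  qed
  also have "\<dots> = (\<integral>\<^sup>+x. (\<integral>\<^sup>+t. indicator T t * indicator (ball 0 (2 * r)) x * indicator {w. dist (fst w) (snd w) < 1 / 2} (x, t) \<partial>lborel) \<partial>lborel)"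
  proof (rule lborel_pair.Fubini')
    show "(\<lambda>(x, t). indicator T t * indicator (ball 0 (2 * r)) x * (indicator {w. dist (fst w) (snd w) < 1 / 2} (x, t) :: ennreal))
      \<in> borel_measurable (lborel \<Otimes>\<^sub>M (lborel :: 'a measure))"
    proof -
      have "{w \<in> space ((borel :: 'a measure) \<Otimes>\<^sub>M borel). dist (fst w) (snd w :: 'a) < 1 / 2} \<in> sets (borel \<Otimes>\<^sub>M borel)"
        by measurable
      then have W: "{w. dist (fst w) (snd w :: 'a) < 1 / 2} \<in> sets (borel \<Otimes>\<^sub>M borel)"
        by (simp add: space_pair_measure)
      have "(\<lambda>w. indicator T (snd w) * indicator (ball 0 (2 * r)) (fst w) *
          (indicator {w. dist (fst w) (snd w) < 1 / 2} w :: ennreal)) \<in> borel_measurable (borel \<Otimes>\<^sub>M borel)"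
        by (intro borel_measurable_times_ennreal measurable_compose[OF measurable_snd borel_measurable_indicator]
            measurable_compose[OF measurable_fst borel_measurable_indicator] borel_measurable_indicator)
          (use W in simp_all)
      moreover have "borel_measurable (borel \<Otimes>\<^sub>M borel) =
          (borel_measurable (lborel \<Otimes>\<^sub>M lborel) :: ('a \<times> 'a \<Rightarrow> ennreal) set)"
        by (intro measurable_cong_sets sets_pair_measure_cong) simp_all
      ultimately show ?thesis by (simp add: split_beta')
    qed
  qed
  also have "\<dots> = (\<integral>\<^sup>+x. indicator (ball 0 (2 * r)) x * emeasure lborel (T \<inter> ball x (1 / 2)) \<partial>lborel)"
  proof (rule nn_integral_cong)
    fix x :: 'a
    have "(\<integral>\<^sup>+t. indicator T t * indicator (ball 0 (2 * r)) x * indicator {w. dist (fst w) (snd w) < 1 / 2} (x, t) \<partial>lborel)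
      = (\<integral>\<^sup>+t. indicator (ball 0 (2 * r)) x * indicator (T \<inter> ball x (1 / 2)) t \<partial>lborel)"
      by (intro nn_integral_cong) (auto simp: indicator_def)
    then show "(\<integral>\<^sup>+t. indicator T t * indicator (ball 0 (2 * r)) x * indicator {w. dist (fst w) (snd w) < 1 / 2} (x, t) \<partial>lborel)
      = indicator (ball 0 (2 * r)) x * emeasure lborel (T \<inter> ball x (1 / 2))"
      by (simp add: nn_integral_cmult_indicator)
  qed
  also have "\<dots> \<le> (\<integral>\<^sup>+x. ennreal v * indicator A x + ennreal \<kappa> * indicator (ball 0 (2 * r)) x \<partial>lborel)"
  proof (rule nn_integral_mono)
    fix x :: 'a
    have "emeasure lborel (T \<inter> ball x (1 / 2)) \<le> ennreal v"
      unfolding vx[of x, symmetric] fin'[OF bounded_ball, symmetric] by (rule emeasure_mono) auto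
    moreover have "emeasure lborel (T \<inter> ball x (1 / 2)) \<le> ennreal \<kappa>" if "x \<in> ball 0 (2 * r)" "x \<notin> A"
      using that by (auto simp: A_def fin' bounded_Int intro!: ennreal_leI)
    ultimately show "indicator (ball 0 (2 * r)) x * emeasure lborel (T \<inter> ball x (1 / 2))
      \<le> ennreal v * indicator A x + ennreal \<kappa> * indicator (ball 0 (2 * r)) x"
      by (auto simp: indicator_def intro: add_increasing2)
  qed
  also have "\<dots> = ennreal (v * measure lborel A + \<kappa> * measure lborel (ball (0::'a) (2 * r)))"
  proof -
    have "0 \<le> \<kappa>" using v c by (simp add: \<kappa> v_def)
    have "(\<integral>\<^sup>+x. ennreal v * indicator A x + ennreal \<kappa> * indicator (ball 0 (2 * r)) x \<partial>lborel) =
        (\<integral>\<^sup>+x. ennreal v * indicator A x \<partial>lborel) + (\<integral>\<^sup>+x. ennreal \<kappa> * indicator (ball (0::'a) (2 * r)) x \<partial>lborel)"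
      by (intro nn_integral_add borel_measurable_times_ennreal borel_measurable_indicator borel_measurable_const) simp_all
    also have "\<dots> = ennreal v * emeasure lborel A + ennreal \<kappa> * emeasure lborel (ball (0::'a) (2 * r))"
      by (simp add: nn_integral_cmult_indicator)
    also have "\<dots> = ennreal (v * measure lborel A + \<kappa> * measure lborel (ball (0::'a) (2 * r)))"
      unfolding fin'[OF bA] fin'[OF bounded_ball] using v \<open>0 \<le> \<kappa>\<close>
      by (simp add: ennreal_mult' ennreal_plus)
    finally show ?thesis .
  qed
  finally have "measure lborel (T \<inter> ball 0 r) * v \<le> v * measure lborel A + \<kappa> * measure lborel (ball (0::'a) (2 * r))"
    using v c by (subst (asm) ennreal_le_iff) (auto simp: \<kappa>)
  \<comment> \<open>\<kappa> is chosen for this identity: the centres outside A account for at most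
    half of the guaranteed mass, and the other half is left for A.\<close>
  also have "\<kappa> * measure lborel (ball (0::'a) (2 * r)) = v * (c / 2 * measure lborel (ball (0::'a) r))"
    using r by (simp add: \<kappa> v_def[symmetric] content_ball power_mult_distrib)
  finally have "v * measure lborel (T \<inter> ball 0 r) \<le> v * (measure lborel A + c / 2 * measure lborel (ball (0::'a) r))"
    by (simp add: algebra_simps)
  then have "measure lborel (T \<inter> ball 0 r) \<le> measure lborel A + c / 2 * measure lborel (ball (0::'a) r)"
    using v by simp
  then show "c / 2 * measure lborel (ball (0::'a) r) \<le> measure lborel A"
    using dens by linarith
qed

subsection \<open>Supersolutions and the comparison with the potential\<close>

lemma integral_ball_step_indicator:
  fixes S :: "'a::euclidean_space set"
  assumes S [measurable]: "S \<in> sets borel" and "S \<subseteq> ball z 1"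
  shows "(LINT u|ball_step. indicator S (z + u)) = measure lborel S / measure lborel (ball (0::'a) 1)"
proof -
  have pre [measurable]: "(\<lambda>u. z + u) -` S \<in> sets borel"
    using measurable_sets[of "\<lambda>u. z + u" borel borel S] by simp
  have "(LINT u|ball_step. indicator S (z + u)) = (LINT u|ball_step. indicator ((\<lambda>u. z + u) -` S) u)"
    by (intro Bochner_Integration.integral_cong) (auto simp: indicator_def)
  also have "\<dots> = measure ball_step ((\<lambda>u. z + u) -` S)"
    by simp
  also have "\<dots> = measure lborel (ball 0 1 \<inter> (\<lambda>u. z + u) -` S) / measure lborel (ball (0::'a) 1)"
    unfolding ball_step_def
    by (intro measure_uniform_measure emeasure_ball_neq_0 emeasure_ball_neq_top) auto
  also have "ball 0 1 \<inter> (\<lambda>u. z + u) -` S = (\<lambda>u. z + u) -` S"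
    using assms(2) by (fastforce simp: dist_norm)
  also have "measure lborel ((\<lambda>u. z + u) -` S) = measure (distr lborel borel (\<lambda>u. z + u)) S"
    by (subst measure_distr) auto
  also have "distr lborel borel (\<lambda>u. z + u) = lborel"
    by (rule lborel_distr_plus)
  finally show ?thesis .
qed

context cancelled_walk
begin

text \<open>The square root of \<open>sqr\<close>, written as a norm in the product space so that
  the triangle inequality is available.\<close>

definition radius :: "'a \<Rightarrow> nat \<Rightarrow> real" where
  "radius z q = norm (z, sqrt weight * (real q + 1 / 2))"

lemma sqr_eq_radius: "sqr z q = (radius z q)^2"
  using weight_pos by (simp add: sqr_def radius_def norm_Pair power_mult_distrib)

lemma radius_nonneg: "0 \<le> radius z q"
  by (simp add: radius_def)

lemma radius_measurable [measurable]: "(\<lambda>z. radius z q) \<in> borel_measurable borel"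
  unfolding radius_def by (intro borel_measurable_continuous_onI continuous_intros)

lemma radius_add: "radius (z + u) q \<le> radius z q + norm u"
proof -
  have "radius (z + u) q = norm ((z, sqrt weight * (real q + 1 / 2)) + (u, 0))"
    by (simp add: radius_def)
  also have "\<dots> \<le> radius z q + norm (u, 0 :: real)"
    unfolding radius_def by (rule norm_triangle_ineq)
  finally show ?thesis by (simp add: norm_Pair)
qed

lemma radius_diff: "radius z q \<le> radius (z - t) q + norm t"
  using radius_add[of "z - t" t q] by simp

lemma radius_diff': "radius (z - t) q \<le> radius z q + norm t"
  using radius_add[of z "- t" q] by simp

lemma radius_mono:
  assumes "norm z \<le> norm z'" "q \<le> q'"
  shows "radius z q \<le> radius z' q'"
proof -
  have "(sqrt weight * (real q + 1 / 2))^2 \<le> (sqrt weight * (real q' + 1 / 2))^2"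
    using weight_pos assms(2) by (intro power_mono mult_left_mono) auto
  moreover have "(norm z)^2 \<le> (norm z')^2"
    using assms(1) by (intro power_mono) auto
  ultimately show ?thesis
    unfolding radius_def norm_Pair by (intro real_sqrt_le_mono add_mono) (simp_all add: power_mult_distrib)
qed

text \<open>With \<open>radius_add\<close> this bounds the growth of the radius in one round; it is
  the origin of the margin 1 + sqrt weight in the lemmas below.\<close>

lemma radius_Suc: "radius z (Suc q) \<le> radius z q + sqrt weight"
proof -
  have "radius z (Suc q) = norm ((z, sqrt weight * (real q + 1 / 2)) + (0, sqrt weight))"
    by (simp add: radius_def algebra_simps)
  also have "\<dots> \<le> radius z q + norm (0 :: 'a, sqrt weight)"
    unfolding radius_def by (rule norm_triangle_ineq)
  finally show ?thesis using weight_pos by (simp add: norm_Pair)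
qed

lemma norm_le_radius: "norm z \<le> radius z q"
  by (simp add: radius_def norm_Pair real_le_rsqrt)

lemma weight_le_radius: "sqrt weight * real q \<le> radius z q"
proof -
  have "sqrt weight * real q \<le> sqrt weight * (real q + 1 / 2)"
    using weight_pos by (intro mult_left_mono) auto
  also have "\<dots> \<le> radius z q"
    unfolding radius_def norm_Pair by (rule real_le_rsqrt) simp
  finally show ?thesis .
qed

text \<open>An axiomatic stand-in for the hitting probability that is stable under the rescaling
  between scales. Signs are prescribed only below radius R, because a rescaled function may be
  negative further out; the bound is global so that all averages exist.\<close>

definition supersolution :: "'a set \<Rightarrow> real \<Rightarrow> ('a \<Rightarrow> nat \<Rightarrow> real) \<Rightarrow> bool" where
  "supersolution T R f \<longleftrightarrow>
    (\<forall>q. (\<lambda>z. f z q) \<in> borel_measurable borel) \<and> (\<exists>M. \<forall>z q. \<bar>f z q\<bar> \<le> M) \<and>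
    (\<forall>z q. radius z q < R \<longrightarrow> 0 \<le> f z q) \<and>
    (\<forall>z\<in>T. radius z 0 < R \<longrightarrow> 1 \<le> f z 0) \<and>
    (\<forall>z q. radius z q < R \<longrightarrow> \<not> (z \<in> T \<and> q = 0) \<longrightarrow> walk f z q \<le> f z q)"

lemma integrable_shift:
  fixes f :: "'a \<Rightarrow> real"
  assumes f [measurable]: "f \<in> borel_measurable borel" and "\<And>z. \<bar>f z\<bar> \<le> M"
  shows "integrable ball_step (\<lambda>u. f (z + u))"
  by (rule integrable_ball_step[of _ M]) (use assms(2) in auto)

text \<open>At this distance from radius R all three terms of \<open>walk\<close> are nonnegative,
  so each of them alone is a lower bound: a win of Player 1, or a random move that lands in
  S.\<close>

lemma supersolution_ge_cont:
  assumes sup: "supersolution T R f" and R: "radius z q + 1 + sqrt weight < R"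
    and nt: "\<not> (z \<in> T \<and> q = 0)"
  shows "a * f z (q - 1) \<le> f z q"
    and "\<And>S e. S \<in> sets borel \<Longrightarrow> S \<subseteq> ball z 1 \<Longrightarrow> (\<And>x. x \<in> S \<Longrightarrow> e \<le> f x q) \<Longrightarrow>
      (1 - 2 * a) * (e * (measure lborel S / measure lborel (ball (0::'a) 1))) \<le> f z q"
proof -
  have b: "0 \<le> sqrt weight" using weight_pos by simp
  have [measurable]: "\<And>q. (\<lambda>z. f z q) \<in> borel_measurable borel"
    using sup by (simp add: supersolution_def)
  obtain M where M: "\<And>z q. \<bar>f z q\<bar> \<le> M"
    using sup by (auto simp: supersolution_def)
  have int: "integrable ball_step (\<lambda>u. f (z + u) q)"
    by (rule integrable_shift) (use M in auto)
  have nonneg: "0 \<le> f z' q'" if "radius z' q' < R" for z' q'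
    using sup that by (simp add: supersolution_def)
  have n1: "0 \<le> f z (q - 1)"
  proof (rule nonneg)
    have "radius z (q - 1) \<le> radius z q" by (rule radius_mono) auto
    then show "radius z (q - 1) < R" using R b by linarith
  qed
  have n2: "0 \<le> f z (Suc q)"
    by (rule nonneg) (use R b radius_Suc[of z q] in linarith)
  have nu: "0 \<le> f (z + u) q" if "norm u < 1" for u
    by (rule nonneg) (use R b radius_add[of z u q] that in linarith)
  have n3: "0 \<le> (LINT u|ball_step. f (z + u) q)"
    using integral_ball_step_mono[of "\<lambda>_. 0", OF _ int] nu by simp
  have "walk f z q \<le> f z q"
  proof -
    have "radius z q < R" using R b by linarith
    then show ?thesis using sup nt by (simp add: supersolution_def)
  qed
  then have w: "a * f z (q - 1) + a * f z (Suc q) + (1 - 2 * a) * (LINT u|ball_step. f (z + u) q) \<le> f z q"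
    by (simp add: walk_def)
  show "a * f z (q - 1) \<le> f z q"
    using w mult_nonneg_nonneg[OF less_imp_le[OF a_pos] n2] mult_nonneg_nonneg[of "1 - 2 * a", OF _ n3] a_less
    by linarith
  fix S e assume S: "S \<in> sets borel" "S \<subseteq> ball z 1" "\<And>x. x \<in> S \<Longrightarrow> e \<le> f x q"
  have "(LINT u|ball_step. e * indicator S (z + u)) \<le> (LINT u|ball_step. f (z + u) q)"
  proof (rule integral_ball_step_mono[OF _ int])
    show "integrable ball_step (\<lambda>u. e * indicator S (z + u))"
      using S(1) by (intro integrable_mult_right integrable_shift[of _ 1]) (auto simp: indicator_def)
    show "e * indicator S (z + u) \<le> f (z + u) q" if "norm u < 1" for u
      using S(3) nu[OF that] by (auto simp: indicator_def)
  qed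
  then have "e * (measure lborel S / measure lborel (ball (0::'a) 1)) \<le> (LINT u|ball_step. f (z + u) q)"
    by (simp add: integral_ball_step_indicator[OF S(1,2)])
  then have "(1 - 2 * a) * (e * (measure lborel S / measure lborel (ball (0::'a) 1)))
      \<le> (1 - 2 * a) * (LINT u|ball_step. f (z + u) q)"
    using a_less by (intro mult_left_mono) auto
  then show "(1 - 2 * a) * (e * (measure lborel S / measure lborel (ball (0::'a) 1))) \<le> f z q"
    using w mult_nonneg_nonneg[OF less_imp_le[OF a_pos] n1] mult_nonneg_nonneg[OF less_imp_le[OF a_pos] n2]
    by linarith
qed

text \<open>
  The walk can first undo all moves of Player 2; then the random moves alone can lead into the
  target.
\<close>

lemma barrier_near:
  assumes C: "0 \<le> C" and \<kappa>: "0 < \<kappa>"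
  obtains c\<^sub>3 where "0 < c\<^sub>3" "c\<^sub>3 \<le> 1"
    "\<And>T R f x z q. T \<in> sets borel \<Longrightarrow> supersolution T R f \<Longrightarrow>
      \<kappa> \<le> measure lborel (T \<inter> ball x (1 / 2)) \<Longrightarrow> norm x + C + 2 + 2 * sqrt weight < R \<Longrightarrow>
      radius (z - x) q < C \<Longrightarrow> c\<^sub>3 \<le> f z q"
proof -
  define v where "v = measure lborel (ball (0::'a) 1)"
  \<comment> \<open>\<open>c\<^sub>0\<close> bounds the chance to enter T in one random move from
    within 1/2 of x, and \<rho> is the chance that a random move lands in a given ball of radius
    1/4. A distance below C needs at most Mz such moves, each gaining 1/4, and a radius below C
    allows a count of at most Mq.\<close>
  define c\<^sub>0 where "c\<^sub>0 = min 1 ((1 - 2 * a) * (\<kappa> / v))"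
  define \<rho> where "\<rho> = (1 - 2 * a) * (1 / 4) ^ DIM('a)"
  define Mz where "Mz = nat \<lceil>4 * C\<rceil>"
  define Mq where "Mq = nat \<lceil>C / sqrt weight\<rceil>"
  define c\<^sub>3 where "c\<^sub>3 = a ^ Mq * (c\<^sub>0 * \<rho> ^ Mz)"
  have v: "0 < v" by (simp add: v_def content_ball_pos)
  have c0: "0 < c\<^sub>0" "c\<^sub>0 \<le> 1"
    using v \<kappa> a_less by (auto simp: c\<^sub>0_def)
  have \<rho>: "0 < \<rho>" "\<rho> \<le> 1"
  proof -
    show "0 < \<rho>" using a_less by (simp add: \<rho>_def)
    have "(1 - 2 * a) * (1 / 4) ^ DIM('a) \<le> 1 * 1"
      using a_pos a_less by (intro mult_mono power_le_one) auto
    then show "\<rho> \<le> 1" by (simp add: \<rho>_def)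
  qed
  have b: "0 < sqrt weight" using weight_pos by simp
  have near: "c\<^sub>3 \<le> f z q"
    if T: "T \<in> sets borel" and sup: "supersolution T R f"
      and mass: "\<kappa> \<le> measure lborel (T \<inter> ball x (1 / 2))" and R: "norm x + C + 2 + 2 * sqrt weight < R"
      and near: "radius (z - x) q < C" for T R f x z q
  proof -
    have inR: "radius z' q' + 1 + sqrt weight < R" if "radius (z' - x) q' < C" for z' q'
      using radius_diff[of z' q' x] that R b by linarith
    have inR0: "radius z' 0 + 1 + sqrt weight < R" if "norm (z' - x) < C + 1" for z'
    proof -
      have "radius z' 0 = norm ((z' - x, 0) + (x, sqrt weight * (1 / 2)))"
        by (simp add: radius_def)
      also have "\<dots> \<le> norm (z' - x, 0::real) + norm (x, sqrt weight * (1 / 2))"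
        by (rule norm_triangle_ineq)
      also have "norm (x, sqrt weight * (1 / 2)) \<le> norm x + norm (sqrt weight * (1 / 2))"
        by (rule norm_Pair_le)
      finally have "radius z' 0 \<le> norm (z' - x) + norm x + sqrt weight / 2"
        using b by (simp add: norm_Pair)
      then show ?thesis using that R b by linarith
    qed
    have on_T: "1 \<le> f z' 0" if "z' \<in> T" "radius z' 0 < R" for z'
      using sup that by (simp add: supersolution_def)
    have zmove: "c\<^sub>0 * \<rho> ^ m \<le> f z' 0" if "norm (z' - x) < 1 / 2 + real m / 4" "norm (z' - x) < C" for m z'
      using that
    proof (induction m arbitrary: z')
      case 0
      have bd: "radius z' 0 + 1 + sqrt weight < R" using inR0 0 by simp
      show ?case
      proof (cases "z' \<in> T")
        case True
        have "radius z' 0 < R" using bd b by linarith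
        then show ?thesis using on_T[OF True] c0 by simp
      next
        case False
        have sub: "T \<inter> ball x (1 / 2) \<subseteq> ball z' 1"
        proof
          fix t assume "t \<in> T \<inter> ball x (1 / 2)"
          then show "t \<in> ball z' 1"
            using 0(1) dist_triangle[of z' t x] by (simp add: dist_norm)
        qed
        have "(1 - 2 * a) * (1 * (measure lborel (T \<inter> ball x (1 / 2)) / v)) \<le> f z' 0"
          unfolding v_def
        proof (rule supersolution_ge_cont(2)[OF sup bd _ _ sub])
          fix t assume t: "t \<in> T \<inter> ball x (1 / 2)"
          have "radius t 0 \<le> radius z' 0 + norm (t - z')"
            using radius_add[of z' "t - z'" 0] by simp
          moreover have "norm (t - z') < 1" using t sub by (auto simp: dist_norm norm_minus_commute)
          ultimately have "radius t 0 < R" using bd b by linarith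
          then show "1 \<le> f t 0" using on_T[of t] t by auto
        qed (use T False in auto)
        moreover have "(1 - 2 * a) * (\<kappa> / v) \<le> (1 - 2 * a) * (measure lborel (T \<inter> ball x (1 / 2)) / v)"
          using mass v a_less by (intro mult_left_mono divide_right_mono) auto
        ultimately show ?thesis by (simp add: c\<^sub>0_def)
      qed
    next
      case (Suc m)
      have bd: "radius z' 0 + 1 + sqrt weight < R" using inR0 Suc.prems by simp
      have mono: "c\<^sub>0 * \<rho> ^ Suc m \<le> c\<^sub>0 * \<rho> ^ j" if "j \<le> Suc m" for j
        using c0 \<rho> that by (intro mult_left_mono power_decreasing) auto
      show ?case
      proof (cases "norm (z' - x) < 1 / 2 \<or> z' \<in> T")
        case True
        then show ?thesis
        proof
          assume "z' \<in> T"
          moreover have "radius z' 0 < R" using bd b by linarith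
          ultimately have "1 \<le> f z' 0" by (rule on_T)
          then show ?thesis using mono[OF le0] c0 unfolding power_0 mult_1_right by linarith
        next
          assume n: "norm (z' - x) < 1 / 2"
          have "norm (z' - x) < 1 / 2 + real m / 4" using n by (rule less_le_trans) simp
          then show ?thesis using Suc.IH Suc.prems mono[of m] by fastforce
        qed
      next
        case False
        \<comment> \<open>The point half a unit closer to x: the ball of radius 1/4 about it is
          within reach, and all its points are closer to x by more than 1/4.\<close>
        define w where "w = z' - (1 / (2 * norm (z' - x))) *\<^sub>R (z' - x)"
        have pos: "0 < norm (z' - x)" "1 / 2 \<le> norm (z' - x)" using False by linarith+
        then have wz: "norm (w - z') = 1 / 2" by (simp add: w_def)
        have "w - x = (1 - 1 / (2 * norm (z' - x))) *\<^sub>R (z' - x)"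
          by (simp add: w_def algebra_simps)
        then have "norm (w - x) = \<bar>1 - 1 / (2 * norm (z' - x))\<bar> * norm (z' - x)"
          by simp
        also have "\<dots> = \<bar>(1 - 1 / (2 * norm (z' - x))) * norm (z' - x)\<bar>"
          by (simp add: abs_mult)
        also have "(1 - 1 / (2 * norm (z' - x))) * norm (z' - x) = norm (z' - x) - 1 / 2"
          using pos(1) by (simp add: field_simps)
        finally have wx: "norm (w - x) = norm (z' - x) - 1 / 2"
          using pos(2) by linarith
        have sub: "ball w (1 / 4) \<subseteq> ball z' 1"
        proof
          fix t assume "t \<in> ball w (1 / 4)"
          then show "t \<in> ball z' 1"
            using wz dist_triangle[of z' t w] by (simp add: dist_norm norm_minus_commute)
        qed
        have "(1 - 2 * a) * (c\<^sub>0 * \<rho> ^ m * (measure lborel (ball w (1 / 4)) / v)) \<le> f z' 0"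
          unfolding v_def
        proof (rule supersolution_ge_cont(2)[OF sup bd _ _ sub])
          fix t assume t: "t \<in> ball w (1 / 4)"
          have "norm (t - x) \<le> norm (t - w) + norm (w - x)"
            using norm_triangle_ineq[of "t - w" "w - x"] by simp
          then have "norm (t - x) < norm (z' - x) - 1 / 4"
            using t wx by (simp add: dist_norm norm_minus_commute)
          then show "c\<^sub>0 * \<rho> ^ m \<le> f t 0"
            using Suc.prems by (intro Suc.IH) (simp_all add: field_simps)
        qed (use False in auto)
        moreover have "measure lborel (ball w (1 / 4)) / v = (1 / 4) ^ DIM('a)"
          using unit_ball_vol_pos[of "real DIM('a)", OF of_nat_0_le_iff] by (simp add: v_def content_ball less_imp_neq[symmetric])
        ultimately show ?thesis by (simp add: \<rho>_def mult_ac)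
      qed
    qed
    have zall: "c\<^sub>0 * \<rho> ^ Mz \<le> f z' 0" if "norm (z' - x) < C" for z'
    proof (rule zmove)
      have "4 * C \<le> real Mz" unfolding Mz_def by (rule real_nat_ceiling_ge)
      then show "norm (z' - x) < 1 / 2 + real Mz / 4" using that by linarith
    qed (rule that)
    have qmove: "a ^ q * (c\<^sub>0 * \<rho> ^ Mz) \<le> f z q"
      using near
    proof (induction q)
      case 0
      then show ?case using zall[of z] norm_le_radius[of "z - x" 0] by simp
    next
      case (Suc q)
      have "radius (z - x) q < C"
        using radius_mono[of "z - x" "z - x" q "Suc q"] Suc.prems by simp
      then have "a * (a ^ q * (c\<^sub>0 * \<rho> ^ Mz)) \<le> a * f z q"
        using Suc.IH a_pos by (intro mult_left_mono) auto
      also have "\<dots> \<le> f z (Suc q)"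
        using supersolution_ge_cont(1)[OF sup inR[OF Suc.prems]] by simp
      finally show ?case by (simp add: mult_ac)
    qed
    have "real q \<le> C / sqrt weight"
      using weight_le_radius[of q "z - x"] near b by (simp add: pos_le_divide_eq mult.commute)
    also have "\<dots> \<le> real Mq" unfolding Mq_def by (rule real_nat_ceiling_ge)
    finally have "a ^ Mq \<le> a ^ q"
      using a_pos a_less by (intro power_decreasing) auto
    then have "c\<^sub>3 \<le> a ^ q * (c\<^sub>0 * \<rho> ^ Mz)"
      unfolding c\<^sub>3_def using c0 \<rho> by (intro mult_right_mono) auto
    then show ?thesis using qmove by linarith
  qed
  show thesis
  proof (rule that[of c\<^sub>3])
    show "0 < c\<^sub>3" using a_pos c0 \<rho> by (simp add: c\<^sub>3_def)
    have "c\<^sub>0 * \<rho> ^ Mz \<le> 1 * 1" using c0 \<rho> by (intro mult_mono power_le_one) auto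
    then have "a ^ Mq * (c\<^sub>0 * \<rho> ^ Mz) \<le> 1 * 1"
      using a_pos a_less c0 \<rho> by (intro mult_mono power_le_one) auto
    then show "c\<^sub>3 \<le> 1" by (simp add: c\<^sub>3_def)
  qed (rule near)
qed

end

lemma integral_indicator_times_bounds:
  fixes g :: "'a \<Rightarrow> real"
  assumes "integrable M (\<lambda>t. indicator A t * g t)" "A \<in> sets M" "emeasure M A < \<infinity>"
  shows "(\<And>t. t \<in> A \<Longrightarrow> g t \<le> K) \<Longrightarrow> (LINT t|M. indicator A t * g t) \<le> K * measure M A"
    and "(\<And>t. t \<in> A \<Longrightarrow> K \<le> g t) \<Longrightarrow> K * measure M A \<le> (LINT t|M. indicator A t * g t)"
proof -
  have i: "integrable M (\<lambda>t. K * indicator A t)"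
    using assms by (intro integrable_mult_right integrable_real_indicator)
  have e: "(LINT t|M. K * indicator A t) = K * measure M A"
    using assms(2) by (simp add: sets.Int_space_eq2)
  show "(LINT t|M. indicator A t * g t) \<le> K * measure M A" if "\<And>t. t \<in> A \<Longrightarrow> g t \<le> K"
    unfolding e[symmetric] using assms i that by (intro integral_mono) (auto simp: indicator_def)
  show "K * measure M A \<le> (LINT t|M. indicator A t * g t)" if "\<And>t. t \<in> A \<Longrightarrow> K \<le> g t"
    unfolding e[symmetric] using assms i that by (intro integral_mono) (auto simp: indicator_def)
qed

context cancelled_walk
begin

lemma walk_affine:
  assumes "integrable ball_step (\<lambda>u. f (z + u) q)"
  shows "walk (\<lambda>z q. k * (f z q - m)) z q = k * (walk f z q - m)"
proof -
  have e: "(LINT u|ball_step. k * (f (z + u) q - m)) = k * ((LINT u|ball_step. f (z + u) q) - m)"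
    using assms by (simp add: ball_step.prob_space[simplified])
  show ?thesis unfolding walk_def e by (simp add: algebra_simps)
qed

text \<open>A maximum principle. If v exceeded f somewhere, take a point where v - f is positive and
  within \<delta> of its supremum. There v gains at least \<delta> in one round while f gains
  nothing, so the average of v - f after the round would exceed the supremum. Outside radius R' this
  average meets only v \<le> 0 \<le> f, and the margin below R keeps f nonnegative there.\<close>

lemma comparison:
  assumes sup: "supersolution T R f"
    and v_meas: "\<And>q. (\<lambda>z. v z q) \<in> borel_measurable borel" and v_bd: "\<And>z q. \<bar>v z q\<bar> \<le> B"
    and R': "R' + 1 + sqrt weight \<le> R" and \<delta>: "0 < \<delta>"
    and inside: "\<And>z q. radius z q < R' \<Longrightarrow>
      v z q \<le> f z q \<or> v z q + \<delta> \<le> walk v z q \<and> \<not> (z \<in> T \<and> q = 0)"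
    and outside: "\<And>z q. R' \<le> radius z q \<Longrightarrow> v z q \<le> 0"
    and z0: "radius z0 q0 < R'"
  shows "v z0 q0 \<le> f z0 q0"
proof (rule ccontr)
  assume neg: "\<not> v z0 q0 \<le> f z0 q0"
  have b: "0 \<le> sqrt weight" using weight_pos by simp
  have f_meas: "\<And>q. (\<lambda>z. f z q) \<in> borel_measurable borel"
    using sup by (simp add: supersolution_def)
  obtain M where M: "\<And>z q. \<bar>f z q\<bar> \<le> M"
    using sup by (auto simp: supersolution_def)
  define G where "G = {v z q - f z q | z q. radius z q < R'}"
  have bdd: "bdd_above G"
  proof (rule bdd_aboveI)
    fix x assume "x \<in> G"
    then obtain z q where "x = v z q - f z q" by (auto simp: G_def)
    then show "x \<le> B + M" using v_bd[of z q] M[of z q] by linarith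
  qed
  have "v z0 q0 - f z0 q0 \<le> Sup G"
    using z0 bdd by (intro cSup_upper) (auto simp: G_def)
  then have S: "0 < Sup G" using neg by linarith
  have "G \<noteq> {}" using z0 by (auto simp: G_def)
  moreover have "max 0 (Sup G - \<delta>) < Sup G" using S \<delta> by simp
  ultimately obtain x where "x \<in> G" "max 0 (Sup G - \<delta>) < x"
    by (meson less_cSupE)
  then obtain z q where zq: "radius z q < R'" "0 < v z q - f z q" "Sup G - \<delta> < v z q - f z q"
    by (auto simp: G_def)
  then have vw: "v z q + \<delta> \<le> walk v z q" and nt: "\<not> (z \<in> T \<and> q = 0)"
    using inside[of z q] by linarith+
  have fw: "walk f z q \<le> f z q"
  proof -
    have "radius z q < R" using zq(1) R' b by linarith
    then show ?thesis using sup nt by (simp add: supersolution_def)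
  qed
  have g: "v z' q' - f z' q' \<le> Sup G" if "radius z' q' < R" for z' q'
  proof (cases "radius z' q' < R'")
    case True
    then show ?thesis using bdd by (intro cSup_upper) (auto simp: G_def)
  next
    case False
    then have "v z' q' \<le> 0" by (intro outside) simp
    moreover have "0 \<le> f z' q'" using sup that by (simp add: supersolution_def)
    ultimately show ?thesis using S by linarith
  qed
  have i1: "integrable ball_step (\<lambda>u. v (z + u) q)" "integrable ball_step (\<lambda>u. f (z + u) q)"
    by (rule integrable_shift[OF v_meas v_bd] integrable_shift[OF f_meas M])+
  have "(LINT u|ball_step. v (z + u) q) - (LINT u|ball_step. f (z + u) q) =
      (LINT u|ball_step. v (z + u) q - f (z + u) q)"
    using i1 by simp
  also have "\<dots> \<le> (LINT u|(ball_step :: 'a measure). Sup G)"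
  proof (rule integral_ball_step_mono)
    show "v (z + u) q - f (z + u) q \<le> Sup G" if "norm u < 1" for u :: 'a
      by (rule g) (use radius_add[of z u q] that zq(1) R' b in linarith)
  qed (use i1 in auto)
  also have "\<dots> = Sup G" by (simp add: ball_step.prob_space[simplified])
  finally have g3: "(1 - 2 * a) * ((LINT u|ball_step. v (z + u) q) - (LINT u|ball_step. f (z + u) q))
      \<le> (1 - 2 * a) * Sup G"
    using a_less by (intro mult_left_mono) auto
  have "v z (q - 1) - f z (q - 1) \<le> Sup G"
  proof (rule g)
    have "radius z (q - 1) \<le> radius z q" by (rule radius_mono) auto
    then show "radius z (q - 1) < R" using zq(1) R' b by linarith
  qed
  then have g1: "a * (v z (q - 1) - f z (q - 1)) \<le> a * Sup G"
    using a_pos by (intro mult_left_mono) auto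
  have "v z (Suc q) - f z (Suc q) \<le> Sup G"
    by (rule g) (use radius_Suc[of z q] zq(1) R' b in linarith)
  then have g2: "a * (v z (Suc q) - f z (Suc q)) \<le> a * Sup G"
    using a_pos by (intro mult_left_mono) auto
  have "walk v z q - walk f z q \<le> a * Sup G + a * Sup G + (1 - 2 * a) * Sup G"
    using g1 g2 g3 by (simp add: walk_def algebra_simps)
  also have "\<dots> = Sup G" by (simp add: algebra_simps)
  finally show False using vw fw zq(3) by linarith
qed

text \<open>A Riesz-type potential, in the space of pairs (z, q), of the Lebesgue measure on A
  placed at count 0.\<close>

definition pot :: "'a set \<Rightarrow> 'a \<Rightarrow> nat \<Rightarrow> real" where
  "pot A z q = (LINT t|lborel. indicator A t * kern (z - t) q)"

lemma pot_measurable: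
  assumes [measurable]: "A \<in> sets borel"
  shows "(\<lambda>z. pot A z q) \<in> borel_measurable borel"
  unfolding pot_def
proof (rule lborel.borel_measurable_lebesgue_integral)
  show "(\<lambda>(z, t). indicator A t * kern (z - t) q) \<in> borel_measurable (borel \<Otimes>\<^sub>M lborel)"
    unfolding split_beta'
    by (intro borel_measurable_times measurable_compose[OF measurable_snd borel_measurable_indicator]
        measurable_compose[OF _ kern_measurable]) simp_all
qed

lemma pot_bounds:
  assumes "A \<in> sets borel" "bounded A"
  shows "(\<And>t. t \<in> A \<Longrightarrow> kern (z - t) q \<le> K) \<Longrightarrow> pot A z q \<le> K * measure lborel A"
    and "(\<And>t. t \<in> A \<Longrightarrow> K \<le> kern (z - t) q) \<Longrightarrow> K * measure lborel A \<le> pot A z q"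
  unfolding pot_def using assms emeasure_bounded_finite[OF assms(2)]
  by (intro integral_indicator_times_bounds integrable_kern; simp)+

text \<open>By Fubini averaging commutes with the superposition, so subharmonicity passes from the
  kernel to the potential.\<close>

lemma walk_pot:
  assumes A [measurable]: "A \<in> sets borel" and bA: "bounded A"
  shows "integrable lborel (\<lambda>t. indicator A t * walk kern (z - t) q)"
    and "walk (pot A) z q = (LINT t|lborel. indicator A t * walk kern (z - t) q)"
proof -
  interpret pair_sigma_finite lborel "ball_step :: 'a measure"
    by standard
  let ?f = "\<lambda>t u. indicator A t * kern (z + u - t) q"
  have fin: "emeasure lborel A < \<infinity>" by (rule emeasure_bounded_finite[OF bA])
  have int: "integrable (lborel \<Otimes>\<^sub>M ball_step) (\<lambda>(t, u). ?f t u)"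
  proof (rule Bochner_Integration.integrable_bound)
    show "integrable (lborel \<Otimes>\<^sub>M (ball_step :: 'a measure)) (\<lambda>w. (weight / 4) powr (- gam) * indicator (A \<times> UNIV) w)"
    proof (intro integrable_mult_right integrable_real_indicator)
      have "emeasure (lborel \<Otimes>\<^sub>M (ball_step :: 'a measure)) (A \<times> UNIV) =
          emeasure lborel A * emeasure (ball_step :: 'a measure) UNIV"
        by (rule ball_step.emeasure_pair_measure_Times) auto
      then show "emeasure (lborel \<Otimes>\<^sub>M (ball_step :: 'a measure)) (A \<times> UNIV) < \<infinity>"
        using fin by (simp add: ball_step.emeasure_space_1[simplified])
    qed auto
    show "(\<lambda>(t, u). ?f t u) \<in> borel_measurable (lborel \<Otimes>\<^sub>M ball_step)"
      unfolding split_beta'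
      by (intro borel_measurable_times measurable_compose[OF measurable_fst borel_measurable_indicator]
          measurable_compose[OF _ kern_measurable]) simp_all
    show "AE w in lborel \<Otimes>\<^sub>M ball_step. norm (case w of (t, u) \<Rightarrow> ?f t u)
        \<le> norm ((weight / 4) powr (- gam) * indicator (A \<times> UNIV) w)"
      using kern_le_bound by (auto simp: abs_of_pos[OF kern_pos] indicator_def)
  qed
  have eq: "(LINT u|ball_step. ?f t u) = indicator A t * (LINT u|ball_step. kern (z - t + u) q)" for t
    by (simp add: algebra_simps)
  have i3: "integrable lborel (\<lambda>t. indicator A t * (LINT u|ball_step. kern (z - t + u) q))"
    using integrable_fst[OF int] by (simp only: eq)
  have fub: "(LINT u|ball_step. pot A (z + u) q) =
      (LINT t|lborel. indicator A t * (LINT u|ball_step. kern (z - t + u) q))"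
    unfolding pot_def using Fubini_integral[OF int] by (simp only: eq)
  have i12: "integrable lborel (\<lambda>t. indicator A t * kern (z - t) q')" for q'
    by (rule integrable_kern[OF A bA])
  have w: "indicator A t * walk kern (z - t) q = a * (indicator A t * kern (z - t) (q - 1))
      + a * (indicator A t * kern (z - t) (Suc q))
      + (1 - 2 * a) * (indicator A t * (LINT u|ball_step. kern (z - t + u) q))" for t
    by (simp add: walk_def algebra_simps)
  show "integrable lborel (\<lambda>t. indicator A t * walk kern (z - t) q)"
    unfolding w using i12 i3 by (intro Bochner_Integration.integrable_add integrable_mult_right)
  have "(LINT t|lborel. indicator A t * walk kern (z - t) q) =
      a * pot A z (q - 1) + a * pot A z (Suc q)
      + (1 - 2 * a) * (LINT t|lborel. indicator A t * (LINT u|ball_step. kern (z - t + u) q))"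
  proof -
    let ?g = "\<lambda>t. indicator A t * (LINT u|ball_step. kern (z - t + u) q)"
    have "(LINT t|lborel. a * (indicator A t * kern (z - t) (q - 1)) + a * (indicator A t * kern (z - t) (Suc q))
        + (1 - 2 * a) * ?g t) =
      (LINT t|lborel. a * (indicator A t * kern (z - t) (q - 1)) + a * (indicator A t * kern (z - t) (Suc q)))
        + (LINT t|lborel. (1 - 2 * a) * ?g t)"
      by (intro Bochner_Integration.integral_add Bochner_Integration.integrable_add integrable_mult_right i12 i3)
    also have "(LINT t|lborel. a * (indicator A t * kern (z - t) (q - 1)) + a * (indicator A t * kern (z - t) (Suc q)))
      = (LINT t|lborel. a * (indicator A t * kern (z - t) (q - 1))) + (LINT t|lborel. a * (indicator A t * kern (z - t) (Suc q)))"
      by (intro Bochner_Integration.integral_add integrable_mult_right i12)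
    finally show ?thesis
      unfolding w pot_def by (simp only: integral_mult_right_zero)
  qed
  then show "walk (pot A) z q = (LINT t|lborel. indicator A t * walk kern (z - t) q)"
    by (simp add: walk_def fub)
qed

text \<open>
  The potential of the good centres, suitably normalized, is a lower bound for every
  supersolution: it is at most \<open>c\<^sub>3\<close> near the centres and not positive far away from them.
\<close>

lemma single_scale:
  assumes c: "0 < c"
  obtains \<theta> s\<^sub>0 where "0 < \<theta>" "\<theta> < 1" "1 \<le> s\<^sub>0"
    "\<And>T s f z q. T \<in> sets borel \<Longrightarrow> s\<^sub>0 \<le> s \<Longrightarrow>
      c * measure lborel (ball (0::'a) s) \<le> measure lborel (T \<inter> ball 0 s) \<Longrightarrow>
      supersolution T (16 * s) f \<Longrightarrow> radius z q < s \<Longrightarrow> \<theta> \<le> f z q"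
proof -
  obtain C\<^sub>0 c\<^sub>1 where C0: "1 \<le> C\<^sub>0" and c1: "0 < c\<^sub>1"
    and subh: "\<And>z q. C\<^sub>0^2 \<le> sqr z q \<Longrightarrow> kern z q + c\<^sub>1 * kern z q / sqr z q \<le> walk kern z q"
    using kern_subharmonic by blast
  obtain C where C: "0 < C" and CI: "\<And>R z q. 1 \<le> R \<Longrightarrow>
      (LINT t|lborel. indicator (ball z R) t * kern (z - t) q) \<le> C * sqrt R"
    using integral_kern_ball by blast
  define \<kappa> where "\<kappa> = c / 2 * measure lborel (ball (0::'a) (1 / 2)) / 2 ^ DIM('a)"
  have \<kappa>: "0 < \<kappa>" using c by (simp add: \<kappa>_def content_ball_pos)
  obtain c\<^sub>3 where c3: "0 < c\<^sub>3" "c\<^sub>3 \<le> 1" and near: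
    "\<And>T R f x z q. T \<in> sets borel \<Longrightarrow> supersolution T R f \<Longrightarrow>
      \<kappa> \<le> measure lborel (T \<inter> ball x (1 / 2)) \<Longrightarrow> norm x + C\<^sub>0 + 2 + 2 * sqrt weight < R \<Longrightarrow>
      radius (z - x) q < C\<^sub>0 \<Longrightarrow> c\<^sub>3 \<le> f z q"
    using barrier_near[of C\<^sub>0 \<kappa>] C0 \<kappa> by auto
  \<comment> \<open>For s \<ge> \<open>s\<^sub>0\<close> the gap between radius 15 * s and radius 16
    * s contains a full round, and \<open>near\<close> applies at every centre of norm below 2 *
    s.\<close>
  define s\<^sub>0 where "s\<^sub>0 = C\<^sub>0 + 2 + 2 * sqrt weight"
  define \<omega> where "\<omega> = unit_ball_vol (real DIM('a))"
  \<comment> \<open>All good centres have norm below 2 * s. From a start of radius below s they are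
    at distance at most 3 * s, and from radius 15 * s or more at distance at least 13 * s.\<close>
  define d where "d = 3 powr (- (2 * gam)) - 13 powr (- (2 * gam))"
  \<comment> \<open>The lower bound for v at the start: the factor sqrt s from volume times kernel
    cancels against the sqrt s in W.\<close>
  define \<theta>' where "\<theta>' = c\<^sub>3 / (C * sqrt 18) * (c / 2 * \<omega>) * d"
  have b: "0 < sqrt weight" using weight_pos by simp
  have \<omega>: "0 < \<omega>" by (simp add: \<omega>_def unit_ball_vol_pos)
  have d: "0 < d"
    using gam_pos by (simp add: d_def powr_less_mono2_neg)
  have \<theta>': "0 < \<theta>'" using c3 C c \<omega> d by (simp add: \<theta>'_def)
  have main: "\<theta>' \<le> f z0 q0"
    if T: "T \<in> sets borel" and s: "s\<^sub>0 \<le> s"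
      and dens: "c * measure lborel (ball (0::'a) s) \<le> measure lborel (T \<inter> ball 0 s)"
      and sup: "supersolution T (16 * s) f" and z0: "radius z0 q0 < s" for T s f z0 q0
  proof -
    have s1: "1 \<le> s" using s C0 b unfolding s\<^sub>0_def by linarith
    then have s_pos: "0 < s" by simp
    define A where "A = {x \<in> ball 0 (2 * s). \<kappa> \<le> measure lborel (T \<inter> ball x (1 / 2))}"
    have A [measurable]: "A \<in> sets borel" and vol: "c / 2 * measure lborel (ball (0::'a) s) \<le> measure lborel A"
      using good_centres[OF T s1 less_imp_le[OF c] dens \<kappa>_def] by (simp_all add: A_def)
    have bA: "bounded A" unfolding A_def by (rule bounded_subset[of "ball 0 (2 * s)"]) auto
    have A_norm: "norm t < 2 * s" if "t \<in> A" for t using that by (simp add: A_def)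
    define V where "V = measure lborel A"
    have volV: "c / 2 * (\<omega> * s ^ DIM('a)) \<le> V"
      using vol s_pos by (simp add: content_ball \<omega>_def V_def)
    then have V: "0 < V" using c \<omega> s_pos by (intro less_le_trans[OF _ volV]) simp
    \<comment> \<open>W bounds the potential below radius 16 * s, since every good centre is then
      within 18 * s. Subtracting m makes v nonpositive from radius 15 * s on, and the factor k keeps
      v at most \<open>c\<^sub>3\<close>.\<close>
    define W where "W = C * sqrt (18 * s)"
    define m where "m = (13 * s) powr (- (2 * gam)) * V"
    define k where "k = c\<^sub>3 / W"
    define v where "v = (\<lambda>z q. k * (pot A z q - m))"
    have W: "0 < W" using C s_pos by (simp add: W_def)
    have k: "0 < k" using c3 W by (simp add: k_def)
    have m: "0 \<le> m" using V by (simp add: m_def)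
    have pot0: "0 \<le> pot A z q" for z q
      using pot_bounds(2)[OF A bA, of 0 z q] kern_pos less_imp_le by auto
    have potb: "pot A z q \<le> (weight / 4) powr (- gam) * V" for z q
      unfolding V_def by (rule pot_bounds(1)[OF A bA]) (rule kern_le_bound)
    have pot_meas: "(\<lambda>z. pot A z q) \<in> borel_measurable borel" for q
      by (rule pot_measurable[OF A])
    have pot_abs: "\<bar>pot A z q\<bar> \<le> (weight / 4) powr (- gam) * V" for z q
      using pot0 potb by (simp add: abs_of_nonneg)
    have potW: "pot A z q \<le> W" if "radius z q < 16 * s" for z q
    proof -
      have "pot A z q \<le> (LINT t|lborel. indicator (ball z (18 * s)) t * kern (z - t) q)"
        unfolding pot_def
      proof (intro integral_mono integrable_kern A bA bounded_ball)
        fix t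
        have "t \<in> ball z (18 * s)" if "t \<in> A"
          using norm_triangle_ineq4[of z t] A_norm[OF that] norm_le_radius[of z q] \<open>radius z q < 16 * s\<close>
          by (simp add: dist_norm)
        then show "indicator A t * kern (z - t) q \<le> indicator (ball z (18 * s)) t * kern (z - t) q"
          using kern_pos[of "z - t" q] by (auto simp: indicator_def)
      qed auto
      also have "\<dots> \<le> W" unfolding W_def using s1 by (intro CI) simp
      finally show ?thesis .
    qed
    have v_le: "v z q \<le> c\<^sub>3" if "radius z q < 16 * s" for z q
    proof -
      have "k * (pot A z q - m) \<le> k * W"
        using k potW[OF that] m by (intro mult_left_mono) auto
      then show ?thesis using W by (simp add: v_def k_def)
    qed
    \<comment> \<open>The least gain of the kernel at distances up to 18 * s, times the volume of A.
      It may depend on s: \<open>comparison\<close> asks only for a positive number.\<close>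
    define \<delta> where "\<delta> = k * (c\<^sub>1 * (18 * s) powr (- (2 * gam)) / (18 * s)^2 * V)"
    have "v z0 q0 \<le> f z0 q0"
    proof (rule comparison[OF sup, of v "k * ((weight / 4) powr (- gam) * V + m)" "15 * s" \<delta>])
      show "(\<lambda>z. v z q) \<in> borel_measurable borel" for q
        unfolding v_def by (intro borel_measurable_times borel_measurable_diff pot_meas) auto
      show "\<bar>v z q\<bar> \<le> k * ((weight / 4) powr (- gam) * V + m)" for z q
        using pot_abs[of z q] k m by (simp add: v_def abs_mult)
      show "15 * s + 1 + sqrt weight \<le> 16 * s"
        using s C0 b unfolding s\<^sub>0_def by linarith
      show "0 < \<delta>" using k c1 s_pos V by (simp add: \<delta>_def)
      show "radius z0 q0 < 15 * s" using z0 s_pos by linarith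
      show "v z q \<le> 0" if "15 * s \<le> radius z q" for z q
      proof -
        have "pot A z q \<le> (13 * s) powr (- (2 * gam)) * measure lborel A"
        proof (rule pot_bounds(1)[OF A bA])
          fix t assume "t \<in> A"
          then have "13 * s \<le> radius (z - t) q"
            using A_norm[of t] radius_diff[of z q t] that by linarith
          then have "(13 * s)^2 \<le> sqr (z - t) q"
            unfolding sqr_eq_radius using s_pos by (intro power_mono) auto
          then show "kern (z - t) q \<le> (13 * s) powr (- (2 * gam))"
            using s_pos by (intro kern_le_powr) auto
        qed
        then show ?thesis using k by (simp add: v_def m_def V_def mult_nonneg_nonpos)
      qed
      show "v z q \<le> f z q \<or> v z q + \<delta> \<le> walk v z q \<and> \<not> (z \<in> T \<and> q = 0)"
        if rad: "radius z q < 15 * s" for z q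
      proof -
        have rad16: "radius z q < 16 * s" using rad s_pos by linarith
        \<comment> \<open>On the target f is at least 1, and near a centre it is at least
          \<open>c\<^sub>3\<close>; v is at most \<open>c\<^sub>3\<close> in both cases. Elsewhere
          the distance to every centre is large enough for the strict gain of the kernel.\<close>
        consider "z \<in> T \<and> q = 0" | t where "t \<in> A" "radius (z - t) q < C\<^sub>0"
          | "\<not> (z \<in> T \<and> q = 0)" "\<And>t. t \<in> A \<Longrightarrow> C\<^sub>0 \<le> radius (z - t) q"
          by fastforce
        then show ?thesis
        proof cases
          case 1
          then have "1 \<le> f z q" using sup rad16 by (auto simp: supersolution_def)
          then show ?thesis using v_le[OF rad16] c3 by linarith
        next
          case (2 t)
          have "c\<^sub>3 \<le> f z q"
          proof (rule near[OF T sup _ _ 2(2)])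
            show "\<kappa> \<le> measure lborel (T \<inter> ball t (1 / 2))" using 2(1) by (simp add: A_def)
            show "norm t + C\<^sub>0 + 2 + 2 * sqrt weight < 16 * s"
              using A_norm[OF 2(1)] s s_pos by (simp add: s\<^sub>0_def)
          qed
          then show ?thesis using v_le[OF rad16] by linarith
        next
          case 3
          have step: "(c\<^sub>1 * (18 * s) powr (- (2 * gam)) / (18 * s)^2) \<le> walk kern (z - t) q - kern (z - t) q"
            if t: "t \<in> A" for t
          proof -
            have r18: "radius (z - t) q \<le> 18 * s"
              using radius_diff'[of z t q] A_norm[OF t] rad s_pos by linarith
            have sq: "sqr (z - t) q \<le> (18 * s)^2"
              unfolding sqr_eq_radius using r18 radius_nonneg by (intro power_mono) auto
            have "(c\<^sub>1 * (18 * s) powr (- (2 * gam)) / (18 * s)^2) \<le> c\<^sub>1 * kern (z - t) q / sqr (z - t) q"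
            proof (rule frac_le)
              show "c\<^sub>1 * (18 * s) powr (- (2 * gam)) \<le> c\<^sub>1 * kern (z - t) q"
                using kern_ge_powr[OF _ sq] s_pos c1 by (intro mult_left_mono) auto
            qed (use c1 kern_pos[of "z - t" q] sqr_pos[of "z - t" q] sq in auto)
            moreover have "C\<^sub>0^2 \<le> sqr (z - t) q"
              unfolding sqr_eq_radius using 3(2)[OF t] C0 by (intro power_mono) auto
            ultimately show ?thesis using subh[of "z - t" q] by linarith
          qed
          have "(c\<^sub>1 * (18 * s) powr (- (2 * gam)) / (18 * s)^2) * measure lborel A
              \<le> (LINT t|lborel. indicator A t * (walk kern (z - t) q - kern (z - t) q))"
          proof (rule integral_indicator_times_bounds(2))
            show "integrable lborel (\<lambda>t. indicator A t * (walk kern (z - t) q - kern (z - t) q))"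
              using Bochner_Integration.integrable_diff[OF walk_pot(1)[OF A bA, of z q] integrable_kern[OF A bA, of z q]]
              by (simp add: right_diff_distrib)
          qed (use step emeasure_bounded_finite[OF bA] in auto)
          also have "\<dots> = walk (pot A) z q - pot A z q"
            unfolding walk_pot(2)[OF A bA] pot_def right_diff_distrib
            by (rule Bochner_Integration.integral_diff[OF walk_pot(1)[OF A bA] integrable_kern[OF A bA]])
          finally have "(c\<^sub>1 * (18 * s) powr (- (2 * gam)) / (18 * s)^2) * V \<le> walk (pot A) z q - pot A z q"
            by (simp add: V_def)
          then have "\<delta> \<le> k * (walk (pot A) z q - pot A z q)"
            unfolding \<delta>_def using k by (intro mult_left_mono) auto
          moreover have "walk v z q = k * (walk (pot A) z q - m)"
            unfolding v_def by (rule walk_affine) (rule integrable_shift[OF pot_meas pot_abs])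
          ultimately have "v z q + \<delta> \<le> walk v z q" by (simp add: v_def algebra_simps)
          then show ?thesis using 3(1) by simp
        qed
      qed
    qed
    moreover have "\<theta>' \<le> v z0 q0"
    proof -
      have "(3 * s) powr (- (2 * gam)) * V \<le> pot A z0 q0"
        unfolding V_def
      proof (rule pot_bounds(2)[OF A bA])
        fix t assume "t \<in> A"
        then have "radius (z0 - t) q0 \<le> 3 * s"
          using radius_diff'[of z0 t q0] A_norm[of t] z0 by simp
        then have "sqr (z0 - t) q0 \<le> (3 * s)^2"
          unfolding sqr_eq_radius using radius_nonneg by (intro power_mono) auto
        then show "(3 * s) powr (- (2 * gam)) \<le> kern (z0 - t) q0"
          using s_pos by (intro kern_ge_powr) auto
      qed
      then have a1: "k * ((3 * s) powr (- (2 * gam)) * V - m) \<le> v z0 q0"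
        unfolding v_def using k by (intro mult_left_mono) auto
      have a2: "(3 * s) powr (- (2 * gam)) * V - m = d * (s powr (- (2 * gam)) * V)"
        using s_pos by (simp add: m_def d_def powr_mult algebra_simps)
      have a3: "k * (d * (s powr (- (2 * gam)) * (c / 2 * (\<omega> * s ^ DIM('a))))) \<le> k * (d * (s powr (- (2 * gam)) * V))"
        using volV k d by (intro mult_left_mono) auto
      have a4: "k * (d * (s powr (- (2 * gam)) * (c / 2 * (\<omega> * s ^ DIM('a))))) =
          k * d * (c / 2 * \<omega>) * (s ^ DIM('a) * s powr (- (2 * gam)))"
        by (simp add: mult_ac)
      have a5: "k * d * (c / 2 * \<omega>) * (s ^ DIM('a) * s powr (- (2 * gam))) = \<theta>'"
        unfolding power_DIM_times_powr[OF s_pos] using s_pos C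
        by (simp add: k_def W_def \<theta>'_def real_sqrt_mult mult_ac)
      show ?thesis using order_trans[OF a3 a1[unfolded a2]] unfolding a4 a5 .
    qed
    ultimately show ?thesis by linarith
  qed
  show thesis
  \<comment> \<open>The cap 1/2 keeps \<theta> below 1, so that 1 - \<theta> is a valid ratio for
    the iteration.\<close>
  proof (rule that[of "min \<theta>' (1 / 2)" s\<^sub>0])
    show "1 \<le> s\<^sub>0" using C0 b by (simp add: s\<^sub>0_def)
    show "min \<theta>' (1 / 2) \<le> f z q"
      if "T \<in> sets borel" "s\<^sub>0 \<le> s" "c * measure lborel (ball (0::'a) s) \<le> measure lborel (T \<inter> ball 0 s)"
        "supersolution T (16 * s) f" "radius z q < s" for T s f z q
      using main[OF that] by simp
  qed (use \<theta>' in auto)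
qed

end

section \<open>Iteration over scales and hitting probabilities\<close>

context cancelled_walk
begin

text \<open>The value 1 on the target is a fixed point of the affine map that sends m to 0, and
  \<open>walk\<close> commutes with affine maps. Thus a lower bound on a ball can be divided out;
  this takes the place of the strong Markov property.\<close>

lemma supersolution_rescale:
  assumes sup: "supersolution T R f" and m: "m < 1" and R': "R' \<le> R"
    and ge: "\<And>z q. radius z q < R' \<Longrightarrow> m \<le> f z q"
  shows "supersolution T R' (\<lambda>z q. 1 / (1 - m) * (f z q - m))"
proof -
  have meas: "\<And>q. (\<lambda>z. f z q) \<in> borel_measurable borel"
    using sup by (simp add: supersolution_def)
  obtain M where M: "\<And>z q. \<bar>f z q\<bar> \<le> M"
    using sup by (auto simp: supersolution_def)
  have k: "0 < 1 / (1 - m)" using m by simp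
  show ?thesis
    unfolding supersolution_def
  proof (intro conjI allI ballI impI)
    show "(\<lambda>z. 1 / (1 - m) * (f z q - m)) \<in> borel_measurable borel" for q
      using meas by (intro borel_measurable_times borel_measurable_diff) auto
    have "\<bar>1 / (1 - m) * (f z q - m)\<bar> \<le> 1 / (1 - m) * (M + \<bar>m\<bar>)" for z q
    proof -
      have "\<bar>f z q - m\<bar> \<le> M + \<bar>m\<bar>" using M[of z q] by linarith
      then have "1 / (1 - m) * \<bar>f z q - m\<bar> \<le> 1 / (1 - m) * (M + \<bar>m\<bar>)"
        using k by (intro mult_left_mono) auto
      then show ?thesis using k by (simp only: abs_mult abs_of_pos)
    qed
    then show "\<exists>M. \<forall>z q. \<bar>1 / (1 - m) * (f z q - m)\<bar> \<le> M" by blast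
    show "0 \<le> 1 / (1 - m) * (f z q - m)" if "radius z q < R'" for z q
      using ge[OF that] k by (intro mult_nonneg_nonneg) auto
    show "1 \<le> 1 / (1 - m) * (f z 0 - m)" if "z \<in> T" "radius z 0 < R'" for z
    proof -
      have "1 \<le> f z 0" using sup that R' by (simp add: supersolution_def)
      then have "1 / (1 - m) * (1 - m) \<le> 1 / (1 - m) * (f z 0 - m)"
        using k by (intro mult_left_mono) auto
      then show ?thesis using m by simp
    qed
    show "walk (\<lambda>z q. 1 / (1 - m) * (f z q - m)) z q \<le> 1 / (1 - m) * (f z q - m)"
      if "radius z q < R'" "\<not> (z \<in> T \<and> q = 0)" for z q
    proof -
      have "walk f z q \<le> f z q" using sup that R' by (simp add: supersolution_def)
      then have "1 / (1 - m) * (walk f z q - m) \<le> 1 / (1 - m) * (f z q - m)"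
        using k by (intro mult_left_mono) auto
      then show ?thesis
        by (subst walk_affine[where f = f, OF integrable_shift[OF meas M]])
    qed
  qed
qed

text \<open>Each reduction of the radius by the factor 16 multiplies the bound on the deficit 1 - f
  by 1 - \<theta>. The density of T enters once at every scale, with the same c.\<close>

lemma multi_scale:
  assumes c: "0 < c"
  obtains \<theta> s\<^sub>0 where "0 < \<theta>" "\<theta> < 1" "1 \<le> s\<^sub>0"
    "\<And>T S f k z q. T \<in> sets borel \<Longrightarrow>
      (\<And>r. 1 \<le> r \<Longrightarrow> c * measure lborel (ball (0::'a) r) \<le> measure lborel (T \<inter> ball 0 r)) \<Longrightarrow>
      supersolution T S f \<Longrightarrow> s\<^sub>0 \<le> S / 16 ^ k \<Longrightarrow> radius z q < S / 16 ^ k \<Longrightarrow>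
      1 - (1 - \<theta>) ^ k \<le> f z q"
proof -
  obtain \<theta> s\<^sub>0 where \<theta>: "0 < \<theta>" "\<theta> < 1" and s0: "1 \<le> s\<^sub>0" and single:
    "\<And>T s f z q. T \<in> sets borel \<Longrightarrow> s\<^sub>0 \<le> s \<Longrightarrow>
      c * measure lborel (ball (0::'a) s) \<le> measure lborel (T \<inter> ball 0 s) \<Longrightarrow>
      supersolution T (16 * s) f \<Longrightarrow> radius z q < s \<Longrightarrow> \<theta> \<le> f z q"
    using single_scale[OF c] by blast
  have "1 - (1 - \<theta>) ^ k \<le> f z q"
    if T: "T \<in> sets borel"
      and dens: "\<And>r. 1 \<le> r \<Longrightarrow> c * measure lborel (ball (0::'a) r) \<le> measure lborel (T \<inter> ball 0 r)"
      and sup: "supersolution T S f" and S: "s\<^sub>0 \<le> S / 16 ^ k" and z: "radius z q < S / 16 ^ k"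
    for T S f k z q
    using S z
  proof (induction k arbitrary: z q)
    case 0
    then show ?case using sup by (simp add: supersolution_def)
  next
    case (Suc k)
    define s where "s = S / 16 ^ Suc k"
    define m where "m = 1 - (1 - \<theta>) ^ k"
    have s: "s\<^sub>0 \<le> s" "1 \<le> s" using Suc.prems(1) s0 unfolding s_def by linarith+
    have s16: "16 * s = S / 16 ^ k" by (simp add: s_def)
    have "S = s * 16 ^ Suc k" by (simp add: s_def)
    then have "0 \<le> S" using s(2) by simp
    have m: "m < 1" using \<theta> by (simp add: m_def)
    have "supersolution T (16 * s) (\<lambda>z q. 1 / (1 - m) * (f z q - m))"
    proof (rule supersolution_rescale[OF sup m])
      have "S / 16 ^ k \<le> S / 1"
        using \<open>0 \<le> S\<close> by (intro divide_left_mono) auto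
      then show "16 * s \<le> S" by (simp add: s16)
      show "m \<le> f z q" if "radius z q < 16 * s" for z q
        unfolding m_def using that s by (intro Suc.IH) (auto simp: s16[symmetric])
    qed
    then have "\<theta> \<le> 1 / (1 - m) * (f z q - m)"
      using Suc.prems s dens[OF s(2)] by (intro single[OF T s(1)]) (auto simp: s_def)
    then have "\<theta> * (1 - m) \<le> f z q - m"
      using m by (simp add: field_simps)
    moreover have "1 - (1 - \<theta>) ^ Suc k = \<theta> * (1 - m) + m"
      by (simp add: m_def algebra_simps)
    ultimately show ?case by linarith
  qed
  then show thesis using that \<theta> s0 by blast
qed

text \<open>
  \<open>hit T S N z q\<close> is the probability that the walk started in \<open>(z, q)\<close> reaches \<open>T \<times> {0}\<close>
  within \<open>N\<close> rounds and before its radius is \<open>S\<close> or larger.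
\<close>

primrec hit :: "'a set \<Rightarrow> real \<Rightarrow> nat \<Rightarrow> 'a \<Rightarrow> nat \<Rightarrow> real" where
  "hit T S 0 = (\<lambda>z q. if radius z q < S \<and> z \<in> T \<and> q = 0 then 1 else 0)"
| "hit T S (Suc N) = (\<lambda>z q. if radius z q < S then if z \<in> T \<and> q = 0 then 1 else walk (hit T S N) z q else 0)"

lemma walk_measurable:
  assumes f: "\<And>q. (\<lambda>z. f z q) \<in> borel_measurable borel"
  shows "(\<lambda>z. walk f z q) \<in> borel_measurable borel"
proof -
  have "(\<lambda>z. LINT u|ball_step. f (z + u) q) \<in> borel_measurable borel"
  proof (rule ball_step.borel_measurable_lebesgue_integral)
    show "(\<lambda>(z, u). f (z + u) q) \<in> borel_measurable (borel \<Otimes>\<^sub>M ball_step)"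
      unfolding split_beta' by (intro measurable_compose[OF _ f]) measurable
  qed
  then show ?thesis
    unfolding walk_def using f by (intro borel_measurable_add borel_measurable_times) auto
qed

lemma walk_mono:
  assumes "\<And>q. (\<lambda>z. f z q) \<in> borel_measurable borel" "\<And>q. (\<lambda>z. g z q) \<in> borel_measurable borel"
    and "\<And>z q. \<bar>f z q\<bar> \<le> B" "\<And>z q. \<bar>g z q\<bar> \<le> B" "\<And>z q. f z q \<le> g z q"
  shows "walk f z q \<le> walk g z q"
  unfolding walk_def using a_pos a_less assms
  by (intro add_mono mult_left_mono integral_ball_step_mono integrable_shift[of _ B]) auto

lemma walk_const: "walk (\<lambda>_ _. k) z q = k"
proof -
  have e: "(LINT u|(ball_step :: 'a measure). k) = k" by (simp add: ball_step.prob_space[simplified])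
  show ?thesis unfolding walk_def e by (simp add: algebra_simps)
qed

lemma hit_measurable_bounds:
  assumes T [measurable]: "T \<in> sets borel"
  shows "(\<lambda>z. hit T S N z q) \<in> borel_measurable borel \<and> (\<forall>z. 0 \<le> hit T S N z q \<and> hit T S N z q \<le> 1)"
proof (induction N arbitrary: q)
  case 0
  have "{z. radius z q < S \<and> z \<in> T \<and> q = 0} \<in> sets borel" by measurable
  then show ?case by (auto intro!: measurable_If)
next
  case (Suc N)
  have meas: "(\<lambda>z. hit T S N z q) \<in> borel_measurable borel" for q using Suc by blast
  have bd: "\<bar>hit T S N z q\<bar> \<le> 1" "0 \<le> hit T S N z q" "hit T S N z q \<le> 1" for z q
    using Suc[of q] by (auto simp: abs_le_iff intro: order_trans[of _ 0])
  have w: "(\<lambda>z. walk (hit T S N) z q) \<in> borel_measurable borel"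
    by (rule walk_measurable[OF meas])
  have sets: "{z. radius z q < S} \<in> sets borel" "{z. z \<in> T \<and> q = 0} \<in> sets borel" by measurable
  have "(\<lambda>z. hit T S (Suc N) z q) \<in> borel_measurable borel"
    unfolding hit.simps by (intro measurable_If w) (use sets in auto)
  moreover have "0 \<le> walk (hit T S N) z q" "walk (hit T S N) z q \<le> 1" for z
    using walk_mono[of "\<lambda>_ _. 0" "hit T S N" 1 z q] walk_mono[of "hit T S N" "\<lambda>_ _. 1" 1 z q] meas bd
    by (simp_all add: walk_const)
  ultimately show ?case by simp
qed

lemma hit_Suc_ge:
  assumes T: "T \<in> sets borel"
  shows "hit T S N z q \<le> hit T S (Suc N) z q"
proof (induction N arbitrary: z q)
  case 0
  have "0 \<le> walk (hit T S 0) z q"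
    using walk_mono[of "\<lambda>_ _. 0" "hit T S 0" 1 z q] hit_measurable_bounds[OF T, of S 0]
    by (simp add: walk_const)
  then show ?case by simp
next
  case (Suc N)
  have bd: "\<bar>hit T S n z q\<bar> \<le> 1" for n z q
    using hit_measurable_bounds[OF T, of S n q] by (auto simp: abs_le_iff intro: order_trans[of _ 0])
  have "walk (hit T S N) z q \<le> walk (hit T S (Suc N)) z q"
    by (rule walk_mono[of _ _ 1]) (use Suc bd hit_measurable_bounds[OF T] in blast)+
  then show ?case unfolding hit.simps(2)[of T S "Suc N"] by (simp add: hit.simps(2)[of T S N])
qed

text \<open>The probabilities increase with the horizon, and dominated convergence carries the
  recursion to the limit. In this way the supersolution is obtained from finite horizons
  alone.\<close>

lemma hit_limit:
  assumes T: "T \<in> sets borel"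
  obtains h where "supersolution T S h" "\<And>z q. (\<lambda>N. hit T S N z q) \<longlonglongrightarrow> h z q"
proof -
  note mb = hit_measurable_bounds[OF T, of S]
  have meas: "(\<lambda>z. hit T S N z q) \<in> borel_measurable borel" for N q using mb by blast
  have nn: "0 \<le> hit T S N z q" "hit T S N z q \<le> 1" for N z q using mb by blast+
  have bd: "\<bar>hit T S N z q\<bar> \<le> 1" for N z q
    using nn[of N z q] by linarith
  define h where "h z q = lim (\<lambda>N. hit T S N z q)" for z q
  have lim: "(\<lambda>N. hit T S N z q) \<longlonglongrightarrow> h z q" for z q
  proof -
    have "incseq (\<lambda>N. hit T S N z q)"
      by (rule incseq_SucI) (rule hit_Suc_ge[OF T])
    then have "convergent (\<lambda>N. hit T S N z q)"
      using nn(2) by (auto simp: convergent_def elim!: incseq_convergent)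
    then show ?thesis by (simp add: h_def convergent_LIMSEQ_iff)
  qed
  have h_meas: "(\<lambda>z. h z q) \<in> borel_measurable borel" for q
    by (rule borel_measurable_LIMSEQ_real[OF lim meas])
  have h_nn: "0 \<le> h z q" "h z q \<le> 1" for z q
    by (rule LIMSEQ_le_const[OF lim], use nn in auto) (rule LIMSEQ_le_const2[OF lim], use nn in auto)
  have wlim: "(\<lambda>N. walk (hit T S N) z q) \<longlonglongrightarrow> walk h z q" for z q
    unfolding walk_def
  proof (intro tendsto_add tendsto_mult tendsto_const lim)
    show "(\<lambda>N. LINT u|ball_step. hit T S N (z + u) q) \<longlonglongrightarrow> (LINT u|ball_step. h (z + u) q)"
    proof (rule integral_dominated_convergence[where w = "\<lambda>_. 1"])
      show "(\<lambda>u. h (z + u) q) \<in> borel_measurable ball_step"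
        by simp (intro measurable_compose[OF _ h_meas], simp)
      show "(\<lambda>u. hit T S N (z + u) q) \<in> borel_measurable ball_step" for N
        by simp (intro measurable_compose[OF _ meas], simp)
    qed (use lim bd in auto)
  qed
  have "supersolution T S h"
    unfolding supersolution_def
  proof (intro conjI allI ballI impI h_meas h_nn)
    have "\<bar>h z q\<bar> \<le> 1" for z q using h_nn[of z q] by linarith
    then show "\<exists>M. \<forall>z q. \<bar>h z q\<bar> \<le> M" by blast
    show "1 \<le> h z 0" if "z \<in> T" "radius z 0 < S" for z
    proof -
      have "hit T S N z 0 = 1" for N using that by (cases N) auto
      then show ?thesis using lim[of z 0] by (simp add: LIMSEQ_const_iff)
    qed
    show "walk h z q \<le> h z q" if "radius z q < S" "\<not> (z \<in> T \<and> q = 0)" for z q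
    proof -
      have "(\<lambda>N. hit T S (Suc N) z q) \<longlonglongrightarrow> h z q"
        using lim by (rule LIMSEQ_Suc)
      then have "(\<lambda>N. walk (hit T S N) z q) \<longlonglongrightarrow> h z q"
        using that by (simp add: hit.simps(2))
      then show ?thesis using wlim[of z q] LIMSEQ_unique by force
    qed
  qed
  then show thesis using lim by (rule that)
qed

text \<open>The order of quantifiers is the point: \<open>s\<^sub>0\<close> and k do not depend on T
  and S, both of which change with the step size.\<close>

lemma hit_likely:
  assumes c: "0 < c" and \<eta>: "0 < \<eta>"
  obtains s\<^sub>0 k where "1 \<le> s\<^sub>0"
    "\<And>T S z q. T \<in> sets borel \<Longrightarrow>
      (\<And>r. 1 \<le> r \<Longrightarrow> c * measure lborel (ball (0::'a) r) \<le> measure lborel (T \<inter> ball 0 r)) \<Longrightarrow>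
      s\<^sub>0 \<le> S / 16 ^ k \<Longrightarrow> radius z q < S / 16 ^ k \<Longrightarrow> \<exists>N. 1 - \<eta> < hit T S N z q"
proof -
  obtain \<theta> s\<^sub>0 where \<theta>: "0 < \<theta>" "\<theta> < 1" "1 \<le> s\<^sub>0" and multi:
    "\<And>T S f k z q. T \<in> sets borel \<Longrightarrow>
      (\<And>r. 1 \<le> r \<Longrightarrow> c * measure lborel (ball (0::'a) r) \<le> measure lborel (T \<inter> ball 0 r)) \<Longrightarrow>
      supersolution T S f \<Longrightarrow> s\<^sub>0 \<le> S / 16 ^ k \<Longrightarrow> radius z q < S / 16 ^ k \<Longrightarrow>
      1 - (1 - \<theta>) ^ k \<le> f z q"
    using multi_scale[OF c] by blast
  obtain k where k: "(1 - \<theta>) ^ k < \<eta>"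
    using real_arch_pow_inv[of \<eta> "1 - \<theta>"] \<eta> \<theta> by auto
  show thesis
  proof (rule that[of s\<^sub>0 k])
    fix T :: "'a set" and S z q
    assume T: "T \<in> sets borel"
      and *: "\<And>r. 1 \<le> r \<Longrightarrow> c * measure lborel (ball (0::'a) r) \<le> measure lborel (T \<inter> ball 0 r)"
        "s\<^sub>0 \<le> S / 16 ^ k" "radius z q < S / 16 ^ k"
    obtain h where h: "supersolution T S h" "\<And>z q. (\<lambda>N. hit T S N z q) \<longlonglongrightarrow> h z q"
      using hit_limit[OF T] by blast
    have "1 - \<eta> < h z q" using multi[OF T *(1) h(1) *(2,3)] k by linarith
    then have "\<forall>\<^sub>F N in sequentially. 1 - \<eta> < hit T S N z q"
      using h(2) by (rule order_tendstoD(1)[rotated])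
    then show "\<exists>N. 1 - \<eta> < hit T S N z q"
      by (auto simp: eventually_sequentially)
  qed (use \<theta> in auto)
qed

end

subsection \<open>Player 1 undoes the moves of Player 2\<close>

text \<open>\<open>move_measure\<close> is given by its values on sets; this turns that formula into
  a mixture of two point masses and a uniform distribution under the integral.\<close>

lemma nn_integral_combination:
  fixes c\<^sub>1 c\<^sub>2 c\<^sub>3 :: ennreal and M M\<^sub>1 M\<^sub>2 M\<^sub>3 :: "'a measure"
  assumes sets: "sets M\<^sub>1 = sets M" "sets M\<^sub>2 = sets M" "sets M\<^sub>3 = sets M"
    and eq: "\<And>E. E \<in> sets M \<Longrightarrow>
      emeasure M E = c\<^sub>1 * emeasure M\<^sub>1 E + c\<^sub>2 * emeasure M\<^sub>2 E + c\<^sub>3 * emeasure M\<^sub>3 E"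
    and f: "f \<in> borel_measurable M"
  shows "(\<integral>\<^sup>+x. f x \<partial>M) = c\<^sub>1 * (\<integral>\<^sup>+x. f x \<partial>M\<^sub>1) + c\<^sub>2 * (\<integral>\<^sup>+x. f x \<partial>M\<^sub>2) + c\<^sub>3 * (\<integral>\<^sup>+x. f x \<partial>M\<^sub>3)"
proof -
  note sp = sets_eq_imp_space_eq[OF sets(1)] sets_eq_imp_space_eq[OF sets(2)] sets_eq_imp_space_eq[OF sets(3)]
  have ms: "g \<in> borel_measurable M\<^sub>1" "g \<in> borel_measurable M\<^sub>2" "g \<in> borel_measurable M\<^sub>3"
    if "g \<in> borel_measurable M" for g :: "'a \<Rightarrow> ennreal"
    using that sets by (simp_all cong: measurable_cong_sets)
  show ?thesis
    using f
  proof (induction rule: borel_measurable_induct)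
    case (cong f g)
    then have "(\<integral>\<^sup>+x. g x \<partial>N) = (\<integral>\<^sup>+x. f x \<partial>N)" if "space N = space M" for N
      using that by (intro nn_integral_cong) simp
    then show ?case using cong sp by simp
  next
    case (set A)
    then show ?case using eq[OF set] sets by simp
  next
    case (mult u c)
    show ?case
      unfolding nn_integral_cmult[OF mult(2)] nn_integral_cmult[OF ms(1)[OF mult(2)]]
        nn_integral_cmult[OF ms(2)[OF mult(2)]] nn_integral_cmult[OF ms(3)[OF mult(2)]] mult(4)
      by (simp only: distrib_left mult.left_commute)
  next
    case (add u v)
    have uv: "v \<in> borel_measurable M" "u \<in> borel_measurable M" by fact+
    note IH = add.IH
    show ?case
      unfolding nn_integral_add[OF uv] nn_integral_add[OF uv[THEN ms(1)]]
        nn_integral_add[OF uv[THEN ms(2)]] nn_integral_add[OF uv[THEN ms(3)]] IH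
      by (simp only: distrib_left add_ac)
  next
    case (seq U)
    have sup: "(\<integral>\<^sup>+x. (SUP i. U i) x \<partial>N) = (SUP i. \<integral>\<^sup>+x. U i x \<partial>N)" if "sets N = sets M" for N
      unfolding SUP_apply using seq that
      by (intro nn_integral_monotone_convergence_SUP) (auto simp: measurable_cong_sets[OF that refl])
    have inc: "incseq (\<lambda>i. c * (\<integral>\<^sup>+x. U i x \<partial>N))" for c N
      using seq by (intro incseq_SucI mult_left_mono nn_integral_mono) (auto simp: incseq_Suc_iff le_fun_def)
    have "(SUP i. c\<^sub>1 * (\<integral>\<^sup>+x. U i x \<partial>M\<^sub>1) + c\<^sub>2 * (\<integral>\<^sup>+x. U i x \<partial>M\<^sub>2) + c\<^sub>3 * (\<integral>\<^sup>+x. U i x \<partial>M\<^sub>3)) =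
      (SUP i. c\<^sub>1 * (\<integral>\<^sup>+x. U i x \<partial>M\<^sub>1)) + (SUP i. c\<^sub>2 * (\<integral>\<^sup>+x. U i x \<partial>M\<^sub>2)) + (SUP i. c\<^sub>3 * (\<integral>\<^sup>+x. U i x \<partial>M\<^sub>3))"
    proof -
      have "incseq (\<lambda>i. c\<^sub>1 * (\<integral>\<^sup>+x. U i x \<partial>M\<^sub>1) + c\<^sub>2 * (\<integral>\<^sup>+x. U i x \<partial>M\<^sub>2))"
        by (intro incseq_SucI add_mono incseq_SucD[OF inc])
      then show ?thesis
        by (simp only: ennreal_SUP_add inc)
    qed
    then show ?case
      unfolding sup[OF refl] sup[OF sets(1)] sup[OF sets(2)] sup[OF sets(3)] seq.IH SUP_mult_left_ennreal .
  qed
qed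

lemma emeasure_lborel_affine:
  fixes x :: "'a::euclidean_space"
  assumes \<epsilon>: "0 < \<epsilon>" and [measurable]: "A \<in> sets borel"
  shows "emeasure lborel A = ennreal (\<epsilon> ^ DIM('a)) * emeasure lborel ((\<lambda>u. x + \<epsilon> *\<^sub>R u) -` A)"
proof -
  have "emeasure lborel A = emeasure (density (distr lborel borel (\<lambda>u. x + \<epsilon> *\<^sub>R u)) (\<lambda>_. ennreal (\<bar>\<epsilon>\<bar> ^ DIM('a)))) A"
    using lborel_affine[of \<epsilon> x] \<epsilon> by simp
  also have "\<dots> = ennreal (\<epsilon> ^ DIM('a)) * emeasure (distr lborel borel (\<lambda>u. x + \<epsilon> *\<^sub>R u)) A"
    using \<epsilon> by (simp add: emeasure_density nn_integral_cmult_indicator)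
  also have "emeasure (distr lborel borel (\<lambda>u. x + \<epsilon> *\<^sub>R u)) A = emeasure lborel ((\<lambda>u. x + \<epsilon> *\<^sub>R u) -` A)"
    by (subst emeasure_distr) auto
  finally show ?thesis .
qed

lemma emeasure_ball_step_affine:
  fixes x :: "'a::euclidean_space"
  assumes \<epsilon>: "0 < \<epsilon>" and A [measurable]: "A \<in> sets borel"
  shows "emeasure lborel (A \<inter> ball x \<epsilon>) / emeasure lborel (ball x \<epsilon>) =
    emeasure ball_step ((\<lambda>u. x + \<epsilon> *\<^sub>R u) -` A)"
proof -
  have pre: "(\<lambda>u. x + \<epsilon> *\<^sub>R u) -` ball x \<epsilon> = ball 0 1"
    using \<epsilon> by (auto simp: dist_norm)
  have [measurable]: "(\<lambda>u. x + \<epsilon> *\<^sub>R u) -` A \<in> sets borel"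
    using measurable_sets[of "\<lambda>u. x + \<epsilon> *\<^sub>R u" borel borel A] by simp
  have e: "ennreal (\<epsilon> ^ DIM('a)) \<noteq> 0" "ennreal (\<epsilon> ^ DIM('a)) \<noteq> \<top>" using \<epsilon> by simp_all
  have "emeasure lborel (A \<inter> ball x \<epsilon>) / emeasure lborel (ball x \<epsilon>) =
    (ennreal (\<epsilon> ^ DIM('a)) * emeasure lborel ((\<lambda>u. x + \<epsilon> *\<^sub>R u) -` A \<inter> ball 0 1))
      / (ennreal (\<epsilon> ^ DIM('a)) * emeasure lborel (ball (0::'a) 1))"
    using emeasure_lborel_affine[OF \<epsilon>, of "A \<inter> ball x \<epsilon>" x] emeasure_lborel_affine[OF \<epsilon>, of "ball x \<epsilon>" x]
    by (simp add: pre)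
  also have "\<dots> = emeasure lborel (ball 0 1 \<inter> (\<lambda>u. x + \<epsilon> *\<^sub>R u) -` A) / emeasure lborel (ball (0::'a) 1)"
    using e by (simp add: divide_mult_eq Int_commute mult.commute[of "ennreal _"])
  finally show ?thesis
    by (simp add: ball_step_def)
qed

text \<open>A step u outside the unit ball, which has probability 0, is replaced by 0. The new
  position then lies in the enlarged domain for every u, as measurability into
  \<open>round_space\<close> demands.\<close>

lemma nn_integral_move_measure:
  fixes \<Omega> :: "(real ^ 'n) set" and f :: "nat \<times> (real ^ 'n) \<Rightarrow> ennreal"
  assumes op: "open \<Omega>" and \<epsilon>: "0 < \<epsilon>" and x: "x \<in> \<Omega>" "s1 \<in> ball x \<epsilon>" "s2 \<in> ball x \<epsilon>"
    and f: "f \<in> borel_measurable (round_space \<Omega> \<epsilon>)"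
  shows "(\<integral>\<^sup>+v. f v \<partial>move_measure p \<Omega> \<epsilon> s1 s2 x) =
    ennreal (game_alpha TYPE('n) p / 2) * f (0, s1) + ennreal (game_alpha TYPE('n) p / 2) * f (1, s2)
    + ennreal (game_beta TYPE('n) p) * (\<integral>\<^sup>+u. f (2, x + \<epsilon> *\<^sub>R (if norm u < 1 then u else 0)) \<partial>ball_step)"
proof -
  let ?R = "round_space \<Omega> \<epsilon>"
  define \<phi> where "\<phi> u = (2::nat, x + \<epsilon> *\<^sub>R (if norm u < 1 then u else 0))" for u :: "real ^ 'n"
  have sub: "ball x \<epsilon> \<subseteq> enlarged_domain \<Omega> \<epsilon>"
    using op x by (intro ball_subset_enlarged_domain)
  have in_ball: "x + \<epsilon> *\<^sub>R (if norm u < 1 then u else 0) \<in> ball x \<epsilon>" for u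
    using \<epsilon> by (simp add: dist_norm)
  have [measurable]: "enlarged_domain \<Omega> \<epsilon> \<in> sets borel"
    by (rule enlarged_domain_borel[OF op])
  have "(\<lambda>u. x + \<epsilon> *\<^sub>R (if norm u < 1 then u else 0)) \<in> borel_measurable (borel :: (real ^ 'n) measure)"
    by measurable
  then have m2: "(\<lambda>u. x + \<epsilon> *\<^sub>R (if norm u < 1 then u else 0)) \<in> measurable borel (restrict_space borel (enlarged_domain \<Omega> \<epsilon>))"
    using in_ball sub by (intro measurable_restrict_space2) auto
  have \<phi>: "\<phi> \<in> measurable ball_step ?R"
    unfolding \<phi>_def[abs_def] round_space_def measurable_cong_sets[OF sets_ball_step refl]
    by (intro measurable_Pair m2) simp
  have sp: "(0, s1) \<in> space ?R" "(1, s2) \<in> space ?R"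
    using x sub by (auto simp: space_round_space)
  have "(\<integral>\<^sup>+v. f v \<partial>move_measure p \<Omega> \<epsilon> s1 s2 x) =
      ennreal (game_alpha TYPE('n) p / 2) * (\<integral>\<^sup>+v. f v \<partial>return ?R (0, s1))
      + ennreal (game_alpha TYPE('n) p / 2) * (\<integral>\<^sup>+v. f v \<partial>return ?R (1, s2))
      + ennreal (game_beta TYPE('n) p) * (\<integral>\<^sup>+v. f v \<partial>distr ball_step ?R \<phi>)"
  proof (rule nn_integral_combination)
    fix E assume "E \<in> sets (move_measure p \<Omega> \<epsilon> s1 s2 x)"
    then have E: "E \<in> sets ?R" by (simp add: sets_move_measure)
    have slice: "{z. (2, z) \<in> E} \<in> sets borel"
      by (rule section_borel[OF op E]) simp
    have "emeasure (distr ball_step ?R \<phi>) E = emeasure ball_step (\<phi> -` E)"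
      using \<phi> E by (simp add: emeasure_distr)
    also have "\<dots> = emeasure ball_step ((\<lambda>u. x + \<epsilon> *\<^sub>R u) -` {z. (2, z) \<in> E})"
    proof (rule emeasure_eq_AE)
      show "AE u in ball_step. u \<in> \<phi> -` E \<longleftrightarrow> u \<in> (\<lambda>u. x + \<epsilon> *\<^sub>R u) -` {z. (2, z) \<in> E}"
        using AE_ball_step by eventually_elim (simp add: \<phi>_def)
      show "\<phi> -` E \<in> sets ball_step"
        using measurable_sets[OF \<phi> E] by simp
      show "(\<lambda>u. x + \<epsilon> *\<^sub>R u) -` {z. (2, z) \<in> E} \<in> sets ball_step"
        using measurable_sets[of "\<lambda>u. x + \<epsilon> *\<^sub>R u" borel borel, OF _ slice] by simp
    qed
    also have "\<dots> = emeasure lborel ({z. (2, z) \<in> E} \<inter> ball x \<epsilon>) / emeasure lborel (ball x \<epsilon>)"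
      by (rule emeasure_ball_step_affine[OF \<epsilon> slice, symmetric])
    finally show "emeasure (move_measure p \<Omega> \<epsilon> s1 s2 x) E =
      ennreal (game_alpha TYPE('n) p / 2) * emeasure (return ?R (0, s1)) E
      + ennreal (game_alpha TYPE('n) p / 2) * emeasure (return ?R (1, s2)) E
      + ennreal (game_beta TYPE('n) p) * emeasure (distr ball_step ?R \<phi>) E"
      using E by (simp add: emeasure_move_measure[OF op E])
  qed (use f in \<open>auto simp: sets_move_measure measurable_cong_sets[OF sets_move_measure refl]\<close>)
  then show ?thesis
    using f \<phi> sp by (simp add: nn_integral_return nn_integral_distr, simp add: \<phi>_def)
qed

section \<open>The undoing strategy and its bookkeeping\<close>

primrec debt :: "(nat \<Rightarrow> nat \<times> (real ^ 'n)) \<Rightarrow> nat \<Rightarrow> nat" where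
  "debt h 0 = 0"
| "debt h (Suc k) = (if fst (h k) = 0 then debt h k - 1 else if fst (h k) = 1 then Suc (debt h k) else debt h k)"

text \<open>With \<open>debt\<close> this is the walk in unscaled coordinates. Both are functions of
  the history, so a strategy may use them.\<close>

primrec noise :: "real ^ 'n \<Rightarrow> (nat \<Rightarrow> nat \<times> (real ^ 'n)) \<Rightarrow> nat \<Rightarrow> real ^ 'n" where
  "noise x0 h 0 = x0"
| "noise x0 h (Suc k) = (if fst (h k) = 2 then noise x0 h k + (snd (h k) - position x0 h k) else noise x0 h k)"

text \<open>
  Player 1 moves the fraction \<open>1 / debt\<close> of the way towards the point that the random moves alone
  would have reached. For \<open>debt = 0\<close> the division by zero gives the move to the current position.
\<close>

definition undo :: "real \<Rightarrow> real ^ 'n \<Rightarrow> nat \<Rightarrow> (nat \<Rightarrow> nat \<times> (real ^ 'n)) \<Rightarrow> real ^ 'n" where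
  "undo \<epsilon> x0 k h =
    (let w = (1 / real (debt h k)) *\<^sub>R (position x0 h k - noise x0 h k)
     in if norm w < \<epsilon> then position x0 h k - w else position x0 h k)"

lemma position_cong: "(\<And>i. i < k \<Longrightarrow> h i = h' i) \<Longrightarrow> position x0 h k = position x0 h' k"
  by (cases k) auto

lemma debt_cong: "(\<And>i. i < k \<Longrightarrow> h i = h' i) \<Longrightarrow> debt h k = debt h' k"
  by (induction k) auto

lemma noise_cong: "(\<And>i. i < k \<Longrightarrow> h i = h' i) \<Longrightarrow> noise x0 h k = noise x0 h' k"
proof (induction k)
  case (Suc k)
  then have "position x0 h k = position x0 h' k" by (intro position_cong) simp
  then show ?case using Suc by simp
qed simp

lemma round_measurable:
  fixes \<Omega> :: "(real ^ 'n) set"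
  assumes "j \<in> J"
  shows "(\<lambda>h. snd (h j)) \<in> borel_measurable (PiM J (\<lambda>_. round_space \<Omega> \<epsilon>))"
    and "Measurable.pred (PiM J (\<lambda>_. round_space \<Omega> \<epsilon>)) (\<lambda>h. fst (h j) = i)"
proof -
  let ?H = "PiM J (\<lambda>_. round_space \<Omega> \<epsilon>)"
  have c: "(\<lambda>h. h j) \<in> measurable ?H (round_space \<Omega> \<epsilon>)"
    using assms by (rule measurable_component_singleton)
  have s: "snd \<in> measurable (round_space \<Omega> \<epsilon>) (restrict_space borel (enlarged_domain \<Omega> \<epsilon>))"
    and f: "fst \<in> measurable (round_space \<Omega> \<epsilon>) (count_space {0, 1, 2})"
    unfolding round_space_def by (rule measurable_snd measurable_fst)+
  have "(\<lambda>x. x) \<in> measurable (restrict_space borel (enlarged_domain \<Omega> \<epsilon>)) (borel :: (real ^ 'n) measure)"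
    by (rule measurable_restrict_space1) simp
  from measurable_compose[OF measurable_compose[OF c s] this]
  show "(\<lambda>h. snd (h j)) \<in> borel_measurable ?H" by simp
  have "(\<lambda>x. x = i) \<in> measurable (count_space {0, 1, 2}) (count_space UNIV)"
    by simp
  from measurable_compose[OF measurable_compose[OF c f] this]
  show "Measurable.pred ?H (\<lambda>h. fst (h j) = i)" by simp
qed

lemma track_measurable:
  fixes \<Omega> :: "(real ^ 'n) set"
  assumes "{0..<k} \<subseteq> J"
  shows "(\<lambda>h. position x0 h k) \<in> borel_measurable (PiM J (\<lambda>_. round_space \<Omega> \<epsilon>))"
    and "(\<lambda>h. noise x0 h k) \<in> borel_measurable (PiM J (\<lambda>_. round_space \<Omega> \<epsilon>))"
    and "(\<lambda>h. debt h k) \<in> measurable (PiM J (\<lambda>_. round_space \<Omega> \<epsilon>)) (count_space UNIV)"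
proof -
  let ?H = "PiM J (\<lambda>_. round_space \<Omega> \<epsilon>)"
  have pos: "(\<lambda>h. position x0 h j) \<in> borel_measurable ?H" if "{0..<j} \<subseteq> J" for j
    using that by (cases j) (auto intro!: round_measurable)
  then show "(\<lambda>h. position x0 h k) \<in> borel_measurable ?H" using assms .
  show "(\<lambda>h. noise x0 h k) \<in> borel_measurable ?H"
    using assms
  proof (induction k)
    case (Suc k)
    then have k: "k \<in> J" "{0..<k} \<subseteq> J" by auto
    have [measurable]: "(\<lambda>h. noise x0 h k) \<in> borel_measurable ?H" by (rule Suc.IH[OF k(2)])
    note [measurable] = pos[OF k(2)] round_measurable[OF k(1), where \<Omega> = \<Omega> and \<epsilon> = \<epsilon>]
    show ?case by simp
  qed simp
  show "(\<lambda>h. debt h k) \<in> measurable ?H (count_space UNIV)"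
    using assms
  proof (induction k)
    case (Suc k)
    then have k: "k \<in> J" "{0..<k} \<subseteq> J" by auto
    have [measurable]: "(\<lambda>h. debt h k) \<in> measurable ?H (count_space UNIV)" by (rule Suc.IH[OF k(2)])
    note [measurable] = round_measurable[OF k(1), where \<Omega> = \<Omega> and \<epsilon> = \<epsilon>]
    show ?case by simp
  qed simp
qed

text \<open>Legality is demanded on every history, also on those where the displacement is too large
  to be undone in time. The test in \<open>undo\<close> then falls back to standing still; along
  histories that are on track it always succeeds, by \<open>norm_undo_step\<close>.\<close>

lemma strategy_undo:
  fixes \<Omega> :: "(real ^ 'n) set"
  assumes "0 < \<epsilon>"
  shows "strategy \<Omega> \<epsilon> x0 (undo \<epsilon> x0)"
  unfolding strategy_def
proof (intro allI conjI ballI impI)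
  fix k
  note [measurable] = track_measurable[where k = k and J = "{0..<k}" and \<Omega> = \<Omega> and \<epsilon> = \<epsilon>, OF order_refl]
  have [measurable]: "(\<lambda>h. 1 / real (debt h k)) \<in> borel_measurable (PiM {0..<k} (\<lambda>_. round_space \<Omega> \<epsilon>))"
    by (rule measurable_compose[OF track_measurable(3)]) auto
  show "undo \<epsilon> x0 k \<in> borel_measurable (history_space \<Omega> \<epsilon> k)"
    unfolding undo_def[abs_def] history_space_def Let_def by measurable
  show "undo \<epsilon> x0 k h \<in> ball (position x0 h k) \<epsilon>" for h
    using assms by (auto simp: undo_def Let_def dist_norm)
qed

text \<open>The winning event truncated to k rounds. It is determined by a finite history, hence
  accessible through the finite-dimensional distributions.\<close>

definition wins :: "(real ^ 'n) set \<Rightarrow> real ^ 'n \<Rightarrow> real \<Rightarrow> real ^ 'n \<Rightarrow> nat \<Rightarrow> (nat \<Rightarrow> nat \<times> (real ^ 'n)) \<Rightarrow> bool" where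
  "wins \<Omega> y \<delta> x0 k h \<longleftrightarrow>
    (\<exists>j\<le>k. position x0 h j \<notin> \<Omega> \<and> position x0 h j \<in> ball y \<delta> \<and> (\<forall>i<j. position x0 h i \<in> \<Omega>))"

lemma wins_cong:
  assumes "\<And>i. i < k \<Longrightarrow> h i = h' i"
  shows "wins \<Omega> y \<delta> x0 k h \<longleftrightarrow> wins \<Omega> y \<delta> x0 k h'"
proof -
  have "position x0 h j = position x0 h' j" if "j \<le> k" for j
    using that assms by (intro position_cong) simp
  then show ?thesis by (auto simp: wins_def)
qed

lemma wins_measurable:
  fixes \<Omega> :: "(real ^ 'n) set"
  assumes "open \<Omega>" "{0..<k} \<subseteq> J"
  shows "Measurable.pred (PiM J (\<lambda>_. round_space \<Omega> \<epsilon>)) (\<lambda>h. wins \<Omega> y \<delta> x0 k h)"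
proof -
  have [measurable]: "\<Omega> \<in> sets borel" using assms(1) by auto
  have pos: "(\<lambda>h. position x0 h j) \<in> borel_measurable (PiM J (\<lambda>_. round_space \<Omega> \<epsilon>))" if "j \<le> k" for j
    using that assms(2) by (intro track_measurable) auto
  have in\<Omega>: "Measurable.pred (PiM J (\<lambda>_. round_space \<Omega> \<epsilon>)) (\<lambda>h. position x0 h j \<in> B)"
    if "j \<le> k" "B \<in> sets borel" for j and B :: "(real ^ 'n) set"
    using measurable_sets_Collect[OF pos[OF that(1)], of "\<lambda>x. x \<in> B"] that(2) by (simp add: pred_def)
  have "Measurable.pred (PiM J (\<lambda>_. round_space \<Omega> \<epsilon>)) (\<lambda>h. \<exists>j\<in>{..k}. \<not> position x0 h j \<in> \<Omega> \<and>
      position x0 h j \<in> ball y \<delta> \<and> (\<forall>i\<in>{..<j}. position x0 h i \<in> \<Omega>))"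
    by (intro pred_intros_finite pred_intros_logic in\<Omega>) auto
  moreover have "wins \<Omega> y \<delta> x0 k h \<longleftrightarrow> (\<exists>j\<in>{..k}. \<not> position x0 h j \<in> \<Omega> \<and>
      position x0 h j \<in> ball y \<delta> \<and> (\<forall>i\<in>{..<j}. position x0 h i \<in> \<Omega>))" for h
    unfolding wins_def Bex_def Ball_def atMost_iff lessThan_iff by blast
  ultimately show ?thesis by (simp only:)
qed

section \<open>The value of the walk along the actual game\<close>

locale cancelling_game =
  fixes p \<epsilon> :: real and \<Omega> :: "(real ^ 'n) set" and x0 y :: "real ^ 'n"
  assumes op: "open \<Omega>" and p: "2 < p" and \<epsilon>: "0 < \<epsilon>" and x0: "x0 \<in> \<Omega>"

lemma cancelled_walk_game_alpha:
  assumes "2 < p"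
  shows "cancelled_walk (game_alpha TYPE('n) p / 2)"
    and "1 - 2 * (game_alpha TYPE('n::finite) p / 2) = game_beta TYPE('n) p"
proof -
  have "0 < p + real CARD('n)" using assms by simp
  then show "cancelled_walk (game_alpha TYPE('n) p / 2)" "1 - 2 * (game_alpha TYPE('n) p / 2) = game_beta TYPE('n) p"
    using assms by (auto simp: game_alpha_def game_beta_def cancelled_walk_def field_simps)
qed

sublocale cancelling_game \<subseteq> cancelled_walk "game_alpha TYPE('n) p / 2" "TYPE(real ^ 'n)"
  by (rule cancelled_walk_game_alpha(1)[OF p])

context cancelling_game
begin

definition target :: "(real ^ 'n) set" where
  "target = {z. y + \<epsilon> *\<^sub>R z \<notin> \<Omega>}"

text \<open>The inequality is strict because moves go to open balls: it makes the step of
  \<open>undo\<close> shorter than \<epsilon>. A strict bound is impossible for debt 0, hence the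
  second alternative.\<close>

definition on_track :: "nat \<Rightarrow> (nat \<Rightarrow> nat \<times> (real ^ 'n)) \<Rightarrow> bool" where
  "on_track k h \<longleftrightarrow> (\<forall>j\<le>k. position x0 h j \<in> \<Omega>) \<and>
    (norm (position x0 h k - noise x0 h k) < real (debt h k) * \<epsilon> \<or> debt h k = 0 \<and> position x0 h k = noise x0 h k)"

text \<open>A lower bound for the chance of winning by round N, given the history up to round k. It
  is designed to be a submartingale against every Player 2.\<close>

definition val :: "real \<Rightarrow> real \<Rightarrow> nat \<Rightarrow> nat \<Rightarrow> (nat \<Rightarrow> nat \<times> (real ^ 'n)) \<Rightarrow> real" where
  "val S \<delta> N k h = (if wins \<Omega> y \<delta> x0 k h then 1
    else if on_track k h then hit target S (N - k) ((1 / \<epsilon>) *\<^sub>R (noise x0 h k - y)) (debt h k) else 0)"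

lemma target_borel [measurable]: "target \<in> sets borel"
proof -
  have "- \<Omega> \<in> sets borel" using op by auto
  then have "(\<lambda>z. y + \<epsilon> *\<^sub>R z) -` (- \<Omega>) \<inter> space borel \<in> sets borel"
    by (rule measurable_sets[rotated]) simp
  then show ?thesis by (simp add: target_def vimage_def)
qed

lemma hit_bounds: "0 \<le> hit target S N z q" "hit target S N z q \<le> 1"
  using hit_measurable_bounds[OF target_borel] by blast+

lemma hit_meas: "(\<lambda>z. hit target S N z q) \<in> borel_measurable borel"
  using hit_measurable_bounds[OF target_borel] by blast

lemma val_bounds: "0 \<le> val S \<delta> N k h" "val S \<delta> N k h \<le> 1"
  using hit_bounds by (auto simp: val_def)

lemma val_measurable: "(\<lambda>h. val S \<delta> N k h) \<in> borel_measurable (history_space \<Omega> \<epsilon> k)"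
proof -
  let ?H = "history_space \<Omega> \<epsilon> k"
  have [measurable]: "\<Omega> \<in> sets borel" using op by auto
  have w: "Measurable.pred ?H (wins \<Omega> y \<delta> x0 k)"
    unfolding history_space_def by (rule wins_measurable[OF op order_refl])
  have pos: "(\<lambda>h. position x0 h j) \<in> borel_measurable ?H" if "j \<le> k" for j
    unfolding history_space_def using that by (intro track_measurable) auto
  have [measurable]: "(\<lambda>h. position x0 h k) \<in> borel_measurable ?H" "(\<lambda>h. noise x0 h k) \<in> borel_measurable ?H"
    and d [measurable]: "(\<lambda>h. debt h k) \<in> measurable ?H (count_space UNIV)"
    unfolding history_space_def by (rule track_measurable[OF order_refl])+
  have in\<Omega>: "Measurable.pred ?H (\<lambda>h. position x0 h j \<in> \<Omega>)" if "j \<in> {..k}" for j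
    using measurable_sets_Collect[OF pos, of j "\<lambda>x. x \<in> \<Omega>"] that op by (simp add: pred_def)
  have [measurable]: "(\<lambda>h. real (debt h k)) \<in> borel_measurable ?H"
    by (rule measurable_compose[OF d]) auto
  have "Measurable.pred ?H (\<lambda>h. \<forall>j\<in>{..k}. position x0 h j \<in> \<Omega>)"
    by (intro pred_intros_finite in\<Omega>) auto
  moreover have "Measurable.pred ?H (\<lambda>h. norm (position x0 h k - noise x0 h k) < real (debt h k) * \<epsilon>
      \<or> debt h k = 0 \<and> norm (position x0 h k - noise x0 h k) \<le> 0)"
    by measurable
  ultimately have "{h \<in> space ?H. (\<forall>j\<in>{..k}. position x0 h j \<in> \<Omega>) \<and>
      (norm (position x0 h k - noise x0 h k) < real (debt h k) * \<epsilon>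
      \<or> debt h k = 0 \<and> norm (position x0 h k - noise x0 h k) \<le> 0)} \<in> sets ?H"
    unfolding pred_def by (rule sets.sets_Collect_conj[rotated])
  moreover have "on_track k h \<longleftrightarrow> (\<forall>j\<in>{..k}. position x0 h j \<in> \<Omega>) \<and>
      (norm (position x0 h k - noise x0 h k) < real (debt h k) * \<epsilon>
      \<or> debt h k = 0 \<and> norm (position x0 h k - noise x0 h k) \<le> 0)" for h
    unfolding on_track_def norm_le_zero_iff right_minus_eq by blast
  ultimately have t: "{h \<in> space ?H. on_track k h} \<in> sets ?H"
    by (simp only:)
  have "(\<lambda>h. hit target S (N - k) ((1 / \<epsilon>) *\<^sub>R (noise x0 h k - y)) (debt h k)) \<in> borel_measurable ?H"
    by (rule measurable_compose_countable[OF _ d])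
      (intro measurable_compose[OF _ hit_meas] borel_measurable_scaleR borel_measurable_diff
        borel_measurable_const track_measurable(2)[OF order_refl, folded history_space_def])
  then show ?thesis
    unfolding val_def by (intro measurable_If borel_measurable_const w[unfolded pred_def] t)
qed

lemma position_upd [simp]: "j \<le> k \<Longrightarrow> position x0 (h(k := v)) j = position x0 h j"
  by (rule position_cong) simp

lemma noise_upd [simp]: "j \<le> k \<Longrightarrow> noise x0 (h(k := v)) j = noise x0 h j"
  by (rule noise_cong) simp

lemma debt_upd [simp]: "j \<le> k \<Longrightarrow> debt (h(k := v)) j = debt h j"
  by (rule debt_cong) simp

lemma norm_undo_step:
  assumes "on_track k h"
  defines "w \<equiv> (1 / real (debt h k)) *\<^sub>R (position x0 h k - noise x0 h k)"
  shows "norm w < \<epsilon>" "undo \<epsilon> x0 k h = position x0 h k - w"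
proof -
  show *: "norm w < \<epsilon>"
  proof (cases "debt h k = 0")
    case True
    then show ?thesis using \<epsilon> by (simp add: w_def)
  next
    case False
    then have "norm (position x0 h k - noise x0 h k) < real (debt h k) * \<epsilon>"
      using assms(1) by (simp add: on_track_def)
    then have "norm (position x0 h k - noise x0 h k) / real (debt h k) < \<epsilon>"
      using False by (simp add: pos_divide_less_eq mult.commute)
    then show ?thesis by (simp add: w_def)
  qed
  then show "undo \<epsilon> x0 k h = position x0 h k - w"
    by (simp add: undo_def Let_def w_def)
qed

text \<open>
  As long as the walk stays within radius \<open>S\<close>, the position is close to \<open>y\<close>; so a move that
  leaves \<open>\<Omega>\<close> wins, and any other move preserves the bound on the distance to the noise.
\<close>

lemma val_step_ge:
  assumes tr: "on_track k h" and N: "k < N"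
    and rad: "radius ((1 / \<epsilon>) *\<^sub>R (noise x0 h k - y)) (debt h k) < S"
    and room: "\<epsilon> * (S + S / sqrt weight + 1) \<le> \<delta>"
    and i: "i \<in> {0, 1, 2}" and x': "x' \<in> ball (position x0 h k) \<epsilon>"
    and undo: "i = 0 \<Longrightarrow> x' = undo \<epsilon> x0 k h"
  shows "hit target S (N - Suc k) ((1 / \<epsilon>) *\<^sub>R (noise x0 (h(k := (i, x'))) (Suc k) - y)) (debt (h(k := (i, x'))) (Suc k))
    \<le> val S \<delta> N (Suc k) (h(k := (i, x')))"
proof -
  define x z q where "x = position x0 h k" and "z = noise x0 h k" and "q = debt h k"
  let ?h = "h(k := (i, x'))"
  have b: "0 < sqrt weight" using weight_pos by simp
  have run: "\<forall>j\<le>k. position x0 h j \<in> \<Omega>" using tr by (simp add: on_track_def)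
  have inv: "norm (x - z) < real q * \<epsilon> \<or> q = 0 \<and> x = z"
    using tr by (simp add: on_track_def x_def z_def q_def)
  have xx': "norm (x' - x) < \<epsilon>" using x' by (simp add: x_def dist_norm norm_minus_commute)
  show ?thesis
  proof (cases "x' \<in> \<Omega>")
    case False
    \<comment> \<open>\<open>room\<close> collects three distances: z is within \<epsilon> * S of y,
      the old position is within \<epsilon> * q of z with q < S / sqrt weight, and the last move is
      shorter than \<epsilon>.\<close>
    have "norm ((1 / \<epsilon>) *\<^sub>R (z - y)) < S"
      using rad norm_le_radius[of "(1 / \<epsilon>) *\<^sub>R (z - y)" q] by (simp add: z_def q_def)
    then have "norm (z - y) / \<epsilon> < S" using \<epsilon> by simp
    then have zy: "norm (z - y) < \<epsilon> * S"
      using \<epsilon> by (simp add: pos_divide_less_eq mult.commute)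
    have "sqrt weight * real q < S"
      using rad weight_le_radius[of q "(1 / \<epsilon>) *\<^sub>R (z - y)"] by (simp add: z_def q_def)
    then have "real q < S / sqrt weight"
      using b by (simp add: pos_less_divide_eq mult.commute)
    then have "\<epsilon> * real q < \<epsilon> * (S / sqrt weight)"
      using \<epsilon> by (rule mult_strict_left_mono)
    moreover have "norm (x - z) \<le> \<epsilon> * real q"
      using inv by (auto simp: mult.commute)
    moreover have "norm (x' - y) \<le> norm (x' - x) + norm (x - z) + norm (z - y)"
      using norm_triangle_ineq[of "x' - x" "x - y"] norm_triangle_ineq[of "x - z" "z - y"] by simp
    ultimately have "norm (x' - y) < \<epsilon> + \<epsilon> * (S / sqrt weight) + \<epsilon> * S"
      using xx' zy by linarith
    also have "\<dots> = \<epsilon> * (S + S / sqrt weight + 1)"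
      by (simp add: algebra_simps)
    also have "\<dots> \<le> \<delta>" by (rule room)
    finally have "x' \<in> ball y \<delta>" by (simp add: dist_norm norm_minus_commute)
    then have "wins \<Omega> y \<delta> x0 (Suc k) ?h"
      unfolding wins_def using False run by (intro exI[of _ "Suc k"]) auto
    then show ?thesis using hit_bounds by (simp add: val_def)
  next
    case True
    have "on_track (Suc k) ?h"
      unfolding on_track_def
    proof (intro conjI allI impI)
      show "position x0 ?h j \<in> \<Omega>" if "j \<le> Suc k" for j
        using that run True by (cases "j = Suc k") auto
      consider "i = 0" | "i = 1" | "i = 2" using i by auto
      then show "norm (position x0 ?h (Suc k) - noise x0 ?h (Suc k)) < real (debt ?h (Suc k)) * \<epsilon> \<or>
        debt ?h (Suc k) = 0 \<and> position x0 ?h (Suc k) = noise x0 ?h (Suc k)"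
      proof cases
        case 1
        have x'w: "x' = x - (1 / real q) *\<^sub>R (x - z)"
          using undo[OF 1] norm_undo_step(2)[OF tr] by (simp add: x_def z_def q_def)
        have "norm (x' - z) < real (q - 1) * \<epsilon> \<or> q - 1 = 0 \<and> x' = z"
        \<comment> \<open>For q = 0 the position already equals z and does not move; for q = 1 the
          move goes to z itself. For larger q the displacement is multiplied by 1 - 1/q.\<close>
        proof (cases "q \<le> 1")
          case True
          then show ?thesis using x'w inv by (cases q) auto
        next
          case False
          have e: "x' - z = (1 - 1 / real q) *\<^sub>R (x - z)"
            by (simp add: x'w algebra_simps)
          have "0 \<le> 1 - 1 / real q" using False by simp
          then have "norm (x' - z) = (1 - 1 / real q) * norm (x - z)"
            unfolding e norm_scaleR by (simp only: abs_of_nonneg)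
          also have "\<dots> < (1 - 1 / real q) * (real q * \<epsilon>)"
            using inv False by (intro mult_strict_left_mono) auto
          also have "\<dots> = real (q - 1) * \<epsilon>"
            using False by (simp add: field_simps of_nat_diff)
          finally show ?thesis by simp
        qed
        then show ?thesis using 1 by (simp add: z_def q_def)
      next
        case 2
        have "norm (x' - z) \<le> norm (x' - x) + norm (x - z)"
          using norm_triangle_ineq[of "x' - x" "x - z"] by simp
        then have "norm (x' - z) < real (Suc q) * \<epsilon>"
          using xx' inv by (auto simp: algebra_simps)
        then show ?thesis using 2 by (simp add: z_def q_def)
      next
        case 3
        then show ?thesis using inv by (simp add: x_def z_def q_def algebra_simps)
      qed
    qed
    then show ?thesis using hit_bounds by (simp add: val_def del: debt.simps noise.simps)
  qed
qed

text \<open>The destination chosen by Player 2 does not enter the bound: a round won by Player 2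
  always leads to the walk value with count q + 1. Averaging the three kinds of rounds gives the
  recursion of \<open>hit\<close>.\<close>

lemma val_submartingale_step:
  assumes S2: "strategy \<Omega> \<epsilon> x0 S2" and N: "k < N"
    and room: "\<epsilon> * (S + S / sqrt weight + 1) \<le> \<delta>"
    and h: "h \<in> space (history_space \<Omega> \<epsilon> k)"
  shows "ennreal (val S \<delta> N k h) \<le>
    (\<integral>\<^sup>+v. ennreal (val S \<delta> N (Suc k) (h(k := v))) \<partial>transition p \<Omega> \<epsilon> x0 (undo \<epsilon> x0) S2 k h)"
proof (cases "wins \<Omega> y \<delta> x0 k h")
  case True
  have "wins \<Omega> y \<delta> x0 (Suc k) (h(k := v))" for v
  proof -
    have "wins \<Omega> y \<delta> x0 k (h(k := v))"
      using True wins_cong[of k "h(k := v)" h \<Omega> y \<delta> x0] by simp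
    then show ?thesis unfolding wins_def using le_SucI by blast
  qed
  then have "(\<integral>\<^sup>+v. ennreal (val S \<delta> N (Suc k) (h(k := v))) \<partial>transition p \<Omega> \<epsilon> x0 (undo \<epsilon> x0) S2 k h) =
      emeasure (transition p \<Omega> \<epsilon> x0 (undo \<epsilon> x0) S2 k h) (space (transition p \<Omega> \<epsilon> x0 (undo \<epsilon> x0) S2 k h))"
    by (simp add: val_def)
  also have "\<dots> = 1"
    using prob_space_transition[OF op p \<epsilon> x0 strategy_undo[OF \<epsilon>] S2 h]
    by (rule prob_space.emeasure_space_1)
  finally show ?thesis using val_bounds by simp
next
  case notwin: False
  define x z q m where "x = position x0 h k" and "z = noise x0 h k" and "q = debt h k" and "m = N - Suc k"
  define \<zeta> where "\<zeta> = (1 / \<epsilon>) *\<^sub>R (z - y)"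
  have Nk: "N - k = Suc m" using N by (simp add: m_def)
  show ?thesis
  proof (cases "on_track k h \<and> radius \<zeta> q < S")
    case False
    then have "val S \<delta> N k h = 0"
      using notwin Nk by (auto simp: val_def \<zeta>_def z_def q_def)
    then show ?thesis by simp
  next
    case True
    then have tr: "on_track k h" and rad: "radius \<zeta> q < S" by auto
    then have x\<Omega>: "x \<in> \<Omega>" by (auto simp: on_track_def x_def)
    \<comment> \<open>With count 0 the position is z itself and still in \<Omega>, so the walk is
      not yet on the target and the recursion of \<open>hit\<close> takes its \<open>walk\<close>
      branch.\<close>
    have "\<not> (\<zeta> \<in> target \<and> q = 0)"
    proof
      assume *: "\<zeta> \<in> target \<and> q = 0"
      then have "x = z" using tr by (auto simp: on_track_def x_def z_def q_def)
      moreover have "y + \<epsilon> *\<^sub>R \<zeta> = z" using \<epsilon> by (simp add: \<zeta>_def)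
      ultimately show False using * x\<Omega> by (simp add: target_def)
    qed
    then have "hit target S (Suc m) \<zeta> q = walk (hit target S m) \<zeta> q"
      using rad by auto
    moreover have "val S \<delta> N k h = hit target S (Suc m) \<zeta> q"
      using notwin tr unfolding Nk[symmetric] by (simp add: val_def \<zeta>_def z_def q_def)
    ultimately have val: "val S \<delta> N k h = walk (hit target S m) \<zeta> q" by simp
    let ?V = "\<lambda>v. val S \<delta> N (Suc k) (h(k := v))"
    note ge = val_step_ge[OF tr N rad[unfolded \<zeta>_def z_def q_def] room]
    have s1: "undo \<epsilon> x0 k h \<in> ball x \<epsilon>"
      using strategy_undo[OF \<epsilon>] h x\<Omega> by (auto simp: strategy_def x_def)
    have s2: "S2 k h \<in> ball x \<epsilon>"
      using S2 h x\<Omega> by (auto simp: strategy_def x_def)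
    have V0: "hit target S m \<zeta> (q - 1) \<le> ?V (0, undo \<epsilon> x0 k h)"
      using ge[of 0 "undo \<epsilon> x0 k h"] s1 by (simp add: x_def m_def \<zeta>_def z_def q_def)
    have V1: "hit target S m \<zeta> (Suc q) \<le> ?V (1, S2 k h)"
      using ge[of 1 "S2 k h"] s2 by (simp add: x_def m_def \<zeta>_def z_def q_def)
    have V2: "hit target S m (\<zeta> + u) q \<le> ?V (2, x + \<epsilon> *\<^sub>R (if norm u < 1 then u else 0))"
      if "norm u < 1" for u
    proof -
      have "x + \<epsilon> *\<^sub>R u \<in> ball x \<epsilon>" using that \<epsilon> by (simp add: dist_norm)
      moreover have "(1 / \<epsilon>) *\<^sub>R (z + (x + \<epsilon> *\<^sub>R u - x) - y) = \<zeta> + u"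
        using \<epsilon> by (simp add: \<zeta>_def algebra_simps)
      ultimately show ?thesis
        using ge[of 2 "x + \<epsilon> *\<^sub>R u"] that by (simp add: x_def[symmetric] m_def z_def q_def)
    qed
    have V_meas: "(\<lambda>v. ennreal (?V v)) \<in> borel_measurable (round_space \<Omega> \<epsilon>)"
    proof -
      have "(\<lambda>v. h(k := v)) \<in> measurable (round_space \<Omega> \<epsilon>) (history_space \<Omega> \<epsilon> (Suc k))"
        using h unfolding history_space_def
        by (intro measurable_fun_upd[where J = "{0..<k}"]) auto
      from measurable_compose[OF this val_measurable] show ?thesis by simp
    qed
    let ?a = "game_alpha TYPE('n) p / 2"
    have bd: "\<bar>hit target S m z q\<bar> \<le> 1" for z q
      using hit_bounds by (simp add: abs_le_iff order_trans[of _ 0])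
    have int: "integrable ball_step (\<lambda>u. hit target S m (\<zeta> + u) q)"
      by (rule integrable_shift[OF hit_meas bd])
    have "ennreal (walk (hit target S m) \<zeta> q) =
        ennreal ?a * ennreal (hit target S m \<zeta> (q - 1)) + ennreal ?a * ennreal (hit target S m \<zeta> (Suc q))
        + ennreal (1 - 2 * ?a) * ennreal (LINT u|ball_step. hit target S m (\<zeta> + u) q)"
    proof -
      have nn: "0 \<le> (LINT u|ball_step. hit target S m (\<zeta> + u) q)"
        using hit_bounds by (intro Bochner_Integration.integral_nonneg) auto
      have gen: "ennreal (A * r + A * s + B * t) =
          ennreal A * ennreal r + ennreal A * ennreal s + ennreal B * ennreal t"
        if "0 \<le> A" "0 \<le> B" "0 \<le> r" "0 \<le> s" "0 \<le> t" for A B r s t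
        using that by (simp add: ennreal_plus ennreal_mult')
      show ?thesis
        unfolding walk_def using a_pos a_less by (intro gen nn hit_bounds) simp_all
    qed
    also have "ennreal (LINT u|ball_step. hit target S m (\<zeta> + u) q) = (\<integral>\<^sup>+u. ennreal (hit target S m (\<zeta> + u) q) \<partial>ball_step)"
      using hit_bounds by (intro nn_integral_eq_integral[OF int, symmetric]) auto
    also have "ennreal ?a * ennreal (hit target S m \<zeta> (q - 1)) + ennreal ?a * ennreal (hit target S m \<zeta> (Suc q))
        + ennreal (1 - 2 * ?a) * (\<integral>\<^sup>+u. ennreal (hit target S m (\<zeta> + u) q) \<partial>ball_step) \<le>
        ennreal ?a * ennreal (?V (0, undo \<epsilon> x0 k h)) + ennreal ?a * ennreal (?V (1, S2 k h))
        + ennreal (1 - 2 * ?a) * (\<integral>\<^sup>+u. ennreal (?V (2, x + \<epsilon> *\<^sub>R (if norm u < 1 then u else 0))) \<partial>ball_step)"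
      using V0 V1 V2 AE_ball_step
      by (intro add_mono mult_left_mono ennreal_leI nn_integral_mono_AE) (auto elim!: eventually_mono intro: ennreal_leI)
    also have "\<dots> = (\<integral>\<^sup>+v. ennreal (?V v) \<partial>move_measure p \<Omega> \<epsilon> (undo \<epsilon> x0 k h) (S2 k h) x)"
      unfolding cancelled_walk_game_alpha(2)[OF p]
      by (rule nn_integral_move_measure[OF op \<epsilon> x\<Omega> s1 s2 V_meas, symmetric])
    also have "\<dots> = (\<integral>\<^sup>+v. ennreal (?V v) \<partial>transition p \<Omega> \<epsilon> x0 (undo \<epsilon> x0) S2 k h)"
      using x\<Omega> by (simp add: transition_def x_def)
    finally show ?thesis unfolding val .
  qed
qed

text \<open>The submartingale starts at the hitting probability and after N rounds is dominated by
  the indicator of \<open>wins\<close>. The event involves N rounds only, so its probability agrees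
  under the N-step kernel and under the measure on infinite sequences.\<close>

lemma game_measure_wins_ge:
  assumes S2: "strategy \<Omega> \<epsilon> x0 S2" and room: "\<epsilon> * (S + S / sqrt weight + 1) \<le> \<delta>"
  shows "ennreal (hit target S N ((1 / \<epsilon>) *\<^sub>R (x0 - y)) 0) \<le>
    emeasure (game_measure p \<Omega> \<epsilon> x0 (undo \<epsilon> x0) S2)
      {\<omega> \<in> space (game_measure p \<Omega> \<epsilon> x0 (undo \<epsilon> x0) S2). wins \<Omega> y \<delta> x0 N \<omega>}"
proof -
  interpret IT: Ionescu_Tulcea "transition p \<Omega> \<epsilon> x0 (undo \<epsilon> x0) S2" "\<lambda>_. round_space \<Omega> \<epsilon>"
    by (rule Ionescu_Tulcea_transition[OF op p \<epsilon> x0 strategy_undo[OF \<epsilon>] S2])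
  let ?H = "\<lambda>k :: nat. PiM {0..<k} (\<lambda>_. round_space \<Omega> \<epsilon>)"
  let ?C = "\<lambda>k. IT.C 0 k (\<lambda>_. undefined)"
  have u: "(\<lambda>_. undefined) \<in> space (?H 0)" by (simp add: space_PiM)
  have sC: "sets (?C k) = sets (?H k)" "space (?C k) = space (?H k)" for k
    using IT.sets_C[OF u, of k] IT.space_C[OF u, of k] by simp_all
  have vm: "(\<lambda>h. ennreal (val S \<delta> N k h)) \<in> borel_measurable (?H k)" for k
    using val_measurable[of S \<delta> N k] by (simp add: history_space_def)
  have "(\<integral>\<^sup>+h. ennreal (val S \<delta> N 0 h) \<partial>?C 0) \<le> (\<integral>\<^sup>+h. ennreal (val S \<delta> N k h) \<partial>?C k)" if "k \<le> N" for k
    using that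
  proof (induction k)
    case 0
    show ?case by (rule order_refl)
  next
    case (Suc k)
    have "(\<integral>\<^sup>+h. ennreal (val S \<delta> N 0 h) \<partial>?C 0) \<le> (\<integral>\<^sup>+h. ennreal (val S \<delta> N k h) \<partial>?C k)"
      using Suc by simp
    also have "\<dots> \<le> (\<integral>\<^sup>+h. (\<integral>\<^sup>+v. ennreal (val S \<delta> N (Suc k) (h(k := v))) \<partial>transition p \<Omega> \<epsilon> x0 (undo \<epsilon> x0) S2 k h) \<partial>?C k)"
      using Suc.prems by (intro nn_integral_mono val_submartingale_step[OF S2 _ room]) (auto simp: sC history_space_def)
    also have "\<dots> = (\<integral>\<^sup>+h. (\<integral>\<^sup>+h'. ennreal (val S \<delta> N (Suc k) h') \<partial>IT.eP k h) \<partial>?C k)"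
      by (intro nn_integral_cong IT.nn_integral_eP[symmetric] vm) (simp add: sC)
    also have "\<dots> = (\<integral>\<^sup>+h'. ennreal (val S \<delta> N (Suc k) h') \<partial>?C (Suc k))"
    proof -
      have "IT.eP (0 + k) \<in> measurable (?C k) (subprob_algebra (?H (Suc k)))"
        unfolding measurable_cong_sets[OF sC(1) refl] using IT.measurable_eP[of k] by simp
      from nn_integral_bind[OF vm this] show ?thesis by simp
    qed
    finally show ?case .
  qed
  from this[of N] have "(\<integral>\<^sup>+h. ennreal (val S \<delta> N 0 h) \<partial>?C 0) \<le> (\<integral>\<^sup>+h. ennreal (val S \<delta> N N h) \<partial>?C N)"
    by simp
  also have "(\<integral>\<^sup>+h. ennreal (val S \<delta> N 0 h) \<partial>?C 0) = ennreal (hit target S N ((1 / \<epsilon>) *\<^sub>R (x0 - y)) 0)"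
  proof -
    have "(\<integral>\<^sup>+h. ennreal (val S \<delta> N 0 h) \<partial>?C 0) = ennreal (val S \<delta> N 0 (\<lambda>_. undefined))"
      using nn_integral_return[OF u vm[of 0]] by simp
    then show ?thesis using x0 by (simp add: val_def wins_def on_track_def)
  qed
  also have "(\<integral>\<^sup>+h. ennreal (val S \<delta> N N h) \<partial>?C N) \<le> (\<integral>\<^sup>+h. indicator {h \<in> space (?H N). wins \<Omega> y \<delta> x0 N h} h \<partial>?C N)"
  proof (rule nn_integral_mono)
    fix h assume h: "h \<in> space (?C N)"
    \<comment> \<open>With no rounds left \<open>hit\<close> is nonzero only on the target with debt
      0, and there being on track would put the position both inside and outside \<Omega>.\<close>
    have "val S \<delta> N N h = 0" if "\<not> wins \<Omega> y \<delta> x0 N h"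
    proof -
      have False if tr: "on_track N h" and *: "(1 / \<epsilon>) *\<^sub>R (noise x0 h N - y) \<in> target" "debt h N = 0"
      proof -
        have "position x0 h N = noise x0 h N" "position x0 h N \<in> \<Omega>"
          using tr *(2) by (auto simp: on_track_def)
        then show False using *(1) \<epsilon> by (simp add: target_def)
      qed
      then show ?thesis using that by (auto simp: val_def)
    qed
    then show "ennreal (val S \<delta> N N h) \<le> indicator {h \<in> space (?H N). wins \<Omega> y \<delta> x0 N h} h"
      using h val_bounds by (auto simp: sC indicator_def)
  qed
  also have "\<dots> = emeasure (?C N) {h \<in> space (?H N). wins \<Omega> y \<delta> x0 N h}"
    using wins_measurable[OF op order_refl, where k = N and \<epsilon> = \<epsilon> and y = y and \<delta> = \<delta> and ?x0.0 = x0]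
    by (intro nn_integral_indicator) (simp add: sC pred_def)
  also have "\<dots> = emeasure (IT.CI {0..<N}) {h \<in> space (?H N). wins \<Omega> y \<delta> x0 N h}"
  proof -
    have X: "{h \<in> space (?H N). wins \<Omega> y \<delta> x0 N h} \<in> sets (?H N)"
      using wins_measurable[OF op order_refl, where k = N and \<epsilon> = \<epsilon> and y = y and \<delta> = \<delta> and ?x0.0 = x0] by (simp add: pred_def)
    show ?thesis
      using IT.emeasure_CI[OF order_refl X] prod_emb_id[of "{h \<in> space (?H N). wins \<Omega> y \<delta> x0 N h}" "{0..<N}" "\<lambda>_. round_space \<Omega> \<epsilon>"]
      by (simp add: space_PiM)
  qed
  also have "\<dots> = emeasure IT.PF.lim (IT.PF.emb UNIV {0..<N} {h \<in> space (?H N). wins \<Omega> y \<delta> x0 N h})"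
    using wins_measurable[OF op order_refl, where k = N and \<epsilon> = \<epsilon> and y = y and \<delta> = \<delta> and ?x0.0 = x0]
    by (intro IT.lim[symmetric]) (simp_all add: pred_def)
  also have "IT.PF.emb UNIV {0..<N} {h \<in> space (?H N). wins \<Omega> y \<delta> x0 N h} = {\<omega> \<in> space IT.PF.lim. wins \<Omega> y \<delta> x0 N \<omega>}"
  proof -
    have "wins \<Omega> y \<delta> x0 N (restrict \<omega> {0..<N}) = wins \<Omega> y \<delta> x0 N \<omega>" for \<omega>
      by (rule wins_cong) simp
    then show ?thesis by (auto simp: prod_emb_def space_PiM)
  qed
  finally show ?thesis by (simp add: game_measure_def)
qed

end

section \<open>The exit event and the choice of constants\<close>

lemma exit_time_eq:
  "exit_time \<Omega> \<epsilon> x0 \<omega> = (if \<exists>k. position x0 \<omega> k \<in> boundary_strip \<Omega> \<epsilon>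
    then enat (LEAST k. position x0 \<omega> k \<in> boundary_strip \<Omega> \<epsilon>) else \<infinity>)"
proof (cases "\<exists>k. position x0 \<omega> k \<in> boundary_strip \<Omega> \<epsilon>")
  case True
  define j where "j = (LEAST k. position x0 \<omega> k \<in> boundary_strip \<Omega> \<epsilon>)"
  have j: "position x0 \<omega> j \<in> boundary_strip \<Omega> \<epsilon>"
    unfolding j_def using True by (rule LeastI_ex)
  have "exit_time \<Omega> \<epsilon> x0 \<omega> = enat j"
    unfolding exit_time_def
  proof (rule antisym)
    show "(INF k\<in>{k. position x0 \<omega> k \<in> boundary_strip \<Omega> \<epsilon>}. enat k) \<le> enat j"
      using j by (intro INF_lower) simp
    show "enat j \<le> (INF k\<in>{k. position x0 \<omega> k \<in> boundary_strip \<Omega> \<epsilon>}. enat k)"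
      unfolding j_def by (intro INF_greatest) (simp add: Least_le)
  qed
  then show ?thesis using True by (simp add: j_def)
next
  case False
  then have "{k. position x0 \<omega> k \<in> boundary_strip \<Omega> \<epsilon>} = {}" by blast
  then show ?thesis using False by (simp add: exit_time_def top_enat_def)
qed

text \<open>Along sequences in the product space all positions lie in the enlarged domain, where
  belonging to the boundary strip means being outside \<Omega>. So the exit time is the first time
  outside \<Omega>.\<close>

lemma exit_in_ball_iff_wins:
  fixes \<Omega> :: "(real ^ 'n) set"
  assumes x0: "x0 \<in> \<Omega>" and \<omega>: "\<omega> \<in> space (PiM UNIV (\<lambda>_::nat. round_space \<Omega> \<epsilon>))"
  shows "exit_time \<Omega> \<epsilon> x0 \<omega> < \<infinity> \<and>
      position x0 \<omega> (the_enat (exit_time \<Omega> \<epsilon> x0 \<omega>)) \<in> ball y \<delta> \<inter> - \<Omega> \<longleftrightarrow>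
    (\<exists>N. wins \<Omega> y \<delta> x0 N \<omega>)"
proof -
  have "position x0 \<omega> k \<in> enlarged_domain \<Omega> \<epsilon>" for k
  proof (cases k)
    case (Suc j)
    have "\<omega> j \<in> space (round_space \<Omega> \<epsilon>)" using \<omega> by (auto simp: space_PiM)
    then show ?thesis by (auto simp: Suc space_round_space)
  qed (use x0 in \<open>simp add: enlarged_domain_def\<close>)
  then have strip: "position x0 \<omega> k \<in> boundary_strip \<Omega> \<epsilon> \<longleftrightarrow> position x0 \<omega> k \<notin> \<Omega>" for k
    by (auto simp: enlarged_domain_def boundary_strip_def)
  let ?P = "\<lambda>k. position x0 \<omega> k \<notin> \<Omega>"
  have first: "position x0 \<omega> j \<notin> \<Omega> \<and> (\<forall>i<j. position x0 \<omega> i \<in> \<Omega>) \<longleftrightarrow> (\<exists>k. ?P k) \<and> j = (LEAST k. ?P k)" for j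
  proof
    assume *: "position x0 \<omega> j \<notin> \<Omega> \<and> (\<forall>i<j. position x0 \<omega> i \<in> \<Omega>)"
    then have "(LEAST k. ?P k) = j"
      by (intro Least_equality) (auto simp: not_le[symmetric])
    then show "(\<exists>k. ?P k) \<and> j = (LEAST k. ?P k)" using * by auto
  next
    assume "(\<exists>k. ?P k) \<and> j = (LEAST k. ?P k)"
    then show "position x0 \<omega> j \<notin> \<Omega> \<and> (\<forall>i<j. position x0 \<omega> i \<in> \<Omega>)"
      using LeastI_ex[of ?P] not_less_Least[of _ ?P] by auto
  qed
  have "(\<exists>N. wins \<Omega> y \<delta> x0 N \<omega>) \<longleftrightarrow>
      (\<exists>j. position x0 \<omega> j \<in> ball y \<delta> \<and> (position x0 \<omega> j \<notin> \<Omega> \<and> (\<forall>i<j. position x0 \<omega> i \<in> \<Omega>)))"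
    unfolding wins_def by blast
  also have "\<dots> \<longleftrightarrow> (\<exists>k. ?P k) \<and> position x0 \<omega> (LEAST k. ?P k) \<in> ball y \<delta>"
    unfolding first by blast
  also have "\<dots> \<longleftrightarrow> exit_time \<Omega> \<epsilon> x0 \<omega> < \<infinity> \<and>
      position x0 \<omega> (the_enat (exit_time \<Omega> \<epsilon> x0 \<omega>)) \<in> ball y \<delta> \<inter> - \<Omega>"
    using LeastI_ex[of ?P] by (auto simp: exit_time_eq strip)
  finally show ?thesis ..
qed

lemma exit_in_ball_measurable:
  fixes \<Omega> :: "(real ^ 'n) set"
  assumes "open \<Omega>" "x0 \<in> \<Omega>"
  shows "{\<omega> \<in> space (PiM UNIV (\<lambda>_::nat. round_space \<Omega> \<epsilon>)). exit_time \<Omega> \<epsilon> x0 \<omega> < \<infinity> \<and>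
      position x0 \<omega> (the_enat (exit_time \<Omega> \<epsilon> x0 \<omega>)) \<in> ball y \<delta> \<inter> - \<Omega>}
    \<in> sets (PiM UNIV (\<lambda>_::nat. round_space \<Omega> \<epsilon>))"
proof -
  have "{\<omega> \<in> space (PiM UNIV (\<lambda>_::nat. round_space \<Omega> \<epsilon>)). \<exists>N. wins \<Omega> y \<delta> x0 N \<omega>}
      \<in> sets (PiM UNIV (\<lambda>_::nat. round_space \<Omega> \<epsilon>))"
    using wins_measurable[OF assms(1) subset_UNIV, where \<epsilon> = \<epsilon> and y = y and \<delta> = \<delta> and ?x0.0 = x0]
    unfolding pred_def by (intro sets.sets_Collect_countable_Ex)
  then show ?thesis
    by (rule back_subst[where P = "\<lambda>A. A \<in> _"]) (use exit_in_ball_iff_wins[OF assms(2)] in blast)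
qed

text \<open>The density condition is scale invariant: the Jacobian factor cancels, so the same c
  serves for every \<epsilon>.\<close>

lemma (in cancelling_game) density_target:
  fixes c r :: real
  assumes r: "0 < r"
    and dens: "c * measure lebesgue (ball y (\<epsilon> * r)) \<le> measure lebesgue ((- \<Omega>) \<inter> ball y (\<epsilon> * r))"
  shows "c * measure lborel (ball (0 :: real ^ 'n) r) \<le> measure lborel (target \<inter> ball 0 r)"
proof -
  have \<Omega>: "- \<Omega> \<in> sets borel" using op by auto
  have scale: "measure lebesgue A = \<epsilon> ^ CARD('n) * measure lborel ((\<lambda>u. y + \<epsilon> *\<^sub>R u) -` A)"
    if "A \<in> sets borel" for A :: "(real ^ 'n) set"
  proof -
    have "measure lebesgue A = measure lborel A"
      using that by (simp add: measure_completion)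
    also have "\<dots> = \<epsilon> ^ DIM(real ^ 'n) * measure lborel ((\<lambda>u. y + \<epsilon> *\<^sub>R u) -` A)"
      unfolding measure_def emeasure_lborel_affine[OF \<epsilon> that, of y] enn2real_mult
      using \<epsilon> by simp
    finally show ?thesis by simp
  qed
  have "(\<lambda>u. y + \<epsilon> *\<^sub>R u) -` ball y (\<epsilon> * r) = ball 0 r"
    using \<epsilon> by (auto simp: dist_norm)
  moreover from this have "(\<lambda>u. y + \<epsilon> *\<^sub>R u) -` ((- \<Omega>) \<inter> ball y (\<epsilon> * r)) = target \<inter> ball 0 r"
    by (auto simp: target_def)
  ultimately have "\<epsilon> ^ CARD('n) * (c * measure lborel (ball (0 :: real ^ 'n) r)) \<le>
      \<epsilon> ^ CARD('n) * measure lborel (target \<inter> ball 0 r)"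
    using dens scale[of "ball y (\<epsilon> * r)"] scale[of "(- \<Omega>) \<inter> ball y (\<epsilon> * r)"] \<Omega>
    by (simp add: mult_ac)
  then show ?thesis using \<epsilon> by simp
qed

theorem theorem3p7:
  fixes \<Omega> :: "(real ^ 'n) set" and y :: "real ^ 'n" and p :: real
  assumes "2 < p"
    and "bounded \<Omega>" and "\<Omega> \<noteq> {}" and "open \<Omega>"
    and "y \<in> frontier \<Omega>"
    and "measure_density_condition \<Omega> y"
  shows "game_regular p \<Omega> y"
  unfolding game_regular_def
proof (intro allI impI)
  fix \<delta> \<eta> :: real assume \<delta>: "0 < \<delta>" and \<eta>: "0 < \<eta>"
  interpret W: cancelled_walk "game_alpha TYPE('n) p / 2" "TYPE(real ^ 'n)"
    by (rule cancelled_walk_game_alpha(1)[OF assms(1)])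
  obtain c where c: "0 < c" and
    dens: "\<And>r. 0 < r \<Longrightarrow> c * measure lebesgue (ball y r) \<le> measure lebesgue ((- \<Omega>) \<inter> ball y r)"
    using assms(6) by (auto simp: measure_density_condition_def)
  obtain s\<^sub>0 k where s0: "1 \<le> s\<^sub>0" and likely: "\<And>T S (z :: real ^ 'n) q. T \<in> sets borel \<Longrightarrow>
      (\<And>r. 1 \<le> r \<Longrightarrow> c * measure lborel (ball (0 :: real ^ 'n) r) \<le> measure lborel (T \<inter> ball 0 r)) \<Longrightarrow>
      s\<^sub>0 \<le> S / 16 ^ k \<Longrightarrow> W.radius z q < S / 16 ^ k \<Longrightarrow> \<exists>N. 1 - \<eta> < W.hit T S N z q"
  proof (rule W.hit_likely[OF c \<eta>])
    fix s k
    assume s: "1 \<le> s" and l: "\<And>T S z q. T \<in> sets borel \<Longrightarrow>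
      (\<And>r. 1 \<le> r \<Longrightarrow> c * measure lborel (ball (0 :: real ^ 'n) r) \<le> measure lborel (T \<inter> ball 0 r)) \<Longrightarrow>
      s \<le> S / 16 ^ k \<Longrightarrow> W.radius z q < S / 16 ^ k \<Longrightarrow> \<exists>N. 1 - \<eta> < W.hit T S N z q"
    show thesis
      by (rule that[OF s l])
  qed
  define b where "b = sqrt (W.weight)"
  \<comment> \<open>L turns the sum S + S / b in \<open>room\<close> into the product S * L.\<close>
  define L where "L = 1 + 1 / b"
  \<comment> \<open>The factor 4 makes the innermost radius S / 16 ^ k at least 2 * \<delta>0 /
    \<epsilon>: one half for the distance of \<open>x0\<close> from y, the other for
    \<open>s\<^sub>0\<close> and b.\<close>
  define \<delta>0 where "\<delta>0 = \<delta> / (4 * L * 16 ^ k)"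
  \<comment> \<open>The first bound gives \<delta> / \<epsilon> - 1 \<ge> \<delta> / (2 *
    \<epsilon>), the second \<open>s\<^sub>0\<close> + b < \<delta>0 / \<epsilon>.\<close>
  define \<epsilon>0 where "\<epsilon>0 = min (\<delta> / 2) (\<delta>0 / (s\<^sub>0 + b))"
  have b: "0 < b" using W.weight_pos by (simp add: b_def)
  have L: "1 \<le> L" using b by (simp add: L_def)
  have \<delta>0: "0 < \<delta>0" using \<delta> L by (simp add: \<delta>0_def)
  have \<epsilon>0: "0 < \<epsilon>0" using \<delta> \<delta>0 s0 b by (simp add: \<epsilon>0_def)
  show "\<exists>\<delta>0>0. \<exists>\<epsilon>0>0. \<forall>\<epsilon>. 0 < \<epsilon> \<and> \<epsilon> < \<epsilon>0 \<longrightarrow>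
        (\<forall>x0 \<in> ball y \<delta>0 \<inter> \<Omega>. \<exists>S1. strategy \<Omega> \<epsilon> x0 S1 \<and>
            (\<forall>S2. strategy \<Omega> \<epsilon> x0 S2 \<longrightarrow>
              measure (game_measure p \<Omega> \<epsilon> x0 S1 S2)
                {\<omega> \<in> space (game_measure p \<Omega> \<epsilon> x0 S1 S2).
                  exit_time \<Omega> \<epsilon> x0 \<omega> < \<infinity> \<and>
                  position x0 \<omega> (the_enat (exit_time \<Omega> \<epsilon> x0 \<omega>)) \<in> ball y \<delta> \<inter> - \<Omega>}
              \<ge> 1 - \<eta>))"
  proof (rule exI[of _ \<delta>0], intro conjI \<delta>0, rule exI[of _ \<epsilon>0], intro conjI \<epsilon>0 allI impI ballI)
    fix \<epsilon> x0 assume \<epsilon>': "0 < \<epsilon> \<and> \<epsilon> < \<epsilon>0" and near: "x0 \<in> ball y \<delta>0 \<inter> \<Omega>"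
    then have \<epsilon>: "0 < \<epsilon>" and x0\<Omega>: "x0 \<in> \<Omega>" by auto
    interpret cancelling_game p \<epsilon> \<Omega> x0 y
      by standard (use assms \<epsilon> x0\<Omega> in auto)
    \<comment> \<open>The value of S for which \<open>room\<close> holds with equality.\<close>
    define S where "S = (\<delta> / \<epsilon> - 1) / L"
    have room: "\<epsilon> * (S + S / sqrt W.weight + 1) \<le> \<delta>"
    proof -
      have "S + S / sqrt W.weight = S * L" by (simp add: L_def b_def algebra_simps)
      also have "\<dots> = \<delta> / \<epsilon> - 1" using L by (simp add: S_def)
      finally show ?thesis using \<epsilon> by simp
    qed
    have e2: "2 * \<epsilon> < \<delta>" "\<epsilon> * (s\<^sub>0 + b) < \<delta>0"
      using \<epsilon>' s0 b by (auto simp: \<epsilon>0_def pos_less_divide_eq)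
    have "\<delta> / (2 * \<epsilon>) \<le> \<delta> / \<epsilon> - 1"
      using e2 \<epsilon> by (simp add: field_simps)
    then have "\<delta> / (2 * \<epsilon>) / L / 16 ^ k \<le> S / 16 ^ k"
      unfolding S_def using L by (intro divide_right_mono) auto
    moreover have "\<delta> / (2 * \<epsilon>) / L / 16 ^ k = 2 * (\<delta>0 / \<epsilon>)"
      by (simp add: \<delta>0_def)
    moreover have *: "s\<^sub>0 + b < \<delta>0 / \<epsilon>"
      using e2 \<epsilon> by (simp add: pos_less_divide_eq mult.commute)
    ultimately have S1: "s\<^sub>0 \<le> S / 16 ^ k" and S2: "\<delta>0 / \<epsilon> + b < S / 16 ^ k"
      using s0 b by linarith+
    have rad: "W.radius ((1 / \<epsilon>) *\<^sub>R (x0 - y)) 0 < S / 16 ^ k"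
    proof -
      have "W.radius ((1 / \<epsilon>) *\<^sub>R (x0 - y)) 0 \<le> norm ((1 / \<epsilon>) *\<^sub>R (x0 - y)) + norm (b * (1 / 2))"
        unfolding W.radius_def b_def of_nat_0 add_0 by (rule norm_Pair_le)
      also have "\<dots> \<le> norm (x0 - y) / \<epsilon> + b"
        using \<epsilon> b by simp
      also have "norm (x0 - y) / \<epsilon> < \<delta>0 / \<epsilon>"
      proof (rule divide_strict_right_mono[OF _ \<open>0 < \<epsilon>\<close>])
        have "dist y x0 < \<delta>0" using near by simp
        then show "norm (x0 - y) < \<delta>0" by (simp add: dist_norm norm_minus_commute)
      qed
      finally show ?thesis using S2 by simp
    qed
    have dens': "c * measure lborel (ball (0 :: real ^ 'n) r) \<le> measure lborel (target \<inter> ball 0 r)" if "1 \<le> r" for r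
      using that \<epsilon> by (intro density_target dens) auto
    obtain N where N: "1 - \<eta> < W.hit target S N ((1 / \<epsilon>) *\<^sub>R (x0 - y)) 0"
      using likely[OF target_borel dens' S1 rad] by blast
    show "\<exists>S1. strategy \<Omega> \<epsilon> x0 S1 \<and>
            (\<forall>S2. strategy \<Omega> \<epsilon> x0 S2 \<longrightarrow>
              measure (game_measure p \<Omega> \<epsilon> x0 S1 S2)
                {\<omega> \<in> space (game_measure p \<Omega> \<epsilon> x0 S1 S2).
                  exit_time \<Omega> \<epsilon> x0 \<omega> < \<infinity> \<and>
                  position x0 \<omega> (the_enat (exit_time \<Omega> \<epsilon> x0 \<omega>)) \<in> ball y \<delta> \<inter> - \<Omega>}
              \<ge> 1 - \<eta>)"
    proof (intro exI[of _ "undo \<epsilon> x0"] conjI strategy_undo[OF \<epsilon>] allI impI)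
      fix S2 assume S2: "strategy \<Omega> \<epsilon> x0 S2"
      let ?G = "game_measure p \<Omega> \<epsilon> x0 (undo \<epsilon> x0) S2"
      let ?E = "{\<omega> \<in> space ?G. exit_time \<Omega> \<epsilon> x0 \<omega> < \<infinity> \<and>
          position x0 \<omega> (the_enat (exit_time \<Omega> \<epsilon> x0 \<omega>)) \<in> ball y \<delta> \<inter> - \<Omega>}"
      interpret G: prob_space ?G
        by (rule prob_space_game_measure[OF op p \<epsilon> x0\<Omega> strategy_undo[OF \<epsilon>] S2])
      interpret IT: Ionescu_Tulcea "transition p \<Omega> \<epsilon> x0 (undo \<epsilon> x0) S2" "\<lambda>_. round_space \<Omega> \<epsilon>"
        by (rule Ionescu_Tulcea_transition[OF op p \<epsilon> x0\<Omega> strategy_undo[OF \<epsilon>] S2])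
      have sG: "space ?G = space (PiM UNIV (\<lambda>_::nat. round_space \<Omega> \<epsilon>))"
        "sets ?G = sets (PiM UNIV (\<lambda>_::nat. round_space \<Omega> \<epsilon>))"
        by (simp_all add: game_measure_def)
      have E: "?E \<in> sets ?G"
        unfolding sG by (rule exit_in_ball_measurable[OF op x0\<Omega>])
      have "ennreal (1 - \<eta>) \<le> ennreal (W.hit target S N ((1 / \<epsilon>) *\<^sub>R (x0 - y)) 0)"
        using N by (intro ennreal_leI) simp
      also have "\<dots> \<le> emeasure ?G {\<omega> \<in> space ?G. wins \<Omega> y \<delta> x0 N \<omega>}"
        by (rule game_measure_wins_ge[OF S2 room])
      also have "\<dots> \<le> emeasure ?G ?E"
      proof (rule emeasure_mono[OF _ E])
        show "{\<omega> \<in> space ?G. wins \<Omega> y \<delta> x0 N \<omega>} \<subseteq> ?E"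
          using exit_in_ball_iff_wins[OF x0\<Omega>, where \<epsilon> = \<epsilon> and y = y and \<delta> = \<delta>] unfolding sG by blast
      qed
      finally have "ennreal (1 - \<eta>) \<le> ennreal (measure ?G ?E)"
        by (simp add: G.emeasure_eq_measure)
      then show "1 - \<eta> \<le> measure ?G ?E"
        by (simp add: ennreal_le_iff)
    qed
  qed
qed

end
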